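(* Let $d\geq 2$ and let $\Gamma\subset\mathbb{R}^d$ be a full-rank lattice. The $d$-dimensional flat torus $\mathbb{T}_\Gamma=\mathbb{R}^d/\Gamma$ has the inverse localization property if and only if the quadratic form $Q_\Gamma$ is a (real) multiple of a quadratic form with integer coefficients.
   Context: Functions are real-valued. Write $\Gamma=A_\Gamma\mathbb{Z}^d$ with $A_\Gamma\in \mathrm{GL}_d(\mathbb{R})$ and set $B_\Gamma:=(A_\Gamma^{*})^{-1}$ (star denotes transpose), so the dual lattice is $\Gamma^*=B_\Gamma\mathbb{Z}^d$. The positive-definite quadratic form $Q_\Gamma$ is $Q_\Gamma(k):=4\pi^2|B_\Gamma k|^2$; the Laplace eigenvalues of $\mathbb{T}_\Gamma$ are $\lambda_k=Q_\Gamma(k)$, $k\in\mathbb{Z}^d$. A Laplace eigenfunction $u$ on $\mathbb{T}_\Gamma$ with eigenvalue $\lambda\ge 0$ is viewed as a $\Gamma$-periodic function on $\mathbb{R}^d$ with $\Delta u+\lambda u=0$. A quadratic form $\sum_{1\leq i\leq j\leq d} b_{ij}k_ik_j$ has integer coefficients if $b_{ij}\in\mathbb{Z}$ for all $i\le j$ (so the coefficient of $k_ik_j$, $i<j$, need not be even). Inverse localization property: $\mathbb{T}_\Gamma$ has it if for any solution $h$ of the Helmholtz equation $\Delta h+h=0$ on $\mathbb{R}^d$, any ball $B\subset\mathbb{R}^d$ and any positive integer $l$, there exists a sequence of Laplace eigenfunctions $u_n$ on $\mathbb{T}_\Gamma$ with eigenvalues $\lambda_n\to\infty$ such that $\lim_{n\to\infty}\|u_n(\cdot/\sqrt{\lambda_n})-h\|_{C^l(B)}=0$.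 *)

theory Defs
  imports "HOL-Analysis.Analysis"
begin

definition partial_deriv :: "'n::finite \<Rightarrow> (real^'n \<Rightarrow> real) \<Rightarrow> real^'n \<Rightarrow> real" where
  "partial_deriv i f x = frechet_derivative f (at x) (axis i 1)"

definition iterated_partial :: "'n::finite list \<Rightarrow> (real^'n \<Rightarrow> real) \<Rightarrow> real^'n \<Rightarrow> real" where
  "iterated_partial is f = foldr partial_deriv is f"

text \<open>Meant for open \<open>S\<close>, where differentiability on \<open>S\<close> is differentiability at each point of \<open>S\<close>.\<close>

fun Ck_on :: "nat \<Rightarrow> (real^'n::finite \<Rightarrow> real) \<Rightarrow> (real^'n) set \<Rightarrow> bool" where
  "Ck_on 0 f S \<longleftrightarrow> continuous_on S f"
| "Ck_on (Suc k) f S \<longleftrightarrow> f differentiable_on S \<and> (\<forall>i. Ck_on k (partial_deriv i f) S)"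

text \<open>
  The norm of \<open>C\<^sup>l(S)\<close> for open \<open>S\<close>: the supremum over \<open>S\<close> of all partial derivatives of order
  at most \<open>l\<close>. A list of directions of length \<open>m\<close> stands for a partial derivative of order \<open>m\<close>;
  for \<open>C\<^sup>l\<close> functions the order of the list is irrelevant. The value is \<open>\<infinity>\<close> for functions that are
  not in \<open>C\<^sup>l(S)\<close>, so that junk values of \<^const>\<open>frechet_derivative\<close> play no role.
\<close>

definition Cl_norm :: "nat \<Rightarrow> (real^'n::finite) set \<Rightarrow> (real^'n \<Rightarrow> real) \<Rightarrow> ennreal" where
  "Cl_norm l S f =
     (if Ck_on l f S
      then (SUP is \<in> {is. length is \<le> l}. SUP x \<in> S. ennreal \<bar>iterated_partial is f x\<bar>)
      else \<infinity>)"

definition laplacian :: "(real^'n::finite \<Rightarrow> real) \<Rightarrow> real^'n \<Rightarrow> real" where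
  "laplacian f x = (\<Sum>i\<in>UNIV. partial_deriv i (partial_deriv i f) x)"

text \<open>Classical (\<open>C\<^sup>2\<close>) solutions on the whole space of \<open>\<Delta>f + \<mu>f = 0\<close>.\<close>

definition helmholtz_solution :: "real \<Rightarrow> (real^'n::finite \<Rightarrow> real) \<Rightarrow> bool" where
  "helmholtz_solution \<mu> f \<longleftrightarrow> Ck_on 2 f UNIV \<and> (\<forall>x. laplacian f x + \<mu> * f x = 0)"

definition lattice_of :: "real^'n^'n::finite \<Rightarrow> (real^'n) set" where
  "lattice_of A = {A *v k | k. \<forall>i. k $ i \<in> \<int>}"

definition laplace_eigenfunction ::
    "(real^'n::finite) set \<Rightarrow> real \<Rightarrow> (real^'n \<Rightarrow> real) \<Rightarrow> bool" where
  "laplace_eigenfunction \<Gamma> \<mu> u \<longleftrightarrow>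
     \<mu> \<ge> 0 \<and> (\<exists>x. u x \<noteq> 0) \<and> (\<forall>x. \<forall>\<gamma>\<in>\<Gamma>. u (x + \<gamma>) = u x) \<and> helmholtz_solution \<mu> u"

text \<open>
  Since \<open>\<mu> n\<close> tends to infinity, the division by zero that occurs where \<open>\<mu> n = 0\<close> affects
  only finitely many \<open>n\<close>.
\<close>

definition inverse_localization :: "(real^'n::finite) set \<Rightarrow> bool" where
  "inverse_localization \<Gamma> \<longleftrightarrow>
     (\<forall>h a r l. helmholtz_solution 1 h \<and> r > 0 \<and> l \<ge> 1 \<longrightarrow>
        (\<exists>u \<mu>. (\<forall>n. laplace_eigenfunction \<Gamma> (\<mu> n) (u n)) \<and>
               filterlim \<mu> at_top sequentially \<and>
               (\<lambda>n. Cl_norm l (ball a r) (\<lambda>x. u n (x /\<^sub>R sqrt (\<mu> n)) - h x)) \<longlonglongrightarrow> 0))"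

definition lattice_form :: "real^'n^'n::finite \<Rightarrow> real^'n \<Rightarrow> real" where
  "lattice_form A k = 4 * pi\<^sup>2 * (norm (matrix_inv (transpose A) *v k))\<^sup>2"

text \<open>
  The order on the index type is used only to list each monomial \<open>k\<^sub>i k\<^sub>j\<close> once; the coefficients
  of the mixed monomials need not be even.
\<close>

definition integral_quadratic_form :: "(real^'n::{finite,linorder} \<Rightarrow> real) \<Rightarrow> bool" where
  "integral_quadratic_form q \<longleftrightarrow>
     (\<exists>b :: 'n \<Rightarrow> 'n \<Rightarrow> int.
        \<forall>k. q k = (\<Sum>(i, j) \<in> {(i, j). i \<le> j}. of_int (b i j) * (k $ i) * (k $ j)))"

end

theory Submission
  imports Defs
begin

text \<open>
  Integral form implies localization: superpositions of plane waves with frequencies on the unit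
  sphere are locally uniformly dense in the solutions of the Helmholtz equation on the whole space.
  An interior gradient estimate (by a comparison function on a half ball) makes every solution an
  entire analytic function with superexponentially decaying Taylor coefficients. A solution is
  determined by its Cauchy data on a hyperplane; applying the rotation fields
  \<open>x\<^sub>t \<partial>\<^sub>j - x\<^sub>j \<partial>\<^sub>t\<close> repeatedly to plane waves produces all polynomial Cauchy data, and truncating the
  Cauchy data of a given solution yields approximations. Locally uniform approximation is
  \<open>C\<^sup>l\<close> approximation by the gradient estimate. If the form is integral up to a factor,
  reflecting one rational point of an ellipsoid \<open>Q = const\<close> at rational directions shows
  that its rational points are dense, so the frequencies can be moved to rational points of the
  ellipsoid; clearing denominators turns the sum of waves into an eigenfunction of the torus.

  Conversely, if two coefficients of the form are rationally independent, apply to \<open>Q\<close> a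
  rational-linear functional of the reals that kills one of them but not the other. This gives a
  quadratic form that is not a multiple of \<open>Q\<close> but is constant on the integer points of each
  level set of \<open>Q\<close>. Hence all eigenfunctions satisfy a second differential equation of order
  two, which survives in the limit and is violated by a sum of two plane waves.
\<close>

section \<open>Calculus of partial derivatives and Helmholtz solutions\<close>

text \<open>Approximation is measured by locally uniform convergence throughout; the gradient
  estimate upgrades it to convergence of derivatives. Being a solution is only a C^2 condition, so
  derivatives of solutions are not known to be solutions at the start; difference quotients, which
  are, supply the regularity. Truncating Cauchy data works because of a balance of constants. With
  \<open>d\<close> the dimension, expressing a derivative of order \<open>m\<close> at 0 through
  Cauchy data costs at most \<open>d ^ m\<close>, and Taylor's formula on the ball of radius
  \<open>R\<close> costs \<open>(d * R) ^ m / fact m\<close>. So the Cauchy data must decay like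
  \<open>\<epsilon> ^ m * fact m\<close> with \<open>\<epsilon>\<close> small compared to
  \<open>1 / (d * d * R)\<close>. Every \<open>\<epsilon>\<close> is available, since a solution on
  the whole space can be estimated on balls of any size. In the converse the rational-linear
  functional \<open>\<phi>\<close> is discontinuous, so the eigenvalues do not control the constants
  \<open>\<phi> \<mu> / \<mu>\<close> of the second equation. They converge nevertheless, because
  the limit function is chosen nonzero at the origin.\<close>

lemma partial_deriv_eqI:
  fixes f :: "real^'n::finite \<Rightarrow> real"
  assumes "(f has_derivative (\<lambda>h. \<Sum>j\<in>UNIV. h $ j * g j)) (at x)"
  shows "partial_deriv i f x = g i"
proof -
  have "partial_deriv i f x = (\<Sum>j\<in>UNIV. axis i 1 $ j * g j)"
    unfolding partial_deriv_def by (simp add: frechet_derivative_at[OF assms, symmetric])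
  also have "\<dots> = (\<Sum>j\<in>UNIV. if j = i then g j else 0)"
    by (intro sum.cong) (auto simp: axis_def)
  finally show ?thesis by simp
qed

lemma has_derivative_partial_deriv:
  fixes f :: "real^'n::finite \<Rightarrow> real"
  assumes "f differentiable (at x)"
  shows "(f has_derivative (\<lambda>h. \<Sum>j\<in>UNIV. h $ j * partial_deriv j f x)) (at x)"
proof -
  let ?f' = "frechet_derivative f (at x)"
  have d: "(f has_derivative ?f') (at x)"
    using assms frechet_derivative_works by blast
  then have lin: "linear ?f'"
    using has_derivative_linear by blast
  have "?f' h = (\<Sum>j\<in>UNIV. h $ j * partial_deriv j f x)" for h
  proof -
    have "?f' h = ?f' (\<Sum>j\<in>UNIV. (h $ j) *\<^sub>R axis j 1)"
      using basis_expansion[of h] by (simp add: scalar_mult_eq_scaleR)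
    also have "\<dots> = (\<Sum>j\<in>UNIV. h $ j * ?f' (axis j 1))"
      by (simp add: linear_sum[OF lin] linear_cmul[OF lin])
    finally show ?thesis by (simp add: partial_deriv_def)
  qed
  then have "?f' = (\<lambda>h. \<Sum>j\<in>UNIV. h $ j * partial_deriv j f x)" by blast
  with d show ?thesis by simp
qed

lemma helmholtz_solutionI:
  fixes u :: "real^'n::finite \<Rightarrow> real"
  assumes u: "\<And>x. (u has_derivative (\<lambda>h. \<Sum>i\<in>UNIV. h $ i * g i x)) (at x)"
    and g: "\<And>i x. (g i has_derivative (\<lambda>h. \<Sum>j\<in>UNIV. h $ j * H j i x)) (at x)"
    and H: "\<And>i j. continuous_on UNIV (H j i)"
    and eq: "\<And>x. (\<Sum>i\<in>UNIV. H i i x) + \<mu> * u x = 0"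
  shows "helmholtz_solution \<mu> u"
proof -
  have 1: "partial_deriv i u = g i" for i
    using partial_deriv_eqI[OF u] by blast
  have 2: "partial_deriv j (g i) = H j i" for i j
    using partial_deriv_eqI[OF g] by blast
  have "u differentiable (at x)" "g i differentiable (at x)" for x i
    using u g differentiable_def by blast+
  then show ?thesis
    using H eq
    by (auto simp: helmholtz_solution_def laplacian_def numeral_2_eq_2 1 2
        intro!: differentiable_at_imp_differentiable_on)
qed

lemma helmholtz_solutionD:
  fixes u :: "real^'n::finite \<Rightarrow> real"
  assumes "helmholtz_solution \<mu> u"
  shows "(u has_derivative (\<lambda>h. \<Sum>i\<in>UNIV. h $ i * partial_deriv i u x)) (at x)"
    and "(partial_deriv i u has_derivative
          (\<lambda>h. \<Sum>j\<in>UNIV. h $ j * partial_deriv j (partial_deriv i u) x)) (at x)"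
    and "continuous_on UNIV (partial_deriv j (partial_deriv i u))"
    and "(\<Sum>i\<in>UNIV. partial_deriv i (partial_deriv i u) x) = - \<mu> * u x"
  using assms
  by (auto simp: helmholtz_solution_def laplacian_def numeral_2_eq_2 differentiable_on_def
      eq_neg_iff_add_eq_0 intro!: has_derivative_partial_deriv)

lemma helmholtz_solution_continuous:
  assumes "helmholtz_solution \<mu> u"
  shows "continuous_on X u" "continuous_on X (partial_deriv i u)"
  using helmholtz_solutionD(1,2)[OF assms]
  by (meson continuous_at_imp_continuous_on has_derivative_continuous)+

lemma partial_deriv_lincomb:
  fixes u :: "real^'n::finite \<Rightarrow> real"
  assumes "u differentiable (at x)" "v differentiable (at x)"
  shows "partial_deriv i (\<lambda>x. a * u x + b * v x) x = a * partial_deriv i u x + b * partial_deriv i v x"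
  by (rule partial_deriv_eqI) (auto intro!: derivative_eq_intros
      has_derivative_partial_deriv[OF assms(1)] has_derivative_partial_deriv[OF assms(2)]
      simp: sum_distrib_left sum.distrib algebra_simps)

lemma helmholtz_lincomb:
  assumes u: "helmholtz_solution \<mu> u" and v: "helmholtz_solution \<mu> v"
  shows "helmholtz_solution \<mu> (\<lambda>x. a * u x + b * v x)"
proof (rule helmholtz_solutionI)
  show "((\<lambda>x. a * u x + b * v x) has_derivative
      (\<lambda>h. \<Sum>i\<in>UNIV. h $ i * (a * partial_deriv i u x + b * partial_deriv i v x))) (at x)" for x
    by (auto intro!: derivative_eq_intros helmholtz_solutionD(1)[OF u] helmholtz_solutionD(1)[OF v]
        simp: sum_distrib_left sum.distrib algebra_simps)
  show "((\<lambda>x. a * partial_deriv i u x + b * partial_deriv i v x) has_derivative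
      (\<lambda>h. \<Sum>j\<in>UNIV. h $ j * (a * partial_deriv j (partial_deriv i u) x
         + b * partial_deriv j (partial_deriv i v) x))) (at x)" for x i
    by (auto intro!: derivative_eq_intros helmholtz_solutionD(2)[OF u] helmholtz_solutionD(2)[OF v]
        simp: sum_distrib_left sum.distrib algebra_simps)
  show "continuous_on UNIV (\<lambda>x. a * partial_deriv j (partial_deriv i u) x
         + b * partial_deriv j (partial_deriv i v) x)" for i j
    by (intro continuous_intros helmholtz_solutionD(3)[OF u] helmholtz_solutionD(3)[OF v])
  show "(\<Sum>i\<in>UNIV. a * partial_deriv i (partial_deriv i u) x + b * partial_deriv i (partial_deriv i v) x)
      + \<mu> * (a * u x + b * v x) = 0" for x
    using helmholtz_solutionD(4)[OF u, of x] helmholtz_solutionD(4)[OF v, of x]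
    by (simp add: sum.distrib flip: sum_distrib_left) (simp add: algebra_simps)
qed

lemma partial_deriv_helmholtz_lincomb:
  assumes u: "helmholtz_solution \<mu> u" and v: "helmholtz_solution \<mu> v"
  shows "partial_deriv i (\<lambda>x. a * u x + b * v x) = (\<lambda>x. a * partial_deriv i u x + b * partial_deriv i v x)"
  using helmholtz_solutionD(1)[OF u] helmholtz_solutionD(1)[OF v]
  by (intro ext partial_deriv_lincomb) (auto simp: differentiable_def)

lemma has_derivative_affine_compose:
  fixes u :: "real^'n::finite \<Rightarrow> real"
  assumes "\<And>x. (u has_derivative (\<lambda>h. \<Sum>i\<in>UNIV. h $ i * g i x)) (at x)"
  shows "((\<lambda>x. u (s *\<^sub>R x + a)) has_derivative (\<lambda>h. \<Sum>i\<in>UNIV. h $ i * (s * g i (s *\<^sub>R x + a)))) (at x)"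
proof -
  have "((\<lambda>x. s *\<^sub>R x + a) has_derivative (\<lambda>h. s *\<^sub>R h)) (at x)"
    by (auto intro!: derivative_eq_intros)
  from has_derivative_compose[OF this assms] show ?thesis
    by (simp add: algebra_simps)
qed

lemma helmholtz_affine:
  assumes u: "helmholtz_solution \<mu> u" and "\<nu> = \<mu> * s\<^sup>2"
  shows "helmholtz_solution \<nu> (\<lambda>x. u (s *\<^sub>R x + a))"
proof (rule helmholtz_solutionI)
  show "((\<lambda>x. u (s *\<^sub>R x + a)) has_derivative
      (\<lambda>h. \<Sum>i\<in>UNIV. h $ i * (s * partial_deriv i u (s *\<^sub>R x + a)))) (at x)" for x
    by (rule has_derivative_affine_compose) (rule helmholtz_solutionD(1)[OF u])
  show "((\<lambda>x. s * partial_deriv i u (s *\<^sub>R x + a)) has_derivative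
      (\<lambda>h. \<Sum>j\<in>UNIV. h $ j * (s * (s * partial_deriv j (partial_deriv i u) (s *\<^sub>R x + a))))) (at x)" for i x
    using has_derivative_mult_right[OF has_derivative_affine_compose[OF helmholtz_solutionD(2)[OF u]], of s]
    by (simp add: sum_distrib_left mult.left_commute)
  show "continuous_on UNIV (\<lambda>x. s * (s * partial_deriv j (partial_deriv i u) (s *\<^sub>R x + a)))" for i j
    by (intro continuous_intros continuous_on_compose2[OF helmholtz_solutionD(3)[OF u, of j i]]) auto
  show "(\<Sum>i\<in>UNIV. s * (s * partial_deriv i (partial_deriv i u) (s *\<^sub>R x + a))) + \<nu> * u (s *\<^sub>R x + a) = 0" for x
    using helmholtz_solutionD(4)[OF u, of "s *\<^sub>R x + a"]
    by (simp add: assms(2) power2_eq_square flip: sum_distrib_left)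
qed

lemma partial_deriv_affine:
  assumes u: "helmholtz_solution \<mu> u"
  shows "partial_deriv i (\<lambda>x. u (s *\<^sub>R x + a)) = (\<lambda>x. s * partial_deriv i u (s *\<^sub>R x + a))"
  by (intro ext partial_deriv_eqI[OF has_derivative_affine_compose]) (rule helmholtz_solutionD(1)[OF u])

lemma has_derivative_plane_wave:
  fixes \<xi> :: "real^'n::finite"
  shows "((\<lambda>x. a * cos (\<xi> \<bullet> x + \<phi>)) has_derivative
    (\<lambda>h. \<Sum>i\<in>UNIV. h $ i * (a * \<xi> $ i * cos (\<xi> \<bullet> x + (\<phi> + pi / 2))))) (at x)"
proof -
  have "cos (\<xi> \<bullet> x + (\<phi> + pi / 2)) = - sin (\<xi> \<bullet> x + \<phi>)"
    by (simp add: add.assoc[symmetric] minus_sin_cos_eq)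
  moreover have "((\<lambda>x. a * cos (\<xi> \<bullet> x + \<phi>)) has_derivative
      (\<lambda>h. a * (- ((\<xi> \<bullet> h) * sin (\<xi> \<bullet> x + \<phi>))))) (at x)"
    by (auto intro!: derivative_eq_intros)
  ultimately show ?thesis
    by (simp add: inner_vec_def sum_distrib_left sum_distrib_right algebra_simps flip: sum_negf)
qed

lemma partial_deriv_plane_wave:
  fixes \<xi> :: "real^'n::finite"
  shows "partial_deriv i (\<lambda>x. a * cos (\<xi> \<bullet> x + \<phi>)) = (\<lambda>x. a * \<xi> $ i * cos (\<xi> \<bullet> x + (\<phi> + pi / 2)))"
  by (intro ext partial_deriv_eqI has_derivative_plane_wave)

lemma helmholtz_plane_wave:
  fixes \<xi> :: "real^'n::finite"
  assumes "\<mu> = (norm \<xi>)\<^sup>2"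
  shows "helmholtz_solution \<mu> (\<lambda>x. a * cos (\<xi> \<bullet> x + \<phi>))"
proof (rule helmholtz_solutionI[OF has_derivative_plane_wave has_derivative_plane_wave])
  show "continuous_on UNIV (\<lambda>x. a * \<xi> $ i * \<xi> $ j * cos (\<xi> \<bullet> x + (\<phi> + pi / 2 + pi / 2)))" for i j
    by (intro continuous_intros)
  have c: "cos (\<xi> \<bullet> x + (\<phi> + pi / 2 + pi / 2)) = - cos (\<xi> \<bullet> x + \<phi>)" for x
    by (metis (no_types, lifting) add.assoc cos_periodic_pi field_sum_of_halves)
  have n: "(\<Sum>i\<in>UNIV. a * \<xi> $ i * \<xi> $ i * c) = a * (norm \<xi>)\<^sup>2 * c" for c
    by (simp add: power2_norm_eq_inner inner_vec_def sum_distrib_left sum_distrib_right algebra_simps)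
  have "(\<Sum>i\<in>UNIV. a * \<xi> $ i * \<xi> $ i * cos (\<xi> \<bullet> x + (\<phi> + pi / 2 + pi / 2)))
      = - (a * (norm \<xi>)\<^sup>2 * cos (\<xi> \<bullet> x + \<phi>))" for x
    by (simp only: c n mult_minus_right sum_negf)
  then show "(\<Sum>i\<in>UNIV. a * \<xi> $ i * \<xi> $ i * cos (\<xi> \<bullet> x + (\<phi> + pi / 2 + pi / 2)))
      + \<mu> * (a * cos (\<xi> \<bullet> x + \<phi>)) = 0" for x
    by (simp add: assms)
qed

lemma has_real_derivative_along_axis:
  fixes f :: "real^'n::finite \<Rightarrow> real"
  assumes "\<And>x. (f has_derivative (\<lambda>h. \<Sum>i\<in>UNIV. h $ i * g i x)) (at x)"
  shows "((\<lambda>s. f (x + (c * s) *\<^sub>R axis i 1)) has_real_derivative c * g i (x + (c * s) *\<^sub>R axis i 1)) (at s)"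
proof -
  have 1: "((\<lambda>s. x + (c * s) *\<^sub>R axis i 1) has_derivative (\<lambda>h. (c * h) *\<^sub>R axis i 1)) (at s)"
    by (auto intro!: derivative_eq_intros)
  have "(\<Sum>j\<in>UNIV. ((c * h) *\<^sub>R axis i 1 :: real^'n) $ j * g j y) = h * (c * g i y)" for h y
  proof -
    have "(\<Sum>j\<in>UNIV. ((c * h) *\<^sub>R axis i 1 :: real^'n) $ j * g j y)
        = (\<Sum>j\<in>UNIV. if j = i then c * h * g j y else 0)"
      by (intro sum.cong) (auto simp: axis_def)
    then show ?thesis by simp
  qed
  with has_derivative_compose[OF 1 assms] show ?thesis
    unfolding has_field_derivative_def by (simp add: mult.commute[of _ "c * g i _"])
qed

lemma second_derivative_nonneg_at_min:
  fixes p :: "real \<Rightarrow> real"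
  assumes p: "\<And>s. (p has_real_derivative p' s) (at s)" and p': "(p' has_real_derivative c) (at 0)"
    and d: "d > 0" and min: "\<And>s. \<bar>s\<bar> < d \<Longrightarrow> p 0 \<le> p s"
  shows "c \<ge> 0"
proof (rule ccontr)
  assume "\<not> c \<ge> 0"
  have 0: "p' 0 = 0"
    using DERIV_local_min[OF p d, of 0] min by simp
  obtain e where e: "e > 0" "\<And>h. 0 < h \<Longrightarrow> h < e \<Longrightarrow> p' h < 0"
    using DERIV_neg_dec_right[OF p'] \<open>\<not> c \<ge> 0\<close> 0 by fastforce
  define s where "s = min d e / 2"
  have s: "0 < s" "s < d" "s < e" using d e by (auto simp: s_def)
  obtain z where "0 < z" "z < s" "p s - p 0 = (s - 0) * p' z"
    using MVT2[OF s(1) p] by blast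
  then have "p s < p 0"
    using e(2)[of z] s mult_pos_neg[of s "p' z"] by auto
  then show False using min[of s] s by auto
qed

section \<open>An interior gradient estimate\<close>

text \<open>
  The function \<open>\<psi>\<close> below dominates the odd part \<open>\<phi>\<close> of \<open>u\<close> in the coordinate \<open>t\<close> on the boundary of a
  half ball, and its Laplacian is so negative that \<open>\<psi> - \<phi>\<close> has no negative interior minimum. Both
  functions vanish at the centre, so this bounds the derivative there.
\<close>

lemma gradient_estimate_at_0:
  fixes u :: "real^'n::finite \<Rightarrow> real"
  assumes u: "helmholtz_solution 1 u" and \<rho>: "0 < \<rho>" "\<rho> \<le> 1"
    and M: "\<And>x. norm x \<le> \<rho> \<Longrightarrow> \<bar>u x\<bar> \<le> M" and "M > 0"
  shows "partial_deriv t u 0 \<le> (real CARD('n) + 1) * M / \<rho>"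
proof -
  define e where "e = (axis t 1 :: real^'n)"
  define R where "R x = x - (2 * x $ t) *\<^sub>R e" for x
  \<comment> \<open>With \<open>n\<close> the dimension, the Laplacian of \<open>\<psi>\<close> is
    \<open>M / \<rho>\<^sup>2\<close> times \<open>2 * n - 2 * C\<close>; this choice of
    \<open>C\<close> makes it \<open>- 2 * M / \<rho>\<^sup>2\<close>. The map \<open>R\<close> is
    the reflection in the hyperplane \<open>x $ t = 0\<close>.\<close>
  define C where "C = real CARD('n) + 1"
  define \<psi> where "\<psi> x = (M / \<rho>\<^sup>2) * ((norm x)\<^sup>2 + C * (x $ t * (\<rho> - x $ t)))" for x :: "real^'n"
  define \<phi> where "\<phi> x = (u x - u (R x)) / 2" for x
  define g where "g x = \<psi> x - \<phi> x" for x
  define K where "K = cball 0 \<rho> \<inter> {x :: real^'n. 0 \<le> x $ t}"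
  have C1: "C \<ge> 1" by (simp add: C_def)
  have et: "e $ t = 1" by (simp add: e_def)
  have xe: "x \<bullet> e = x $ t" for x by (simp add: e_def inner_axis)
  have ee: "e \<bullet> e = 1" by (simp add: xe et)
  have normR: "norm (R x) = norm x" for x
    by (simp add: R_def norm_eq_sqrt_inner inner_diff_left inner_diff_right xe et ee inner_commute[of e])
  have contu: "continuous_on UNIV u"
    by (rule helmholtz_solution_continuous[OF u])
  have contR: "continuous_on UNIV R"
    unfolding R_def by (intro continuous_intros)
  have contg: "continuous_on K g"
    unfolding g_def \<psi>_def \<phi>_def using \<rho>
    by (intro continuous_intros continuous_on_subset[OF contR]
        continuous_on_compose2[OF contu] ) auto
  have closed: "closed {x :: real^'n. 0 \<le> x $ t}"
    by (simp add: closed_halfspace_component_ge_cart)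
  have compK: "compact K"
    unfolding K_def by (intro compact_Int_closed compact_cball closed)
  have phi_bound: "\<bar>\<phi> x\<bar> \<le> M" if "norm x \<le> \<rho>" for x
    using M[OF that] M[of "R x"] that unfolding \<phi>_def normR by (simp add: abs_le_iff)
  have g_nonneg: "g x \<ge> 0" if "x \<in> K" for x
  proof -
    obtain x0 where x0: "x0 \<in> K" "\<And>y. y \<in> K \<Longrightarrow> g x0 \<le> g y"
      using continuous_attains_inf[OF compK _ contg] \<open>x \<in> K\<close> by auto
    have "g x0 \<ge> 0"
    proof (rule ccontr)
      assume neg: "\<not> g x0 \<ge> 0"
      have x0t: "0 \<le> x0 $ t" "norm x0 \<le> \<rho>" using x0(1) by (auto simp: K_def)
      then have x0r: "x0 $ t \<le> \<rho>"
        using component_le_norm_cart[of x0 t] by linarith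
      have prod: "C * (x0 $ t * (\<rho> - x0 $ t)) \<ge> 0"
        using x0t x0r C1 by simp
      have "norm x0 \<noteq> \<rho>"
      proof
        assume eq: "norm x0 = \<rho>"
        have "M = (M / \<rho>\<^sup>2) * \<rho>\<^sup>2" using \<rho> by simp
        also have "\<dots> \<le> \<psi> x0"
          unfolding \<psi>_def eq using prod \<open>M > 0\<close> by (intro mult_left_mono) auto
        finally show False
          using neg phi_bound[OF x0t(2)] unfolding g_def by linarith
      qed
      then have n0: "norm x0 < \<rho>" using x0t by simp
      have t0: "x0 $ t > 0"
      proof (rule ccontr)
        assume "\<not> ?thesis"
        then have z: "x0 $ t = 0" using x0t by simp
        then have "\<phi> x0 = 0" by (simp add: \<phi>_def R_def)
        moreover have "\<psi> x0 \<ge> 0" using \<open>M > 0\<close> by (simp add: \<psi>_def z)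
        ultimately show False using neg by (simp add: g_def)
      qed
      \<comment> \<open>Moves shorter than \<open>d\<close> along any axis stay in the half ball, so
        every restriction of \<open>g\<close> to an axis through \<open>x0\<close> has a local
        minimum there.\<close>
      define d where "d = min (\<rho> - norm x0) (x0 $ t)"
      have d: "d > 0" using n0 t0 by (simp add: d_def)
      \<comment> \<open>The reflection turns a move by \<open>s\<close> along axis \<open>j\<close>
        into a move by \<open>\<sigma> j * s\<close>.\<close>
      define \<sigma> where "\<sigma> j = (if j = t then -1 else 1 :: real)" for j
      define H where "H j x = partial_deriv j (partial_deriv j u) x" for j x
      have ge: "(M / \<rho>\<^sup>2) * (2 - (if j = t then 2 * C else 0)) - (H j x0 - H j (R x0)) / 2 \<ge> 0" for j
      proof -
        let ?a = "axis j 1 :: real^'n"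
        let ?b = "if j = t then 1 else 0 :: real"
        define p where "p s = g (x0 + s *\<^sub>R ?a)" for s
        have Ra: "R (x0 + s *\<^sub>R ?a) = R x0 + (\<sigma> j * s) *\<^sub>R ?a" for s
          by (auto simp: R_def \<sigma>_def e_def algebra_simps axis_def vec_eq_iff)
        have at: "(x0 + s *\<^sub>R ?a) $ t = x0 $ t + s * ?b" for s
          by (simp add: axis_def)
        have aa: "?a \<bullet> ?a = 1" by (simp add: inner_axis_axis)
        have na: "(norm (x0 + s *\<^sub>R ?a))\<^sup>2 = (norm x0)\<^sup>2 + 2 * s * x0 $ j + s\<^sup>2" for s
          unfolding power2_norm_eq_inner
          by (simp add: inner_add_left inner_add_right inner_axis inner_axis' aa power2_eq_square
              algebra_simps)
        have p_eq: "p = (\<lambda>s. (M / \<rho>\<^sup>2) * ((norm x0)\<^sup>2 + 2 * s * x0 $ j + s\<^sup>2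
            + C * ((x0 $ t + s * ?b) * (\<rho> - (x0 $ t + s * ?b))))
            - (1 / 2) * (u (x0 + (1 * s) *\<^sub>R ?a) - u (R x0 + (\<sigma> j * s) *\<^sub>R ?a)))"
          unfolding p_def g_def \<psi>_def \<phi>_def Ra at na by simp
        define p' where "p' s = (M / \<rho>\<^sup>2) * (2 * x0 $ j + 2 * s + C * ?b * (\<rho> - 2 * (x0 $ t + s * ?b)))
            - (1 / 2) * (1 * partial_deriv j u (x0 + (1 * s) *\<^sub>R ?a)
               - \<sigma> j * partial_deriv j u (R x0 + (\<sigma> j * s) *\<^sub>R ?a))" for s
        have dp: "(p has_real_derivative p' s) (at s)" for s
          unfolding p_eq p'_def
          by (rule derivative_eq_intros refl has_real_derivative_along_axis helmholtz_solutionD(1)[OF u])+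
            (simp add: algebra_simps)
        have dp': "(p' has_real_derivative
            (M / \<rho>\<^sup>2) * (2 - (if j = t then 2 * C else 0)) - (H j x0 - H j (R x0)) / 2) (at 0)"
          unfolding p'_def
          by (rule derivative_eq_intros refl has_real_derivative_along_axis helmholtz_solutionD(2)[OF u])+
            (simp add: H_def \<sigma>_def field_simps)
        show ?thesis
        proof (rule second_derivative_nonneg_at_min[OF dp dp' d])
          fix s :: real assume s: "\<bar>s\<bar> < d"
          have "norm (x0 + s *\<^sub>R ?a) \<le> norm x0 + \<bar>s\<bar>"
            by (rule order.trans[OF norm_triangle_ineq]) simp
          moreover have "x0 $ t + s * ?b \<ge> 0" using s d_def by auto
          ultimately have "x0 + s *\<^sub>R ?a \<in> K"
            using s d_def by (auto simp: K_def axis_def)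
          then show "p 0 \<le> p s" unfolding p_def using x0(2) by simp
        qed
      qed
      \<comment> \<open>The Laplacian of \<open>g\<close> is nonnegative at the minimum. As the
        Laplacian of \<open>\<phi>\<close> is \<open>- \<phi>\<close>, it equals
        \<open>- 2 * M / \<rho>\<^sup>2 + \<phi> x0\<close>, which is at most \<open>- M\<close>
        because \<open>\<rho> \<le> 1\<close> and \<open>\<phi> \<le> M\<close>.\<close>
      have "0 \<le> (\<Sum>j\<in>UNIV. (M / \<rho>\<^sup>2) * (2 - (if j = t then 2 * C else 0)) - (H j x0 - H j (R x0)) / 2)"
        by (intro sum_nonneg ge)
      also have "\<dots> = (M / \<rho>\<^sup>2) * (2 * real CARD('n) - 2 * C)
          - ((\<Sum>j\<in>UNIV. H j x0) - (\<Sum>j\<in>UNIV. H j (R x0))) / 2"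
        by (simp add: sum_subtractf sum_divide_distrib[symmetric] sum_distrib_left[symmetric])
      also have "\<dots> = - (2 * M / \<rho>\<^sup>2) + \<phi> x0"
        using helmholtz_solutionD(4)[OF u, of x0] helmholtz_solutionD(4)[OF u, of "R x0"]
        by (simp add: H_def C_def \<phi>_def field_simps)
      finally have "2 * M / \<rho>\<^sup>2 \<le> M"
        using phi_bound[OF x0t(2)] by linarith
      moreover have "2 * M \<le> 2 * M / \<rho>\<^sup>2"
      proof -
        have "\<rho>\<^sup>2 \<le> 1" using \<rho> by (simp add: power_le_one)
        then have "2 * M * \<rho>\<^sup>2 \<le> 2 * M" using \<open>M > 0\<close> by simp
        then show ?thesis using \<rho> by (simp add: pos_le_divide_eq)
      qed
      ultimately show False using \<open>M > 0\<close> by linarith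
    qed
    then show ?thesis using x0(2)[OF that] by simp
  qed
  \<comment> \<open>Twice the difference of \<open>\<phi>\<close> and the linear bound for
    \<open>\<psi>\<close> along the axis. It vanishes at 0 and is nonpositive to the right, so its
    derivative at 0 is not positive.\<close>
  define q where "q s = u (0 + (1 * s) *\<^sub>R e) - u (0 + ((- 1) * s) *\<^sub>R e) - 2 * s * (C * M / \<rho>)" for s
  have q_le: "q s \<le> 0" if s: "0 < s" "s \<le> \<rho>" for s
  proof -
    have "s *\<^sub>R e \<in> K" using s by (simp add: K_def et e_def)
    then have "\<phi> (s *\<^sub>R e) \<le> \<psi> (s *\<^sub>R e)" using g_nonneg by (auto simp: g_def)
    moreover have "R (s *\<^sub>R e) = (- s) *\<^sub>R e"
      by (simp add: R_def et algebra_simps flip: scaleR_2)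
    moreover have "\<psi> (s *\<^sub>R e) \<le> (M / \<rho>\<^sup>2) * (C * s * \<rho>)"
    proof -
      have "(norm (s *\<^sub>R e))\<^sup>2 = s\<^sup>2" by (simp add: e_def)
      moreover have "s\<^sup>2 \<le> C * s\<^sup>2" using mult_right_mono[OF C1, of "s\<^sup>2"] by simp
      ultimately show ?thesis unfolding \<psi>_def using \<open>M > 0\<close>
        by (intro mult_left_mono) (auto simp: et algebra_simps power2_eq_square)
    qed
    moreover have "(M / \<rho>\<^sup>2) * (C * s * \<rho>) = s * (C * M / \<rho>)"
      using \<rho> by (simp add: power2_eq_square)
    ultimately show ?thesis by (simp add: q_def \<phi>_def)
  qed
  have "(q has_real_derivative 1 * partial_deriv t u (0 + (1 * 0) *\<^sub>R e)
      - (- 1) * partial_deriv t u (0 + ((- 1) * 0) *\<^sub>R e) - 2 * (C * M / \<rho>)) (at 0)"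
    unfolding q_def e_def
    by (rule derivative_eq_intros refl has_real_derivative_along_axis helmholtz_solutionD(1)[OF u])+ simp
  then have dq: "(q has_real_derivative 2 * (partial_deriv t u 0 - C * M / \<rho>)) (at 0)"
    by simp
  have "\<not> 2 * (partial_deriv t u 0 - C * M / \<rho>) > 0"
  proof
    assume "2 * (partial_deriv t u 0 - C * M / \<rho>) > 0"
    from DERIV_pos_inc_right[OF dq this] obtain d where d: "d > 0" "\<And>h. 0 < h \<Longrightarrow> h < d \<Longrightarrow> q 0 < q (0 + h)"
      by auto
    define h where "h = min \<rho> d / 2"
    have h: "0 < h" "h < d" "h \<le> \<rho>" using d \<rho> by (auto simp: h_def)
    have "q 0 = 0" by (simp add: q_def)
    then show False using d(2)[OF h(1,2)] q_le[OF h(1,3)] by simp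
  qed
  then show ?thesis by (simp add: C_def)
qed

text \<open>Translation to the origin, and the one-sided bound for both \<open>u\<close> and
  \<open>- u\<close>. The bound at the origin requires a positive \<open>M\<close>, hence the detour
  over all \<open>M' > M\<close>.\<close>

lemma gradient_estimate:
  fixes u :: "real^'n::finite \<Rightarrow> real"
  assumes u: "helmholtz_solution 1 u" and \<rho>: "0 < \<rho>" "\<rho> \<le> 1"
    and M: "\<And>x. x \<in> cball a \<rho> \<Longrightarrow> \<bar>u x\<bar> \<le> M"
  shows "\<bar>partial_deriv i u a\<bar> \<le> (real CARD('n) + 1) / \<rho> * M"
proof -
  define C where "C = real CARD('n) + 1"
  have C: "C > 0" by (simp add: C_def)
  have key: "\<bar>partial_deriv i u a\<bar> \<le> C * M' / \<rho>" if "M' > M" for M'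
  proof -
    have M': "\<bar>u (a + x)\<bar> \<le> M'" if "norm x \<le> \<rho>" for x
      using M[of "a + x"] \<open>M' > M\<close> that by (simp add: dist_norm)
    have M'_pos: "M' > 0" using M[of a] \<rho> that by auto
    \<comment> \<open>The summand with coefficient 0 only gives \<open>v c\<close> the shape of a
      linear combination of two solutions.\<close>
    define v where "v c x = c * u (1 *\<^sub>R x + a) + 0 * u (1 *\<^sub>R x + a)" for c x
    have hv: "helmholtz_solution 1 (v c)" for c
      unfolding v_def by (intro helmholtz_lincomb helmholtz_affine[OF u]) auto
    have pv: "partial_deriv i (v c) 0 = c * partial_deriv i u a" for c
      unfolding v_def partial_deriv_helmholtz_lincomb[OF helmholtz_affine[OF u refl] helmholtz_affine[OF u refl]]
        partial_deriv_affine[OF u] by simp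
    have "partial_deriv i (v c) 0 \<le> C * M' / \<rho>" if "\<bar>c\<bar> = 1" for c
      unfolding C_def by (rule gradient_estimate_at_0[OF hv \<rho>])
        (use M' M'_pos that in \<open>auto simp: v_def abs_mult add.commute\<close>)
    from this[of 1] this[of "-1"] show ?thesis by (simp add: pv abs_le_iff)
  qed
  have "\<bar>partial_deriv i u a\<bar> \<le> C / \<rho> * M"
  proof (rule field_le_epsilon)
    fix e :: real assume "e > 0"
    have "C * (M + e * \<rho> / C) / \<rho> = C / \<rho> * M + e"
      using C \<rho> by (simp add: field_simps)
    then show "\<bar>partial_deriv i u a\<bar> \<le> C / \<rho> * M + e"
      using key[of "M + e * \<rho> / C"] C \<rho> \<open>e > 0\<close> by simp
  qed
  then show ?thesis by (simp add: C_def)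
qed

section \<open>Regularity and locally uniform limits\<close>

definition locally_uniform_limit :: "(nat \<Rightarrow> real^'n::finite \<Rightarrow> real) \<Rightarrow> (real^'n \<Rightarrow> real) \<Rightarrow> bool" where
  "locally_uniform_limit f F \<longleftrightarrow> (\<forall>R. uniform_limit (cball 0 R) f F sequentially)"

lemma locally_uniform_limitD:
  assumes "locally_uniform_limit f F" "e > 0"
  shows "\<forall>\<^sub>F n in sequentially. \<forall>x\<in>cball 0 R. \<bar>f n x - F x\<bar> < e"
  using assms by (auto simp: locally_uniform_limit_def uniform_limit_iff dist_real_def)

lemma locally_uniform_limitI:
  assumes "\<And>R e. R > 0 \<Longrightarrow> e > 0 \<Longrightarrow> \<forall>\<^sub>F n in sequentially. \<forall>x\<in>cball 0 R. \<bar>f n x - F x\<bar> < e"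
  shows "locally_uniform_limit f F"
  unfolding locally_uniform_limit_def uniform_limit_iff dist_real_def
proof (intro allI impI)
  fix R e :: real assume "e > 0"
  show "\<forall>\<^sub>F n in sequentially. \<forall>x\<in>cball 0 R. \<bar>f n x - F x\<bar> < e"
    by (rule eventually_mono[OF assms[of "max R 1" e]]) (use \<open>e > 0\<close> in auto)
qed

lemma locally_uniform_limit_pointwise:
  assumes "locally_uniform_limit f F"
  shows "(\<lambda>n. f n x) \<longlonglongrightarrow> F x"
proof -
  have "uniform_limit (cball 0 (norm x)) f F sequentially"
    using assms by (simp add: locally_uniform_limit_def)
  then show ?thesis by (rule tendsto_uniform_limitI) simp
qed

lemma locally_uniform_limit_derivative:
  fixes f :: "nat \<Rightarrow> real^'n::finite \<Rightarrow> real"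
  assumes f: "\<And>n x. (f n has_derivative (\<lambda>h. \<Sum>j\<in>UNIV. h $ j * g j n x)) (at x)"
    and F: "locally_uniform_limit f F"
    and g: "\<And>j R. uniformly_Cauchy_on (cball 0 R) (g j)"
    and G: "\<And>j x. G j x = lim (\<lambda>n. g j n x)"
  shows "locally_uniform_limit (g j) (G j)"
    and "(F has_derivative (\<lambda>h. \<Sum>j\<in>UNIV. h $ j * G j x)) (at x)"
proof -
  have G': "locally_uniform_limit (g j) (G j)" for j
    unfolding locally_uniform_limit_def G[abs_def]
    using Cauchy_uniformly_convergent[OF g] uniformly_convergent_uniform_limit_iff by blast
  then show "locally_uniform_limit (g j) (G j)" .
  define S where "S = ball (0 :: real^'n) (norm x + 1)"
  have x: "x \<in> S" by (simp add: S_def)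
  have nle: "\<forall>\<^sub>F n in sequentially. \<forall>y\<in>S. \<forall>h.
      norm ((\<Sum>j\<in>UNIV. h $ j * g j n y) - (\<Sum>j\<in>UNIV. h $ j * G j y)) \<le> e * norm h"
    if "e > 0" for e
  proof -
    define \<epsilon> where "\<epsilon> = e / real CARD('n)"
    have \<epsilon>: "\<epsilon> > 0" using that by (simp add: \<epsilon>_def)
    have "\<forall>\<^sub>F n in sequentially. \<forall>j. \<forall>y\<in>cball 0 (norm x + 1). \<bar>g j n y - G j y\<bar> < \<epsilon>"
      using locally_uniform_limitD[OF G' \<epsilon>] by (simp add: eventually_all_finite)
    then show ?thesis
    proof eventually_elim
      case (elim n)
      show ?case
      proof (intro ballI allI)
        fix y h assume "y \<in> S"
        then have y: "y \<in> cball 0 (norm x + 1)" by (simp add: S_def)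
        have "norm ((\<Sum>j\<in>UNIV. h $ j * g j n y) - (\<Sum>j\<in>UNIV. h $ j * G j y))
            = \<bar>\<Sum>j\<in>UNIV. h $ j * (g j n y - G j y)\<bar>"
          by (simp add: right_diff_distrib sum_subtractf)
        also have "\<dots> \<le> (\<Sum>j\<in>UNIV. \<bar>h $ j * (g j n y - G j y)\<bar>)"
          by (rule sum_abs)
        also have "\<dots> \<le> (\<Sum>j\<in>(UNIV :: 'n set). norm h * \<epsilon>)"
          unfolding abs_mult
          by (intro sum_mono mult_mono component_le_norm_cart) (use elim y in \<open>auto intro: less_imp_le\<close>)
        also have "\<dots> = e * norm h" by (simp add: \<epsilon>_def)
        finally show "norm ((\<Sum>j\<in>UNIV. h $ j * g j n y) - (\<Sum>j\<in>UNIV. h $ j * G j y)) \<le> e * norm h" .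
      qed
    qed
  qed
  have "\<exists>K. \<forall>y\<in>S. (\<lambda>n. f n y) \<longlonglongrightarrow> K y
      \<and> (K has_derivative (\<lambda>h. \<Sum>j\<in>UNIV. h $ j * G j y)) (at y within S)"
    by (rule has_derivative_sequence[OF _ f[THEN has_derivative_at_withinI] nle x
          locally_uniform_limit_pointwise[OF F]]) (simp_all add: S_def)
  then obtain K where K: "\<And>y. y \<in> S \<Longrightarrow> (\<lambda>n. f n y) \<longlonglongrightarrow> K y"
    "\<And>y. y \<in> S \<Longrightarrow> (K has_derivative (\<lambda>h. \<Sum>j\<in>UNIV. h $ j * G j y)) (at y within S)"
    by blast
  have "K y = F y" if "y \<in> S" for y
    using LIMSEQ_unique[OF K(1)[OF that] locally_uniform_limit_pointwise[OF F]] .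
  then have "(F has_derivative (\<lambda>h. \<Sum>j\<in>UNIV. h $ j * G j x)) (at x within S)"
    by (intro has_derivative_transform[OF x _ K(2)[OF x]]) simp
  then show "(F has_derivative (\<lambda>h. \<Sum>j\<in>UNIV. h $ j * G j x)) (at x)"
    using x at_within_open[of x S] by (simp add: S_def)
qed

text \<open>The mean value theorem replaces the quotient by \<open>f'\<close> at an intermediate
  parameter, and \<open>f'\<close> is uniformly continuous on a compact set of parameters and
  points. Translations and rotations of solutions are differentiated in this way.\<close>

lemma locally_uniform_difference_quotient:
  fixes f :: "real \<Rightarrow> real^'n::finite \<Rightarrow> real"
  assumes f: "\<And>x \<theta>. ((\<lambda>\<theta>. f \<theta> x) has_real_derivative f' \<theta> x) (at \<theta>)"
    and f': "continuous_on UNIV (\<lambda>(\<theta>, x). f' \<theta> x)"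
  shows "locally_uniform_limit (\<lambda>n x. (f (inverse (real (Suc n))) x - f 0 x) / inverse (real (Suc n))) (f' 0)"
proof (rule locally_uniform_limitI)
  fix R e :: real assume "R > 0" "e > 0"
  have "uniformly_continuous_on ({0..1} \<times> cball 0 R) (\<lambda>(\<theta>, x). f' \<theta> x)"
    by (intro compact_uniformly_continuous compact_Times continuous_on_subset[OF f']) auto
  from uniformly_continuous_onE[OF this \<open>e > 0\<close>]
  obtain d where d: "d > 0" "\<And>p q. p \<in> {0..1} \<times> cball 0 R \<Longrightarrow> q \<in> {0..1} \<times> cball 0 R \<Longrightarrow> dist q p < d
      \<Longrightarrow> dist (case q of (\<theta>, x) \<Rightarrow> f' \<theta> x) (case p of (\<theta>, x) \<Rightarrow> f' \<theta> x) < e"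
    by metis
  define s where "s n = inverse (real (Suc n))" for n
  have "\<forall>\<^sub>F n in sequentially. s n < min d 1"
    unfolding s_def using LIMSEQ_inverse_real_of_nat by (rule order_tendstoD) (use d in simp)
  then show "\<forall>\<^sub>F n in sequentially. \<forall>x\<in>cball 0 R.
      \<bar>(f (inverse (real (Suc n))) x - f 0 x) / inverse (real (Suc n)) - f' 0 x\<bar> < e"
    unfolding s_def[symmetric]
  proof eventually_elim
    case (elim n)
    have sn: "s n > 0" by (simp add: s_def)
    show ?case
    proof
      fix x :: "real^'n" assume x: "x \<in> cball 0 R"
      obtain z where z: "0 < z" "z < s n" "f (s n) x - f 0 x = (s n - 0) * f' z x"
        using MVT2[OF sn f] by blast
      have "dist (z, x) (0, x) < d"
        using z elim by (simp add: dist_Pair_Pair)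
      then have "dist (f' z x) (f' 0 x) < e"
        using d(2)[of "(0, x)" "(z, x)"] x z elim by auto
      then show "\<bar>(f (s n) x - f 0 x) / s n - f' 0 x\<bar> < e"
        using z sn by (simp add: dist_real_def)
    qed
  qed
qed

section \<open>Regularity from difference quotients\<close>

definition grad_const :: "'n::finite itself \<Rightarrow> real" where
  "grad_const _ = real CARD('n) + 1"

lemma grad_const_ge_1: "grad_const TYPE('n::finite) \<ge> 1"
  by (simp add: grad_const_def)

lemma difference_quotient_mvt:
  fixes u :: "real^'n::finite \<Rightarrow> real"
  assumes "helmholtz_solution \<mu> u" "s > 0"
  obtains z where "0 < z" "z < s"
    "(u (x + s *\<^sub>R axis i 1) - u x) / s = partial_deriv i u (x + z *\<^sub>R axis i 1)"
proof -
  obtain z where "0 < z" "z < s"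
    "u (x + (1 * s) *\<^sub>R axis i 1) - u (x + (1 * 0) *\<^sub>R axis i 1)
      = (s - 0) * (1 * partial_deriv i u (x + (1 * z) *\<^sub>R axis i 1))"
    using MVT2[OF assms(2) has_real_derivative_along_axis[OF helmholtz_solutionD(1)[OF assms(1)]]]
    by blast
  with that show ?thesis using assms(2) by simp
qed

lemma helmholtz_difference_quotient:
  assumes u: "helmholtz_solution \<mu> u"
  shows "helmholtz_solution \<mu> (\<lambda>x. (u (x + a) - u x) / s)"
    and "partial_deriv j (\<lambda>x. (u (x + a) - u x) / s)
      = (\<lambda>x. (partial_deriv j u (x + a) - partial_deriv j u x) / s)"
proof -
  have eq: "(\<lambda>x. (u (x + a) - u x) / s) = (\<lambda>x. (1 / s) * u (1 *\<^sub>R x + a) + (- 1 / s) * u x)"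
    by (auto simp: diff_divide_distrib)
  have ua: "helmholtz_solution \<mu> (\<lambda>x. u (1 *\<^sub>R x + a))"
    by (rule helmholtz_affine[OF u]) simp
  show "helmholtz_solution \<mu> (\<lambda>x. (u (x + a) - u x) / s)"
    unfolding eq by (rule helmholtz_lincomb[OF ua u])
  show "partial_deriv j (\<lambda>x. (u (x + a) - u x) / s)
      = (\<lambda>x. (partial_deriv j u (x + a) - partial_deriv j u x) / s)"
    unfolding eq partial_deriv_helmholtz_lincomb[OF ua u] partial_deriv_affine[OF u]
    by (auto simp: diff_divide_distrib)
qed

lemma difference_quotient_tendsto:
  fixes u :: "real^'n::finite \<Rightarrow> real"
  assumes u: "helmholtz_solution \<mu> u"
  shows "(\<lambda>n. (partial_deriv j u (x + inverse (real (Suc n)) *\<^sub>R axis i 1) - partial_deriv j u x) / inverse (real (Suc n)))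
    \<longlonglongrightarrow> partial_deriv i (partial_deriv j u) x"
proof -
  have "((\<lambda>s. partial_deriv j u (x + (1 * s) *\<^sub>R axis i 1)) has_real_derivative
      1 * partial_deriv i (partial_deriv j u) (x + (1 * 0) *\<^sub>R axis i 1)) (at 0)"
    by (rule has_real_derivative_along_axis[OF helmholtz_solutionD(2)[OF u]])
  then have "((\<lambda>s. (partial_deriv j u (x + s *\<^sub>R axis i 1) - partial_deriv j u x) / s)
      \<longlongrightarrow> partial_deriv i (partial_deriv j u) x) (at 0)"
    by (simp add: has_field_derivative_iff)
  moreover have "filterlim (\<lambda>n. inverse (real (Suc n))) (at 0) sequentially"
    using LIMSEQ_inverse_real_of_nat by (auto simp: filterlim_at)
  ultimately show ?thesis
    by (rule filterlim_compose)
qed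

text \<open>The gradient estimate cannot yet be applied to \<open>partial_deriv j u\<close>, which
  is not known to be a solution. It is applied to difference quotients instead: with radius 1/4 to
  bound them by means of the mean value theorem, then with radius 1/2 to bound their gradient. The
  radii 1/2, 1/4 and the step below 1/4 fit into the unit ball, and \<open>8 = 2 * 4\<close> comes
  from the two radii.\<close>

lemma second_derivative_estimate:
  fixes u :: "real^'n::finite \<Rightarrow> real"
  assumes u: "helmholtz_solution 1 u"
    and M: "\<And>x. x \<in> cball a 1 \<Longrightarrow> \<bar>u x\<bar> \<le> M"
  shows "\<bar>partial_deriv i (partial_deriv j u) a\<bar> \<le> 8 * (grad_const TYPE('n))\<^sup>2 * M"
proof -
  define C where "C = grad_const TYPE('n)"
  have C: "C \<ge> 1" using grad_const_ge_1 by (simp add: C_def)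
  define s where "s n = inverse (real (Suc n))" for n
  define v where "v n x = (u (x + s n *\<^sub>R axis i 1) - u x) / s n" for n x
  have "\<forall>\<^sub>F n in sequentially. s n < 1 / 4"
    unfolding s_def using LIMSEQ_inverse_real_of_nat by (rule order_tendstoD) simp
  then have "\<forall>\<^sub>F n in sequentially. \<bar>partial_deriv j (v n) a\<bar> \<le> 8 * C\<^sup>2 * M"
  proof eventually_elim
    case (elim n)
    have sn: "s n > 0" by (simp add: s_def)
    have "\<bar>v n x\<bar> \<le> C / (1 / 4) * M" if x: "x \<in> cball a (1 / 2)" for x
    proof -
      obtain z where z: "0 < z" "z < s n" "v n x = partial_deriv i u (x + z *\<^sub>R axis i 1)"
        unfolding v_def by (rule difference_quotient_mvt[OF u sn])
      have "dist a (x + z *\<^sub>R axis i 1) \<le> 1 / 2 + 1 / 4"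
        by (rule order.trans[OF dist_triangle[of _ _ x]])
          (use x z elim in \<open>auto simp: dist_norm intro!: add_mono\<close>)
      then have "\<bar>u y\<bar> \<le> M" if "y \<in> cball (x + z *\<^sub>R axis i 1) (1 / 4)" for y
        using that dist_triangle[of a y "x + z *\<^sub>R axis i 1"] by (intro M) auto
      then show ?thesis
        unfolding z(3) C_def grad_const_def by (intro gradient_estimate[OF u]) auto
    qed
    then have "\<bar>partial_deriv j (v n) a\<bar> \<le> C / (1 / 2) * (C / (1 / 4) * M)"
      unfolding v_def C_def grad_const_def
      by (intro gradient_estimate helmholtz_difference_quotient[OF u]) auto
    then show ?case by (simp add: power2_eq_square mult_ac)
  qed
  moreover have "(\<lambda>n. \<bar>partial_deriv j (v n) a\<bar>) \<longlonglongrightarrow> \<bar>partial_deriv i (partial_deriv j u) a\<bar>"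
    unfolding v_def helmholtz_difference_quotient(2)[OF u] s_def
    by (intro tendsto_rabs difference_quotient_tendsto[OF u])
  ultimately show ?thesis
    unfolding C_def by (intro tendsto_upperbound) auto
qed

text \<open>The estimates of first and second order, applied to the solutions
  \<open>v n - v m\<close>, make the derivatives uniformly Cauchy. Hence the limit is again C^2 and
  the equation survives.\<close>

lemma helmholtz_limit:
  fixes v :: "nat \<Rightarrow> real^'n::finite \<Rightarrow> real"
  assumes v: "\<And>n. helmholtz_solution 1 (v n)" and F: "locally_uniform_limit v F"
  shows "helmholtz_solution 1 F" "locally_uniform_limit (\<lambda>n. partial_deriv i (v n)) (partial_deriv i F)"
proof -
  define C where "C = grad_const TYPE('n)"
  have C: "C \<ge> 1" using grad_const_ge_1 by (simp add: C_def)
  have sub: "helmholtz_solution 1 (\<lambda>x. 1 * v n x + (- 1) * v m x)" for n m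
    by (intro helmholtz_lincomb v)
  have psub: "partial_deriv i (\<lambda>x. 1 * v n x + (- 1) * v m x) =
      (\<lambda>x. 1 * partial_deriv i (v n) x + (- 1) * partial_deriv i (v m) x)" for n m i
    by (rule partial_deriv_helmholtz_lincomb[OF v v])
  have psub2: "partial_deriv j (partial_deriv i (\<lambda>x. 1 * v n x + (- 1) * v m x)) x =
      1 * partial_deriv j (partial_deriv i (v n)) x + (- 1) * partial_deriv j (partial_deriv i (v m)) x" for n m i j x
    unfolding psub using helmholtz_solutionD(2)[OF v]
    by (intro partial_deriv_lincomb) (auto simp: differentiable_def)
  \<comment> \<open>Any quantity whose increments are bounded by the supremum of
    \<open>v n - v m\<close> over a unit ball inherits the Cauchy property, on a ball whose radius
    is smaller by 1.\<close>
  have cauchy: "uniformly_Cauchy_on (cball 0 R) w"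
    if K: "K > 0"
      and w: "\<And>n m x M. (\<And>y. y \<in> cball x 1 \<Longrightarrow> \<bar>1 * v n y + (- 1) * v m y\<bar> \<le> M) \<Longrightarrow> \<bar>w n x - w m x\<bar> \<le> K * M"
    for w :: "nat \<Rightarrow> real^'n \<Rightarrow> real" and K R
  proof (rule uniformly_Cauchy_onI)
    fix e :: real assume "e > 0"
    then have "e / (4 * K) > 0" using K by simp
    from locally_uniform_limitD[OF F this, of "R + 1"]
    obtain N where N: "\<And>n x. n \<ge> N \<Longrightarrow> x \<in> cball 0 (R + 1) \<Longrightarrow> \<bar>v n x - F x\<bar> < e / (4 * K)"
      unfolding eventually_sequentially by blast
    have "dist (w m x) (w n x) < e" if "x \<in> cball 0 R" "m \<ge> N" "n \<ge> N" for x m n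
    proof -
      have "\<bar>w m x - w n x\<bar> \<le> K * (e / (4 * K) + e / (4 * K))"
      proof (rule w)
        fix y assume "y \<in> cball x 1"
        then have y: "y \<in> cball 0 (R + 1)"
          using that(1) dist_triangle[of 0 y x] by auto
        show "\<bar>1 * v m y + (- 1) * v n y\<bar> \<le> e / (4 * K) + e / (4 * K)"
          using N[OF that(2) y] N[OF that(3) y] by linarith
      qed
      also have "\<dots> < e" using K \<open>e > 0\<close> by (simp add: field_simps)
      finally show ?thesis by (simp add: dist_real_def)
    qed
    then show "\<exists>M. \<forall>x\<in>cball 0 R. \<forall>m\<ge>M. \<forall>n\<ge>M. dist (w m x) (w n x) < e" by blast
  qed
  have c1: "uniformly_Cauchy_on (cball 0 R) (\<lambda>n. partial_deriv i (v n))" for i R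
  proof (rule cauchy[of C])
    fix n m x M
    assume "\<And>y. y \<in> cball x 1 \<Longrightarrow> \<bar>1 * v n y + (- 1) * v m y\<bar> \<le> M"
    from gradient_estimate[OF sub, of 1, OF _ _ this]
    show "\<bar>partial_deriv i (v n) x - partial_deriv i (v m) x\<bar> \<le> C * M"
      unfolding psub by (simp add: C_def grad_const_def)
  qed (use C in auto)
  have c2: "uniformly_Cauchy_on (cball 0 R) (\<lambda>n. partial_deriv j (partial_deriv i (v n)))" for i j R
  proof (rule cauchy[of "8 * C\<^sup>2"])
    fix n m x M
    assume "\<And>y. y \<in> cball x 1 \<Longrightarrow> \<bar>1 * v n y + (- 1) * v m y\<bar> \<le> M"
    from second_derivative_estimate[OF sub this]
    show "\<bar>partial_deriv j (partial_deriv i (v n)) x - partial_deriv j (partial_deriv i (v m)) x\<bar> \<le> 8 * C\<^sup>2 * M"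
      unfolding psub2 by (simp add: C_def)
  qed (use C in auto)
  define G where "G i x = lim (\<lambda>n. partial_deriv i (v n) x)" for i x
  define H where "H j i x = lim (\<lambda>n. partial_deriv j (partial_deriv i (v n)) x)" for j i x
  note L1 = locally_uniform_limit_derivative[OF helmholtz_solutionD(1)[OF v] F c1 G_def]
  note L2 = locally_uniform_limit_derivative[OF helmholtz_solutionD(2)[OF v] L1(1) c2 H_def]
  have contH: "continuous_on UNIV (H j i)" for i j
  proof -
    have "continuous_on (cball 0 R) (H j i)" for R
      by (rule uniform_limit_theorem[where F = sequentially and f = "\<lambda>n. partial_deriv j (partial_deriv i (v n))"])
        (use L2(1) in \<open>auto simp: locally_uniform_limit_def
          intro!: always_eventually continuous_on_subset[OF helmholtz_solutionD(3)[OF v]]\<close>)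
    then have "continuous_on (ball 0 R) (H j i)" for R
      by (rule continuous_on_subset[of "cball 0 R"]) auto
    then have "isCont (H j i) x" for x
      using continuous_on_eq_continuous_at[of "ball 0 (norm x + 1)" "H j i"] by auto
    then show ?thesis by (simp add: continuous_at_imp_continuous_on)
  qed
  show "helmholtz_solution 1 F"
  proof (rule helmholtz_solutionI[OF L1(2) L2(2) contH])
    fix x
    have "(\<lambda>n. (\<Sum>i\<in>UNIV. partial_deriv i (partial_deriv i (v n)) x)) \<longlonglongrightarrow> (\<Sum>i\<in>UNIV. H i i x)"
      by (intro tendsto_sum locally_uniform_limit_pointwise L2(1))
    moreover have "(\<lambda>n. - 1 * v n x) \<longlonglongrightarrow> - 1 * F x"
      by (intro tendsto_intros locally_uniform_limit_pointwise[OF F])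
    ultimately show "(\<Sum>i\<in>UNIV. H i i x) + 1 * F x = 0"
      unfolding helmholtz_solutionD(4)[OF v] by (auto dest: LIMSEQ_unique)
  qed
  have "partial_deriv i F = G i"
    using partial_deriv_eqI[OF L1(2)] by blast
  then show "locally_uniform_limit (\<lambda>n. partial_deriv i (v n)) (partial_deriv i F)"
    using L1(1) by simp
qed

text \<open>Difference quotients in direction \<open>i\<close> are solutions and converge locally
  uniformly to \<open>partial_deriv i u\<close>, which is therefore a solution. The limit of their
  \<open>j\<close>-th derivatives, computed in two ways, gives the symmetry of second
  derivatives.\<close>

lemma helmholtz_partial_deriv:
  fixes u :: "real^'n::finite \<Rightarrow> real"
  assumes u: "helmholtz_solution 1 u"
  shows "helmholtz_solution 1 (partial_deriv i u)"
    and "partial_deriv j (partial_deriv i u) = partial_deriv i (partial_deriv j u)"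
proof -
  define s where "s n = inverse (real (Suc n))" for n
  define v where "v n x = (u (x + s n *\<^sub>R axis i 1) - u x) / s n" for n x
  have hv: "helmholtz_solution 1 (v n)" for n
    unfolding v_def by (rule helmholtz_difference_quotient[OF u])
  have lim: "locally_uniform_limit v (partial_deriv i u)"
    using locally_uniform_difference_quotient[of "\<lambda>\<theta> x. u (x + \<theta> *\<^sub>R axis i 1)"
        "\<lambda>\<theta> x. partial_deriv i u (x + \<theta> *\<^sub>R axis i 1)"]
      has_real_derivative_along_axis[OF helmholtz_solutionD(1)[OF u], of _ 1]
      continuous_on_compose2[OF helmholtz_solution_continuous(2)[OF u, of UNIV i],
        of UNIV "\<lambda>(\<theta>, x). x + \<theta> *\<^sub>R axis i 1"]
    by (simp add: v_def[abs_def] s_def case_prod_beta continuous_intros)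
  show "helmholtz_solution 1 (partial_deriv i u)"
    by (rule helmholtz_limit[OF hv lim])
  show "partial_deriv j (partial_deriv i u) = partial_deriv i (partial_deriv j u)"
  proof
    fix x
    have "(\<lambda>n. partial_deriv j (v n) x) \<longlonglongrightarrow> partial_deriv j (partial_deriv i u) x"
      by (rule locally_uniform_limit_pointwise[OF helmholtz_limit(2)[OF hv lim]])
    moreover have "(\<lambda>n. partial_deriv j (v n) x) \<longlonglongrightarrow> partial_deriv i (partial_deriv j u) x"
      unfolding v_def helmholtz_difference_quotient(2)[OF u] s_def
      by (rule difference_quotient_tendsto[OF u])
    ultimately show "partial_deriv j (partial_deriv i u) x = partial_deriv i (partial_deriv j u) x"
      by (rule LIMSEQ_unique)
  qed
qed

section \<open>Taylor expansion of Helmholtz solutions\<close>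

lemma iterated_partial_simps [simp]:
  "iterated_partial [] u = u"
  "iterated_partial (i # is) u = partial_deriv i (iterated_partial is u)"
  by (auto simp: iterated_partial_def)

lemma iterated_partial_append: "iterated_partial (is @ js) u = iterated_partial is (iterated_partial js u)"
  by (simp add: iterated_partial_def)

lemma helmholtz_iterated_partial:
  "helmholtz_solution 1 u \<Longrightarrow> helmholtz_solution 1 (iterated_partial is u)"
  by (induction "is") (auto intro: helmholtz_partial_deriv)

lemma iterated_partial_move:
  assumes "helmholtz_solution 1 u"
  shows "iterated_partial (is @ i # js) u = partial_deriv i (iterated_partial (is @ js) u)"
proof (induction "is")
  case (Cons j "is")
  then show ?case
    using helmholtz_partial_deriv(2)[OF helmholtz_iterated_partial[OF assms]] by simp
qed simp

lemma iterated_partial_cong_mset: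
  assumes u: "helmholtz_solution 1 u" and "mset is = mset js"
  shows "iterated_partial is u = iterated_partial js u"
  using assms(2)
proof (induction "is" arbitrary: js)
  case (Cons i "is")
  then have "i \<in> set js" by (metis list.set_intros(1) set_mset_mset)
  then obtain as bs where js: "js = as @ i # bs" by (meson split_list)
  with Cons.prems have "mset is = mset (as @ bs)" by simp
  from Cons.IH[OF this] show ?case
    by (simp add: js iterated_partial_move[OF u])
qed simp

lemma helmholtz_zero: "helmholtz_solution \<mu> (\<lambda>x. 0)"
  by (rule helmholtz_solutionI[where g = "\<lambda>_ _. 0" and H = "\<lambda>_ _ _. 0"]) auto

lemma helmholtz_sum:
  assumes "finite I" "\<And>i. i \<in> I \<Longrightarrow> helmholtz_solution \<mu> (f i)"
  shows "helmholtz_solution \<mu> (\<lambda>y. \<Sum>i\<in>I. c i * f i y)"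
    and "partial_deriv j (\<lambda>y. \<Sum>i\<in>I. c i * f i y) = (\<lambda>y. \<Sum>i\<in>I. c i * partial_deriv j (f i) y)"
proof -
  have "helmholtz_solution \<mu> (\<lambda>y. \<Sum>i\<in>I. c i * f i y) \<and>
    partial_deriv j (\<lambda>y. \<Sum>i\<in>I. c i * f i y) = (\<lambda>y. \<Sum>i\<in>I. c i * partial_deriv j (f i) y)"
    using assms
  proof (induction I rule: finite_induct)
    case empty
    have "partial_deriv j (\<lambda>y. 0) = (\<lambda>y. 0)"
      by (intro ext partial_deriv_eqI) simp
    then show ?case by (simp add: helmholtz_zero)
  next
    case (insert i I)
    have 1: "helmholtz_solution \<mu> (f i)" "helmholtz_solution \<mu> (\<lambda>y. \<Sum>i\<in>I. c i * f i y)"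
      using insert by auto
    have 2: "(\<lambda>y. \<Sum>i\<in>insert i I. c i * f i y) = (\<lambda>y. c i * f i y + 1 * (\<Sum>i\<in>I. c i * f i y))"
      using insert by simp
    show ?case
      unfolding 2 partial_deriv_helmholtz_lincomb[OF 1]
      using insert helmholtz_lincomb[OF 1, of "c i" 1] by simp
  qed
  then show "helmholtz_solution \<mu> (\<lambda>y. \<Sum>i\<in>I. c i * f i y)"
    "partial_deriv j (\<lambda>y. \<Sum>i\<in>I. c i * f i y) = (\<lambda>y. \<Sum>i\<in>I. c i * partial_deriv j (f i) y)"
    by auto
qed

lemma iterated_partial_sum:
  assumes "finite I" "\<And>i. i \<in> I \<Longrightarrow> helmholtz_solution 1 (f i)"
  shows "iterated_partial is (\<lambda>y. \<Sum>i\<in>I. c i * f i y) = (\<lambda>y. \<Sum>i\<in>I. c i * iterated_partial is (f i) y)"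
  by (induction "is") (simp_all add: helmholtz_sum(2)[OF assms(1) helmholtz_iterated_partial[OF assms(2)]])

lemma iterated_partial_lincomb:
  assumes "helmholtz_solution 1 u" "helmholtz_solution 1 v"
  shows "iterated_partial is (\<lambda>x. a * u x + b * v x)
    = (\<lambda>x. a * iterated_partial is u x + b * iterated_partial is v x)"
  by (induction "is") (simp_all add:
      partial_deriv_helmholtz_lincomb[OF helmholtz_iterated_partial[OF assms(1)] helmholtz_iterated_partial[OF assms(2)]])

text \<open>Each differentiation costs a layer of width \<open>\<rho>\<close> around the ball and a
  factor \<open>grad_const / \<rho>\<close>.\<close>

lemma iterated_gradient_estimate:
  fixes u :: "real^'n::finite \<Rightarrow> real"
  assumes u: "helmholtz_solution 1 u" and \<rho>: "0 < \<rho>" "\<rho> \<le> 1"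
    and M: "\<And>x. x \<in> cball a (r + real (length is) * \<rho>) \<Longrightarrow> \<bar>u x\<bar> \<le> M"
    and y: "y \<in> cball a r"
  shows "\<bar>iterated_partial is u y\<bar> \<le> (grad_const TYPE('n) / \<rho>) ^ length is * M"
  using M y
proof (induction "is" arbitrary: r y)
  case (Cons i "is")
  have "\<bar>partial_deriv i (iterated_partial is u) y\<bar>
      \<le> grad_const TYPE('n) / \<rho> * ((grad_const TYPE('n) / \<rho>) ^ length is * M)"
    unfolding grad_const_def
  proof (rule gradient_estimate[OF helmholtz_iterated_partial[OF u] \<rho>])
    fix x assume "x \<in> cball y \<rho>"
    then have "x \<in> cball a (r + \<rho>)"
      using Cons.prems(2) dist_triangle[of a x y] by auto
    then show "\<bar>iterated_partial is u x\<bar> \<le> ((real CARD('n) + 1) / \<rho>) ^ length is * M"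
      unfolding grad_const_def[symmetric, of "TYPE('n)"]
      by (intro Cons.IH[of "r + \<rho>"] Cons.prems(1)) (auto simp: algebra_simps)
  qed
  then show ?case by simp
qed simp

lemma power_le_fact_mult_exp:
  fixes x :: real
  assumes "x \<ge> 0"
  shows "x ^ m \<le> fact m * exp x"
proof -
  have "(\<Sum>n\<in>{m}. x ^ n /\<^sub>R fact n) \<le> (\<Sum>n. x ^ n /\<^sub>R fact n)"
    by (intro sum_le_suminf summable_exp_generic) (use assms in auto)
  then have "x ^ m / fact m \<le> exp x" by (simp add: exp_def divide_inverse mult.commute)
  then show ?thesis by (simp add: field_simps)
qed

text \<open>The bound \<open>(m + R) ^ m \<le> fact m * exp (m + R)\<close> turns the iterated
  gradient estimate into the growth \<open>fact m\<close> times a geometric factor that is inversely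
  proportional to \<open>R\<close>.\<close>

lemma iterated_partial_bound:
  fixes u :: "real^'n::finite \<Rightarrow> real"
  assumes u: "helmholtz_solution 1 u" and R: "R > 0"
    and M: "\<And>x. x \<in> cball 0 (r + R) \<Longrightarrow> \<bar>u x\<bar> \<le> M"
    and y: "y \<in> cball 0 r"
  shows "\<bar>iterated_partial is u y\<bar>
    \<le> (grad_const TYPE('n) * exp 1 / R) ^ length is * fact (length is) * (exp R * M)"
proof -
  define C where "C = grad_const TYPE('n)"
  have C: "C \<ge> 1" using grad_const_ge_1 by (simp add: C_def)
  define m where "m = length is"
  \<comment> \<open>\<open>m\<close> steps of length \<open>\<rho>\<close> stay within distance \<open>R\<close>, and \<open>\<rho> \<le> 1\<close> as the gradient estimate requires\<close>
  define \<rho> where "\<rho> = R / (real m + R)"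
  have \<rho>: "0 < \<rho>" "\<rho> \<le> 1" using R by (auto simp: \<rho>_def)
  have M0: "M \<ge> 0" using M[of y] y R by force
  have "real m * \<rho> \<le> R" using R by (simp add: \<rho>_def field_simps)
  then have "\<bar>iterated_partial is u y\<bar> \<le> (C / \<rho>) ^ m * M"
    unfolding C_def m_def using M y
    by (intro iterated_gradient_estimate[OF u \<rho>, where a = 0 and r = r]) (auto simp: m_def)
  also have "(C / \<rho>) ^ m = (C / R) ^ m * (real m + R) ^ m"
    by (simp add: \<rho>_def power_mult_distrib power_divide)
  also have "(C / R) ^ m * (real m + R) ^ m \<le> (C / R) ^ m * (fact m * exp (real m + R))"
    using R C by (intro mult_left_mono power_le_fact_mult_exp) auto
  also have "\<dots> = (C * exp 1 / R) ^ m * fact m * exp R"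
    by (simp add: exp_add exp_of_nat_mult[of m 1, simplified] power_mult_distrib power_divide)
  finally show ?thesis using M0 by (simp add: C_def m_def mult_right_mono mult.assoc)
qed

lemma helmholtz_bounded_on_cball:
  assumes "helmholtz_solution \<mu> u"
  obtains M where "M \<ge> 0" "\<And>x. x \<in> cball a R \<Longrightarrow> \<bar>u x\<bar> \<le> M"
proof -
  have "compact (u ` cball a R)"
    by (intro compact_continuous_image helmholtz_solution_continuous[OF assms] compact_cball)
  then obtain M where "\<And>y. y \<in> u ` cball a R \<Longrightarrow> norm y \<le> M"
    using compact_imp_bounded bounded_iff by metis
  then have "\<bar>u x\<bar> \<le> max M 0" if "x \<in> cball a R" for x
    using that by (metis image_eqI max.coboundedI1 real_norm_def)
  then show ?thesis using that[of "max M 0"] by simp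
qed

text \<open>The solution is defined on the whole space, so \<open>R\<close> can be taken large
  enough to bring the geometric factor of the previous estimate down to
  \<open>\<epsilon>\<close>.\<close>

lemma helmholtz_jet_decay:
  fixes u :: "real^'n::finite \<Rightarrow> real"
  assumes u: "helmholtz_solution 1 u" and \<epsilon>: "\<epsilon> > 0"
  obtains K where "K \<ge> 0" "\<And>is. \<bar>iterated_partial is u 0\<bar> \<le> K * \<epsilon> ^ length is * fact (length is)"
proof -
  define R where "R = grad_const TYPE('n) * exp 1 / \<epsilon>"
  have R: "R > 0" using grad_const_ge_1[where 'n = 'n] \<epsilon> by (simp add: R_def)
  have eq: "grad_const TYPE('n) * exp 1 / R = \<epsilon>"
    using R grad_const_ge_1[where 'n = 'n] \<epsilon> by (simp add: R_def)
  obtain M where M: "M \<ge> 0" "\<And>x. x \<in> cball 0 (0 + R) \<Longrightarrow> \<bar>u x\<bar> \<le> M"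
    using helmholtz_bounded_on_cball[OF u, of 0 "0 + R"] by blast
  show ?thesis
  proof (rule that)
    show "exp R * M \<ge> 0" using M by simp
    show "\<bar>iterated_partial is u 0\<bar> \<le> exp R * M * \<epsilon> ^ length is * fact (length is)" for "is"
      using iterated_partial_bound[OF u R, where r = 0 and M = M and y = 0] M by (simp add: eq mult_ac)
  qed
qed

section \<open>Taylor's formula along rays\<close>

definition dir_deriv :: "real^'n::finite \<Rightarrow> (real^'n \<Rightarrow> real) \<Rightarrow> real^'n \<Rightarrow> real" where
  "dir_deriv x u y = (\<Sum>i\<in>UNIV. x $ i * partial_deriv i u y)"

lemma helmholtz_dir_deriv:
  assumes "helmholtz_solution 1 u"
  shows "helmholtz_solution 1 (dir_deriv x u)"
  unfolding dir_deriv_def[abs_def]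
  by (intro helmholtz_sum helmholtz_partial_deriv assms) auto

lemma iterated_partial_dir_deriv:
  assumes "helmholtz_solution 1 u"
  shows "iterated_partial is (dir_deriv x u) = (\<lambda>y. \<Sum>i\<in>UNIV. x $ i * iterated_partial (is @ [i]) u y)"
  unfolding dir_deriv_def[abs_def]
  by (subst iterated_partial_sum) (auto simp: helmholtz_partial_deriv assms iterated_partial_append)

lemma dir_deriv_power_bound:
  fixes u :: "real^'n::finite \<Rightarrow> real"
  assumes "helmholtz_solution 1 u" "\<And>is. length is = m \<Longrightarrow> \<bar>iterated_partial is u y\<bar> \<le> B"
  shows "\<bar>(dir_deriv x ^^ m) u y\<bar> \<le> (real CARD('n) * norm x) ^ m * B"
  using assms
proof (induction m arbitrary: u B)
  case 0
  from 0(2)[of "[]"] show ?case by simp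
next
  case (Suc m)
  have "\<bar>(dir_deriv x ^^ m) (dir_deriv x u) y\<bar> \<le> (real CARD('n) * norm x) ^ m * (real CARD('n) * norm x * B)"
  proof (rule Suc.IH[OF helmholtz_dir_deriv[OF Suc.prems(1)]])
    fix "is" :: "'n list" assume "length is = m"
    have "\<bar>iterated_partial is (dir_deriv x u) y\<bar> \<le> (\<Sum>i\<in>UNIV. \<bar>x $ i * iterated_partial (is @ [i]) u y\<bar>)"
      unfolding iterated_partial_dir_deriv[OF Suc.prems(1)] by (rule sum_abs)
    also have "\<dots> \<le> (\<Sum>i\<in>(UNIV :: 'n set). norm x * B)"
      unfolding abs_mult using \<open>length is = m\<close>
      by (intro sum_mono mult_mono component_le_norm_cart Suc.prems(2)) auto
    finally show "\<bar>iterated_partial is (dir_deriv x u) y\<bar> \<le> real CARD('n) * norm x * B" by simp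
  qed
  then show ?case
    by (simp add: funpow_swap1 mult_ac)
qed

lemma has_real_derivative_along_ray:
  fixes u :: "real^'n::finite \<Rightarrow> real"
  assumes "helmholtz_solution \<mu> u"
  shows "((\<lambda>s. u (s *\<^sub>R x)) has_real_derivative dir_deriv x u (s *\<^sub>R x)) (at s)"
proof -
  have 1: "((\<lambda>s. s *\<^sub>R x) has_derivative (\<lambda>h. h *\<^sub>R x)) (at s)"
    by (auto intro!: derivative_eq_intros)
  have "(\<lambda>h. \<Sum>i\<in>UNIV. (h *\<^sub>R x) $ i * partial_deriv i u (s *\<^sub>R x)) = (*) (dir_deriv x u (s *\<^sub>R x))"
    by (simp add: fun_eq_iff dir_deriv_def sum_distrib_left mult_ac)
  with has_derivative_compose[OF 1 helmholtz_solutionD(1)[OF assms]] show ?thesis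
    unfolding has_field_derivative_def by simp
qed

lemma helmholtz_taylor:
  assumes u: "helmholtz_solution 1 u"
  obtains t where "\<bar>t\<bar> \<le> 1"
    "u x = (\<Sum>m<n. (dir_deriv x ^^ m) u 0 / fact m) + (dir_deriv x ^^ n) u (t *\<^sub>R x) / fact n"
proof -
  have h: "helmholtz_solution 1 ((dir_deriv x ^^ m) u)" for m
    by (induction m) (auto intro: helmholtz_dir_deriv u)
  have "\<exists>t. \<bar>t\<bar> \<le> \<bar>1\<bar> \<and> (\<lambda>s. u (s *\<^sub>R x)) 1
      = (\<Sum>m<n. (\<lambda>s. (dir_deriv x ^^ m) u (s *\<^sub>R x)) 0 / fact m * 1 ^ m)
        + (\<lambda>s. (dir_deriv x ^^ n) u (s *\<^sub>R x)) t / fact n * 1 ^ n"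
    by (rule Maclaurin_all_le[of "\<lambda>m s. (dir_deriv x ^^ m) u (s *\<^sub>R x)"])
      (auto intro!: has_real_derivative_along_ray[OF h])
  then show ?thesis using that by auto
qed

text \<open>The Taylor remainder along the ray to \<open>x\<close> tends to 0, so bounds on the
  derivatives at the origin alone control the solution on a ball. This is how closeness of Cauchy
  data becomes closeness of functions.\<close>

lemma helmholtz_bound_from_jet:
  fixes v :: "real^'n::finite \<Rightarrow> real"
  assumes v: "helmholtz_solution 1 v"
    and b: "\<And>is. \<bar>iterated_partial is v 0\<bar> \<le> b (length is)"
    and B: "\<And>n. (\<Sum>m<n. (real CARD('n) * r) ^ m * b m / fact m) \<le> B"
    and x: "norm x \<le> r"
  shows "\<bar>v x\<bar> \<le> B"
proof -
  define d where "d = real CARD('n)"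
  define C where "C = grad_const TYPE('n)"
  have C: "C \<ge> 1" using grad_const_ge_1 by (simp add: C_def)
  have r: "r \<ge> 0" using x norm_ge_zero order.trans by blast
  \<comment> \<open>Chosen so that the remainder of order \<open>n\<close> is at most
    \<open>(1 / 2) ^ n\<close> times a constant; the \<open>+ 1\<close> keeps \<open>R\<close>
    positive when \<open>r = 0\<close>.\<close>
  define R where "R = 2 * C * exp 1 * d * r + 1"
  have Cdr: "C * exp 1 * d * r \<ge> 0" using C r by (simp add: d_def)
  then have R: "R > 0" by (simp add: R_def mult.assoc)
  have q: "d * r * (C * exp 1 / R) \<le> 1 / 2"
    using R Cdr by (simp add: field_simps R_def)
  have q0: "0 \<le> d * r * (C * exp 1 / R)" using R C r by (simp add: d_def)
  obtain M where M: "M \<ge> 0" "\<And>x. x \<in> cball 0 (r + R) \<Longrightarrow> \<bar>v x\<bar> \<le> M"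
    using helmholtz_bounded_on_cball[OF v, of 0 "r + R"] by blast
  have "\<bar>v x\<bar> \<le> B + (1 / 2) ^ n * (exp R * M)" for n
  proof -
    obtain t where t: "\<bar>t\<bar> \<le> 1"
      "v x = (\<Sum>m<n. (dir_deriv x ^^ m) v 0 / fact m) + (dir_deriv x ^^ n) v (t *\<^sub>R x) / fact n"
      by (rule helmholtz_taylor[OF v])
    have pw: "(d * norm x) ^ m \<le> (d * r) ^ m" for m
      using x by (intro power_mono mult_left_mono) (auto simp: d_def)
    have "\<bar>(dir_deriv x ^^ m) v 0\<bar> / fact m \<le> (d * r) ^ m * b m / fact m" for m
    proof (intro divide_right_mono)
      have b0: "b m \<ge> 0" using b[of "replicate m undefined"] by (simp add: order.trans[OF abs_ge_zero])
      have "\<bar>(dir_deriv x ^^ m) v 0\<bar> \<le> (d * norm x) ^ m * b m"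
        unfolding d_def using b by (intro dir_deriv_power_bound[OF v]) blast
      also have "\<dots> \<le> (d * r) ^ m * b m" by (intro mult_right_mono pw b0)
      finally show "\<bar>(dir_deriv x ^^ m) v 0\<bar> \<le> (d * r) ^ m * b m" .
    qed simp
    then have "\<bar>\<Sum>m<n. (dir_deriv x ^^ m) v 0 / fact m\<bar> \<le> (\<Sum>m<n. (d * r) ^ m * b m / fact m)"
      by (intro order.trans[OF sum_abs] sum_mono) simp
    also have "\<dots> \<le> B" using B by (simp add: d_def)
    finally have 1: "\<bar>\<Sum>m<n. (dir_deriv x ^^ m) v 0 / fact m\<bar> \<le> B" .
    have tx: "t *\<^sub>R x \<in> cball 0 r"
      using t(1) x mult_mono[of "\<bar>t\<bar>" 1 "norm x" r] by simp
    have "\<bar>(dir_deriv x ^^ n) v (t *\<^sub>R x)\<bar>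
        \<le> (d * norm x) ^ n * ((C * exp 1 / R) ^ n * fact n * (exp R * M))"
      unfolding d_def C_def using iterated_partial_bound[OF v R M(2) tx]
      by (intro dir_deriv_power_bound[OF v]) blast
    also have "\<dots> \<le> (d * r) ^ n * ((C * exp 1 / R) ^ n * fact n * (exp R * M))"
      using C R M by (intro mult_right_mono pw) auto
    also have "\<dots> = (d * r * (C * exp 1 / R)) ^ n * (exp R * M) * fact n"
      by (simp only: power_mult_distrib mult_ac)
    also have "\<dots> \<le> (1 / 2) ^ n * (exp R * M) * fact n"
      using q q0 M by (intro mult_right_mono power_mono) auto
    finally have 2: "\<bar>(dir_deriv x ^^ n) v (t *\<^sub>R x) / fact n\<bar> \<le> (1 / 2) ^ n * (exp R * M)"
      by (simp add: field_simps)
    show ?thesis unfolding t(2) using 1 2 by linarith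
  qed
  moreover have "(\<lambda>n. B + (1 / 2) ^ n * (exp R * M)) \<longlonglongrightarrow> B + 0 * (exp R * M)"
    by (intro tendsto_intros LIMSEQ_power_zero) auto
  ultimately show ?thesis
    by (intro LIMSEQ_le_const) auto
qed

section \<open>Superpositions of plane waves\<close>

text \<open>The phase covers sines as well, which makes the set invariant under differentiation,
  and, for suitable \<open>D\<close>, under products.\<close>

inductive_set waves :: "(real^'n::finite) set \<Rightarrow> (real^'n \<Rightarrow> real) set" for D where
  waves_zero: "(\<lambda>x. 0) \<in> waves D"
| waves_add_wave: "w \<in> waves D \<Longrightarrow> \<xi> \<in> D \<Longrightarrow> (\<lambda>x. w x + a * cos (\<xi> \<bullet> x + \<phi>)) \<in> waves D"

lemma waves_add: "w \<in> waves D \<Longrightarrow> v \<in> waves D \<Longrightarrow> (\<lambda>x. v x + w x) \<in> waves D"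
proof (induction w rule: waves.induct)
  case (waves_add_wave w \<xi> a \<phi>)
  then show ?case using waves.waves_add_wave[of "\<lambda>x. v x + w x" D \<xi> a \<phi>] by (simp add: add.assoc)
qed simp

lemma waves_scale: "w \<in> waves D \<Longrightarrow> (\<lambda>x. c * w x) \<in> waves D"
proof (induction w rule: waves.induct)
  case (waves_add_wave w \<xi> a \<phi>)
  then show ?case using waves.waves_add_wave[of "\<lambda>x. c * w x" D \<xi> "c * a" \<phi>] by (simp add: algebra_simps)
qed (simp add: waves.waves_zero)

lemma waves_wave: "\<xi> \<in> D \<Longrightarrow> (\<lambda>x. a * cos (\<xi> \<bullet> x + \<phi>)) \<in> waves D"
  using waves_add_wave[OF waves_zero, of \<xi> D a \<phi>] by simp

lemma helmholtz_waves:
  assumes "D \<subseteq> sphere 0 1" "w \<in> waves D"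
  shows "helmholtz_solution 1 w"
  using assms(2)
proof (induction w rule: waves.induct)
  case (waves_add_wave w \<xi> a \<phi>)
  have "helmholtz_solution 1 (\<lambda>x. 1 * cos (\<xi> \<bullet> x + \<phi>))"
    using waves_add_wave assms(1) by (intro helmholtz_plane_wave) auto
  from helmholtz_lincomb[OF waves_add_wave(3) this, of 1 a] show ?case by simp
qed (rule helmholtz_zero)

definition wave_closure :: "(real^'n::finite) set \<Rightarrow> (real^'n \<Rightarrow> real) set" where
  "wave_closure D = {u. \<forall>R. \<forall>e>0. \<exists>w\<in>waves D. \<forall>x\<in>cball 0 R. \<bar>w x - u x\<bar> < e}"

lemma waves_subset_closure: "w \<in> waves D \<Longrightarrow> w \<in> wave_closure D"
  by (auto simp: wave_closure_def intro!: bexI[of _ w])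

lemma wave_closure_approx:
  assumes "\<And>R e. R > 0 \<Longrightarrow> e > 0 \<Longrightarrow> \<exists>p\<in>wave_closure D. \<forall>x\<in>cball 0 R. \<bar>p x - u x\<bar> < e"
  shows "u \<in> wave_closure D"
  unfolding wave_closure_def
proof (intro CollectI allI impI)
  fix R e :: real assume e: "e > 0"
  obtain p where p: "p \<in> wave_closure D" "\<And>x. x \<in> cball 0 (max R 1) \<Longrightarrow> \<bar>p x - u x\<bar> < e / 2"
    using assms[of "max R 1" "e / 2"] e by (metis half_gt_zero less_max_iff_disj zero_less_one)
  obtain w where w: "w \<in> waves D" "\<And>x. x \<in> cball 0 R \<Longrightarrow> \<bar>w x - p x\<bar> < e / 2"
    using p(1)[unfolded wave_closure_def] half_gt_zero[OF e] by blast
  have "\<bar>w x - u x\<bar> < e" if "x \<in> cball 0 R" for x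
  proof -
    have "x \<in> cball 0 (max R 1)" using that by auto
    then show ?thesis using p(2)[of x] w(2)[OF that] by linarith
  qed
  then show "\<exists>w\<in>waves D. \<forall>x\<in>cball 0 R. \<bar>w x - u x\<bar> < e" using w(1) by blast
qed

lemma wave_closure_limit:
  assumes "\<And>n. v n \<in> wave_closure D" "locally_uniform_limit v u"
  shows "u \<in> wave_closure D"
proof (rule wave_closure_approx)
  fix R e :: real assume "e > 0"
  then have "\<exists>n. \<forall>x\<in>cball 0 R. \<bar>v n x - u x\<bar> < e"
    using eventually_happens'[OF sequentially_bot locally_uniform_limitD[OF assms(2)]] by blast
  then show "\<exists>p\<in>wave_closure D. \<forall>x\<in>cball 0 R. \<bar>p x - u x\<bar> < e"
    using assms(1) by blast
qed

lemma wave_closure_sequence: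
  assumes "u \<in> wave_closure D"
  obtains w where "\<And>n. w n \<in> waves D" "locally_uniform_limit w u"
proof -
  have "\<exists>w\<in>waves D. \<forall>x\<in>cball 0 (real n). \<bar>w x - u x\<bar> < inverse (real (Suc n))" for n
    using assms by (auto simp: wave_closure_def)
  then obtain w where w: "\<And>n. w n \<in> waves D"
    "\<And>n x. x \<in> cball 0 (real n) \<Longrightarrow> \<bar>w n x - u x\<bar> < inverse (real (Suc n))"
    by metis
  have "locally_uniform_limit w u"
  proof (rule locally_uniform_limitI)
    fix R e :: real assume "e > 0"
    have "\<forall>\<^sub>F n in sequentially. inverse (real (Suc n)) < e"
      using LIMSEQ_inverse_real_of_nat by (rule order_tendstoD) (use \<open>e > 0\<close> in simp)
    moreover have "\<forall>\<^sub>F n in sequentially. R \<le> real n"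
      by (meson eventually_at_top_linorder eventually_sequentiallyI nat_ceiling_le_eq)
    ultimately show "\<forall>\<^sub>F n in sequentially. \<forall>x\<in>cball 0 R. \<bar>w n x - u x\<bar> < e"
    proof eventually_elim
      case (elim n)
      show ?case
      proof
        fix x :: "real^'a" assume "x \<in> cball 0 R"
        then have "x \<in> cball 0 (real n)" using elim by auto
        from w(2)[OF this] elim show "\<bar>w n x - u x\<bar> < e" by linarith
      qed
    qed
  qed
  with w(1) that show ?thesis by blast
qed

lemma wave_closure_lincomb:
  assumes "u \<in> wave_closure D" "v \<in> wave_closure D"
  shows "(\<lambda>x. a * u x + b * v x) \<in> wave_closure D"
proof -
  obtain w where w: "\<And>n. w n \<in> waves D" "locally_uniform_limit w u"
    using wave_closure_sequence[OF assms(1)] by blast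
  obtain z where z: "\<And>n. z n \<in> waves D" "locally_uniform_limit z v"
    using wave_closure_sequence[OF assms(2)] by blast
  have "locally_uniform_limit (\<lambda>n x. a * w n x + b * z n x) (\<lambda>x. a * u x + b * v x)"
    using w(2) z(2) unfolding locally_uniform_limit_def
    by (auto intro!: uniform_limit_add bounded_linear_uniform_limit_intros)
  then show ?thesis
    by (rule wave_closure_limit[rotated]) (intro waves_subset_closure waves_add waves_scale w z)
qed

lemma wave_closure_sum:
  assumes "finite I" "\<And>i. i \<in> I \<Longrightarrow> f i \<in> wave_closure D"
  shows "(\<lambda>x. \<Sum>i\<in>I. c i * f i x) \<in> wave_closure D"
  using assms
proof (induction I rule: finite_induct)
  case empty
  then show ?case by (simp add: waves_subset_closure waves_zero)
next
  case (insert i I)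
  then show ?case using wave_closure_lincomb[of "f i" D "\<lambda>x. \<Sum>i\<in>I. c i * f i x" "c i" 1] by simp
qed

lemma helmholtz_wave_closure:
  assumes "D \<subseteq> sphere 0 1" "u \<in> wave_closure D"
  shows "helmholtz_solution 1 u"
proof -
  obtain w where "\<And>n. w n \<in> waves D" "locally_uniform_limit w u"
    using wave_closure_sequence[OF assms(2)] by blast
  then show ?thesis using helmholtz_limit(1) helmholtz_waves[OF assms(1)] by blast
qed

text \<open>
  The generator of the rotations in the plane of the coordinates \<open>j\<close> and \<open>t\<close>. It commutes with the
  Laplacian, and multiplies the Cauchy data on \<open>x\<^sub>t = 0\<close> by \<open>x\<^sub>j\<close> up to terms of lower degree.
\<close>

definition rotation_deriv :: "'n \<Rightarrow> 'n \<Rightarrow> (real^'n::finite \<Rightarrow> real) \<Rightarrow> real^'n \<Rightarrow> real" where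
  "rotation_deriv j t u x = x $ t * partial_deriv j u x - x $ j * partial_deriv t u x"

lemma rotation_deriv_lincomb:
  assumes "helmholtz_solution \<mu> u" "helmholtz_solution \<mu> v"
  shows "rotation_deriv j t (\<lambda>x. a * u x + b * v x)
    = (\<lambda>x. a * rotation_deriv j t u x + b * rotation_deriv j t v x)"
  unfolding rotation_deriv_def partial_deriv_helmholtz_lincomb[OF assms]
  by (auto simp: algebra_simps)

text \<open>Rotating the frequency in the plane of \<open>j\<close> and \<open>t\<close> keeps it on
  the unit sphere. The derivative of the rotated wave at angle 0 is the wave acted on by the
  rotation field, and it is a limit of combinations of two waves.\<close>

lemma rotation_deriv_plane_wave:
  fixes \<xi> :: "real^'n::finite"
  assumes \<xi>: "norm \<xi> = 1" and jt: "j \<noteq> t"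
  shows "rotation_deriv j t (\<lambda>x. a * cos (\<xi> \<bullet> x + \<phi>)) \<in> wave_closure (sphere 0 1)"
proof -
  \<comment> \<open>\<open>P\<close> is the projection of \<open>\<xi>\<close> to the plane of
    \<open>j\<close> and \<open>t\<close>, \<open>\<eta>\<close> is \<open>P\<close> after a quarter
    turn, and \<open>\<zeta> \<theta>\<close> is \<open>\<xi>\<close> with \<open>P\<close> rotated
    by \<open>\<theta>\<close>.\<close>
  define \<eta> where "\<eta> = \<xi> $ j *\<^sub>R axis t 1 - \<xi> $ t *\<^sub>R (axis j 1 :: real^'n)"
  define P where "P = \<xi> $ j *\<^sub>R axis j 1 + \<xi> $ t *\<^sub>R (axis t 1 :: real^'n)"
  define \<zeta> where "\<zeta> \<theta> = \<xi> + sin \<theta> *\<^sub>R \<eta> + (cos \<theta> - 1) *\<^sub>R P" for \<theta>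
  define p where "p = (\<xi> $ j)\<^sup>2 + (\<xi> $ t)\<^sup>2"
  have ax: "axis j 1 \<bullet> (axis t 1 :: real^'n) = 0" "axis t 1 \<bullet> (axis j 1 :: real^'n) = 0"
    using jt by (auto simp: inner_axis_axis)
  have ax': "axis j (1 :: real) $ t = 0" "axis t (1 :: real) $ j = 0"
    using jt by (auto simp: axis_def)
  have ips: "\<eta> \<bullet> \<eta> = p" "P \<bullet> P = p" "\<xi> \<bullet> P = p" "\<xi> \<bullet> \<eta> = 0" "\<eta> \<bullet> P = 0"
    by (simp_all add: \<eta>_def P_def p_def inner_add_left inner_add_right inner_diff_left inner_diff_right
        inner_axis inner_axis' ax ax' inner_axis_axis power2_eq_square)
  have unit: "\<zeta> \<theta> \<in> sphere 0 1" for \<theta>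
  proof -
    have "\<zeta> \<theta> \<bullet> \<zeta> \<theta> = \<xi> \<bullet> \<xi> + (sin \<theta>)\<^sup>2 * (\<eta> \<bullet> \<eta>) + (cos \<theta> - 1)\<^sup>2 * (P \<bullet> P)
      + 2 * sin \<theta> * (\<xi> \<bullet> \<eta>) + 2 * (cos \<theta> - 1) * (\<xi> \<bullet> P) + 2 * sin \<theta> * (cos \<theta> - 1) * (\<eta> \<bullet> P)"
      by (simp add: \<zeta>_def inner_add_left inner_add_right inner_commute power2_eq_square algebra_simps)
    also have "\<dots> = \<xi> \<bullet> \<xi> + p * ((sin \<theta>)\<^sup>2 + (cos \<theta>)\<^sup>2 - 1)"
      unfolding ips by algebra
    also have "\<dots> = 1" using \<xi> by (simp add: norm_eq_sqrt_inner)
    finally show ?thesis by (simp add: norm_eq_sqrt_inner)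
  qed
  define f where "f \<theta> x = a * cos (\<zeta> \<theta> \<bullet> x + \<phi>)" for \<theta> x
  define f' where "f' \<theta> x = - a * sin (\<zeta> \<theta> \<bullet> x + \<phi>) * (cos \<theta> * (\<eta> \<bullet> x) - sin \<theta> * (P \<bullet> x))" for \<theta> x
  have "((\<lambda>\<theta>. f \<theta> x) has_real_derivative f' \<theta> x) (at \<theta>)" for \<theta> x
    unfolding f_def f'_def \<zeta>_def inner_add_left inner_scaleR_left
    by (auto intro!: derivative_eq_intros simp: algebra_simps)
  moreover have "continuous_on UNIV (\<lambda>(\<theta>, x). f' \<theta> x)"
    unfolding f'_def \<zeta>_def case_prod_beta by (intro continuous_intros)
  ultimately have lim: "locally_uniform_limit
      (\<lambda>n x. (f (inverse (real (Suc n))) x - f 0 x) / inverse (real (Suc n))) (f' 0)"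
    by (rule locally_uniform_difference_quotient)
  have "f' 0 \<in> wave_closure (sphere 0 1)"
  proof (rule wave_closure_limit[OF _ lim])
    fix n
    have "(\<lambda>x. (f (inverse (real (Suc n))) x - f 0 x) / inverse (real (Suc n)))
      = (\<lambda>x. real (Suc n) * f (inverse (real (Suc n))) x + (- real (Suc n)) * f 0 x)"
      by (simp add: fun_eq_iff divide_inverse left_diff_distrib right_diff_distrib mult.commute del: of_nat_Suc)
    also have "\<dots> \<in> wave_closure (sphere 0 1)"
      unfolding f_def using unit by (intro wave_closure_lincomb waves_subset_closure waves_wave)
    finally show "(\<lambda>x. (f (inverse (real (Suc n))) x - f 0 x) / inverse (real (Suc n))) \<in> wave_closure (sphere 0 1)" .
  qed
  also have "f' 0 = rotation_deriv j t (\<lambda>x. a * cos (\<xi> \<bullet> x + \<phi>))"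
  proof
    fix x
    have 1: "cos (\<xi> \<bullet> x + (\<phi> + pi / 2)) = - sin (\<xi> \<bullet> x + \<phi>)"
      by (simp add: add.assoc[symmetric] minus_sin_cos_eq)
    have 2: "\<eta> \<bullet> x = \<xi> $ j * x $ t - \<xi> $ t * x $ j"
      by (simp add: \<eta>_def inner_diff_left inner_axis')
    show "f' 0 x = rotation_deriv j t (\<lambda>x. a * cos (\<xi> \<bullet> x + \<phi>)) x"
      unfolding f'_def rotation_deriv_def partial_deriv_plane_wave 1 2
      by (simp add: \<zeta>_def algebra_simps)
  qed
  finally show ?thesis .
qed

text \<open>Gradients of approximating waves converge locally uniformly, and the coefficients of the
  rotation field are bounded by \<open>R\<close> on the ball of radius \<open>R\<close>; so the
  field commutes with the limit.\<close>

lemma rotation_deriv_wave_closure: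
  fixes u :: "real^'n::finite \<Rightarrow> real"
  assumes u: "u \<in> wave_closure (sphere 0 1)" and jt: "j \<noteq> t"
  shows "rotation_deriv j t u \<in> wave_closure (sphere 0 1)"
proof -
  have wv: "rotation_deriv j t w \<in> wave_closure (sphere 0 1)" if "w \<in> waves (sphere 0 1)" for w
    using that
  proof (induction w rule: waves.induct)
    case waves_zero
    have "partial_deriv i (\<lambda>x :: real^'n. 0) x = 0" for i x
      by (rule partial_deriv_eqI) simp
    then have "rotation_deriv j t (\<lambda>x. 0) = (\<lambda>x. 0)"
      by (simp add: rotation_deriv_def fun_eq_iff)
    then show ?case by (simp add: waves_subset_closure waves.waves_zero)
  next
    case (waves_add_wave w \<xi> a \<phi>)
    have 1: "helmholtz_solution 1 w" using helmholtz_waves waves_add_wave by blast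
    have 2: "helmholtz_solution 1 (\<lambda>x. a * cos (\<xi> \<bullet> x + \<phi>))"
      using waves_add_wave by (intro helmholtz_plane_wave) auto
    have "(\<lambda>x. w x + a * cos (\<xi> \<bullet> x + \<phi>)) = (\<lambda>x. 1 * w x + 1 * (a * cos (\<xi> \<bullet> x + \<phi>)))" by simp
    then show ?case
      using rotation_deriv_lincomb[OF 1 2, of j t 1 1]
        wave_closure_lincomb[OF waves_add_wave(3) rotation_deriv_plane_wave[OF _ jt], of \<xi> 1 1 a \<phi>]
        waves_add_wave(2) by simp
  qed
  obtain w where w: "\<And>n. w n \<in> waves (sphere 0 1)" "locally_uniform_limit w u"
    using wave_closure_sequence[OF u] by blast
  have hw: "helmholtz_solution 1 (w n)" for n using helmholtz_waves w(1) by blast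
  have "locally_uniform_limit (\<lambda>n. rotation_deriv j t (w n)) (rotation_deriv j t u)"
  proof (rule locally_uniform_limitI)
    fix R e :: real assume R: "R > 0" and e: "e > 0"
    have "e / (2 * R) > 0" using R e by simp
    from locally_uniform_limitD[OF helmholtz_limit(2)[OF hw w(2), of j] this, where R = R]
      locally_uniform_limitD[OF helmholtz_limit(2)[OF hw w(2), of t] this, where R = R]
    show "\<forall>\<^sub>F n in sequentially. \<forall>x\<in>cball 0 R. \<bar>rotation_deriv j t (w n) x - rotation_deriv j t u x\<bar> < e"
    proof eventually_elim
      case (elim n)
      show ?case
      proof
        fix x :: "real^'n" assume x: "x \<in> cball 0 R"
        define A where "A = partial_deriv j (w n) x - partial_deriv j u x"
        define B where "B = partial_deriv t (w n) x - partial_deriv t u x"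
        have AB: "\<bar>A\<bar> < e / (2 * R)" "\<bar>B\<bar> < e / (2 * R)" using elim x by (auto simp: A_def B_def)
        have "\<bar>x $ i\<bar> \<le> R" for i using component_le_norm_cart[of x i] x by simp
        then have "\<bar>x $ t * A\<bar> \<le> R * \<bar>A\<bar>" "\<bar>x $ j * B\<bar> \<le> R * \<bar>B\<bar>"
          by (simp_all add: abs_mult mult_right_mono)
        moreover have "R * \<bar>A\<bar> < e / 2" "R * \<bar>B\<bar> < e / 2"
          using AB R by (simp_all add: field_simps)
        moreover have "rotation_deriv j t (w n) x - rotation_deriv j t u x = x $ t * A - x $ j * B"
          by (simp add: rotation_deriv_def A_def B_def algebra_simps)
        ultimately show "\<bar>rotation_deriv j t (w n) x - rotation_deriv j t u x\<bar> < e"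
          by linarith
      qed
    qed
  qed
  then show ?thesis
    by (rule wave_closure_limit[OF wv[OF w(1)]])
qed

section \<open>Cauchy data on a hyperplane\<close>

text \<open>Multisets of directions serve as multi-indices. For solutions the chosen listing is
  immaterial, since their partial derivatives commute.\<close>

definition multi_partial :: "'n::finite multiset \<Rightarrow> (real^'n \<Rightarrow> real) \<Rightarrow> real^'n \<Rightarrow> real" where
  "multi_partial M u = iterated_partial (SOME is. mset is = M) u"

lemma multi_partial_mset:
  assumes "helmholtz_solution 1 u"
  shows "multi_partial (mset is) u = iterated_partial is u"
  unfolding multi_partial_def
  by (rule iterated_partial_cong_mset[OF assms]) (rule someI[of _ "is"], rule refl)

lemma multi_partial_simps:
  assumes "helmholtz_solution 1 u"
  shows "multi_partial {#} u = u"
    and "multi_partial (add_mset i M) u = partial_deriv i (multi_partial M u)"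
proof -
  show "multi_partial {#} u = u"
    using multi_partial_mset[OF assms, of "[]"] by simp
  obtain js where "M = mset js" by (metis ex_mset)
  then show "multi_partial (add_mset i M) u = partial_deriv i (multi_partial M u)"
    using multi_partial_mset[OF assms, of "i # js"] multi_partial_mset[OF assms, of js] by simp
qed

lemma helmholtz_multi_partial:
  assumes "helmholtz_solution 1 u"
  shows "helmholtz_solution 1 (multi_partial M u)"
  unfolding multi_partial_def by (rule helmholtz_iterated_partial[OF assms])

lemma multi_partial_lincomb:
  assumes "helmholtz_solution 1 u" "helmholtz_solution 1 v"
  shows "multi_partial M (\<lambda>x. a * u x + b * v x) = (\<lambda>x. a * multi_partial M u x + b * multi_partial M v x)"
  unfolding multi_partial_def by (rule iterated_partial_lincomb[OF assms])

lemma multi_partial_sum: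
  assumes "finite I" "\<And>i. i \<in> I \<Longrightarrow> helmholtz_solution 1 (f i)"
  shows "multi_partial M (\<lambda>y. \<Sum>i\<in>I. c i * f i y) = (\<lambda>y. \<Sum>i\<in>I. c i * multi_partial M (f i) y)"
  unfolding multi_partial_def by (rule iterated_partial_sum[OF assms])

lemma has_derivative_rotation_deriv:
  fixes u :: "real^'n::finite \<Rightarrow> real"
  assumes u: "helmholtz_solution 1 u"
  shows "(rotation_deriv j t u has_derivative
    (\<lambda>h. \<Sum>i\<in>UNIV. h $ i * (rotation_deriv j t (partial_deriv i u) x
      + (if i = t then partial_deriv j u x else 0) - (if i = j then partial_deriv t u x else 0)))) (at x)"
proof -
  note D = helmholtz_solutionD(2)[OF u]
  have "((\<lambda>x. x $ t * partial_deriv j u x - x $ j * partial_deriv t u x) has_derivative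
      (\<lambda>h. (x $ t * (\<Sum>i\<in>UNIV. h $ i * partial_deriv i (partial_deriv j u) x) + h $ t * partial_deriv j u x)
        - (x $ j * (\<Sum>i\<in>UNIV. h $ i * partial_deriv i (partial_deriv t u) x) + h $ j * partial_deriv t u x))) (at x)"
    by (intro has_derivative_diff has_derivative_mult D) (auto intro: bounded_linear_imp_has_derivative bounded_linear_vec_nth)
  moreover have "(\<Sum>i\<in>UNIV. h $ i * (rotation_deriv j t (partial_deriv i u) x
      + (if i = t then partial_deriv j u x else 0) - (if i = j then partial_deriv t u x else 0)))
    = (x $ t * (\<Sum>i\<in>UNIV. h $ i * partial_deriv i (partial_deriv j u) x) + h $ t * partial_deriv j u x)
        - (x $ j * (\<Sum>i\<in>UNIV. h $ i * partial_deriv i (partial_deriv t u) x) + h $ j * partial_deriv t u x)" for h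
  proof -
    have "(\<Sum>i\<in>UNIV. h $ i * (rotation_deriv j t (partial_deriv i u) x
        + (if i = t then partial_deriv j u x else 0) - (if i = j then partial_deriv t u x else 0)))
      = (\<Sum>i\<in>UNIV. x $ t * (h $ i * partial_deriv i (partial_deriv j u) x)
          + (if i = t then h $ i * partial_deriv j u x else 0)
          - (x $ j * (h $ i * partial_deriv i (partial_deriv t u) x)
          + (if i = j then h $ i * partial_deriv t u x else 0)))"
      unfolding rotation_deriv_def helmholtz_partial_deriv(2)[OF u, of j] helmholtz_partial_deriv(2)[OF u, of t]
      by (intro sum.cong) (auto simp: algebra_simps)
    then show ?thesis
      by (simp add: sum.distrib sum_subtractf sum_distrib_left)
  qed
  ultimately show ?thesis
    by (simp add: rotation_deriv_def[abs_def])
qed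

lemma partial_deriv_rotation_deriv:
  assumes "helmholtz_solution 1 u"
  shows "partial_deriv i (rotation_deriv j t u) x = rotation_deriv j t (partial_deriv i u) x
      + (if i = t then partial_deriv j u x else 0) - (if i = j then partial_deriv t u x else 0)"
  by (rule partial_deriv_eqI[OF has_derivative_rotation_deriv[OF assms]])

text \<open>Leibniz rule with linear coefficients: a derivative in direction \<open>t\<close> can
  fall on the coefficient \<open>x $ t\<close>, leaving \<open>j\<close> in its place, and this
  happens in \<open>count M t\<close> ways; likewise for \<open>x $ j\<close>. At the origin only
  these terms survive.\<close>

lemma multi_partial_rotation_deriv:
  fixes u :: "real^'n::finite \<Rightarrow> real"
  assumes u: "helmholtz_solution 1 u" and Xu: "helmholtz_solution 1 (rotation_deriv j t u)"
  shows "multi_partial M (rotation_deriv j t u) x = rotation_deriv j t (multi_partial M u) x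
    + real (count M t) * multi_partial (add_mset j (M - {#t#})) u x
    - real (count M j) * multi_partial (add_mset t (M - {#j#})) u x"
proof (induction M arbitrary: x)
  case empty
  then show ?case by (simp add: multi_partial_simps[OF u] multi_partial_simps[OF Xu])
next
  case (add i M)
  note h = helmholtz_multi_partial[OF u]
  define v where "v = multi_partial M u"
  define Y where "Y = multi_partial (add_mset j (M - {#t#})) u"
  define Z where "Z = multi_partial (add_mset t (M - {#j#})) u"
  have hv: "helmholtz_solution 1 v" and hY: "helmholtz_solution 1 Y" and hZ: "helmholtz_solution 1 Z"
    using h by (auto simp: v_def Y_def Z_def)
  have dX: "rotation_deriv j t v differentiable (at x)"
    using has_derivative_rotation_deriv[OF hv] by (auto simp: differentiable_def)
  have dYZ: "(\<lambda>x. real (count M t) * Y x + (- real (count M j)) * Z x) differentiable (at x)" 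
    using helmholtz_solutionD(1)[OF helmholtz_lincomb[OF hY hZ]] differentiable_def by blast
  have "multi_partial M (rotation_deriv j t u)
      = (\<lambda>x. 1 * rotation_deriv j t v x + 1 * (real (count M t) * Y x + (- real (count M j)) * Z x))"
    by (auto simp: add.IH v_def Y_def Z_def)
  then have "multi_partial (add_mset i M) (rotation_deriv j t u) x
      = partial_deriv i (rotation_deriv j t v) x
        + (real (count M t) * partial_deriv i Y x - real (count M j) * partial_deriv i Z x)"
    unfolding multi_partial_simps(2)[OF Xu]
    by (simp only: partial_deriv_lincomb[OF dX dYZ] partial_deriv_helmholtz_lincomb[OF hY hZ]) simp
  also have "\<dots> = rotation_deriv j t (partial_deriv i v) x
      + ((if i = t then partial_deriv j v x else 0) + real (count M t) * partial_deriv i Y x)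
      - ((if i = j then partial_deriv t v x else 0) + real (count M j) * partial_deriv i Z x)"
    by (simp add: partial_deriv_rotation_deriv[OF hv])
  also have "(if i = t then partial_deriv j v x else 0) + real (count M t) * partial_deriv i Y x
      = real (count (add_mset i M) t) * multi_partial (add_mset j (add_mset i M - {#t#})) u x"
  proof -
    have "partial_deriv i Y x = multi_partial (add_mset j (add_mset i (M - {#t#}))) u x"
      by (simp add: Y_def multi_partial_simps(2)[OF u, symmetric] add_mset_commute)
    moreover have "count M t > 0 \<Longrightarrow> add_mset t (M - {#t#}) = M" by simp
    ultimately show ?thesis
      by (cases "count M t = 0") (auto simp: v_def multi_partial_simps(2)[OF u, symmetric] algebra_simps)
  qed
  also have "(if i = j then partial_deriv t v x else 0) + real (count M j) * partial_deriv i Z x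
      = real (count (add_mset i M) j) * multi_partial (add_mset t (add_mset i M - {#j#})) u x"
  proof -
    have "partial_deriv i Z x = multi_partial (add_mset t (add_mset i (M - {#j#}))) u x"
      by (simp add: Z_def multi_partial_simps(2)[OF u, symmetric] add_mset_commute)
    moreover have "count M j > 0 \<Longrightarrow> add_mset j (M - {#j#}) = M" by simp
    ultimately show ?thesis
      by (cases "count M j = 0") (auto simp: v_def multi_partial_simps(2)[OF u, symmetric] algebra_simps)
  qed
  finally show ?case by (simp add: v_def multi_partial_simps(2)[OF u])
qed

text \<open>The equation trades two derivatives in direction \<open>t\<close> for tangential ones.
  Hence derivatives with at most one \<open>t\<close>, that is, the Cauchy data on
  \<open>x $ t = 0\<close>, determine all derivatives.\<close>

lemma multi_partial_laplace:
  fixes u :: "real^'n::finite \<Rightarrow> real"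
  assumes u: "helmholtz_solution 1 u"
  shows "multi_partial (add_mset t (add_mset t M)) u x
    = - multi_partial M u x - (\<Sum>i\<in>UNIV - {t}. multi_partial (add_mset i (add_mset i M)) u x)"
proof -
  have "(\<Sum>i\<in>UNIV. multi_partial (add_mset i (add_mset i M)) u x) = - multi_partial M u x"
    using helmholtz_solutionD(4)[OF helmholtz_multi_partial[OF u]]
    by (simp add: multi_partial_simps(2)[OF u])
  then show ?thesis
    by (simp add: sum.remove[of UNIV t])
qed

lemma iterated_partial_plane_wave:
  "iterated_partial is (\<lambda>x. a * cos (\<xi> \<bullet> x + \<phi>))
    = (\<lambda>x. (a * prod_list (map (($) \<xi>) is)) * cos (\<xi> \<bullet> x + (\<phi> + real (length is) * (pi / 2))))"
proof (induction "is")
  case (Cons i "is")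
  then show ?case
    by (simp only: iterated_partial_simps partial_deriv_plane_wave) (simp add: algebra_simps add_divide_distrib)
qed simp

text \<open>The wave depends on \<open>x $ t\<close> only, so its Cauchy data are constants; the
  phases 0 and \<open>- pi / 2\<close> give the pairs (1, 0) and (0, 1).\<close>

lemma cauchy_data_axis_wave:
  fixes t :: "'n::finite"
  defines "w \<phi> \<equiv> \<lambda>x :: real^'n. cos (axis t 1 \<bullet> x + \<phi>)"
  assumes "t \<notin># \<gamma>"
  shows "multi_partial \<gamma> (w \<phi>) 0 = (if \<gamma> = {#} then cos \<phi> else 0)"
    and "multi_partial (add_mset t \<gamma>) (w \<phi>) 0 = (if \<gamma> = {#} then - sin \<phi> else 0)"
proof -
  have w: "helmholtz_solution 1 (w \<phi>)"
    using helmholtz_plane_wave[of 1 "axis t 1" 1 \<phi>] by (simp add: w_def)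
  obtain "is" where "is": "\<gamma> = mset is" by (metis ex_mset)
  have it: "iterated_partial js (w \<phi>) 0
      = prod_list (map (($) (axis t 1)) js) * cos (\<phi> + real (length js) * (pi / 2))" for js
    using fun_cong[OF iterated_partial_plane_wave[of js 1 "axis t 1" \<phi>], of 0]
    by (simp add: w_def)
  have z: "prod_list (map (($) (axis t (1 :: real))) is) = (if is = [] then 1 else 0)"
  proof (cases "is")
    case (Cons i js)
    then have "i \<noteq> t" using assms(2) "is" by auto
    then show ?thesis using Cons by (simp add: axis_def)
  qed simp
  show "multi_partial \<gamma> (w \<phi>) 0 = (if \<gamma> = {#} then cos \<phi> else 0)"
    using multi_partial_mset[OF w, of "is"] it[of "is"] z "is" by auto
  show "multi_partial (add_mset t \<gamma>) (w \<phi>) 0 = (if \<gamma> = {#} then - sin \<phi> else 0)"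
    using multi_partial_mset[OF w, of "t # is"] it[of "t # is"] z "is"
    by (auto simp: minus_sin_cos_eq simp del: iterated_partial_simps)
qed

lemma finite_multisets_size_le: "finite {\<gamma> :: 'a::finite multiset. size \<gamma> \<le> n}"
proof -
  have "{\<gamma> :: 'a multiset. size \<gamma> \<le> n} \<subseteq> mset ` {xs. set xs \<subseteq> UNIV \<and> length xs \<le> n}"
    by (metis (mono_tags, lifting) ex_mset image_eqI mem_Collect_eq size_mset subsetI top_greatest)
  then show ?thesis
    by (rule finite_subset) (intro finite_imageI finite_lists_length_le finite)
qed

text \<open>Induction on the degree of the monomial. The rotation field turns normal data
  \<open>\<gamma>\<close> into function data \<open>add_mset j \<gamma>\<close> exactly, up to a
  factor. It turns function data \<open>\<gamma>\<close> into normal data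
  \<open>add_mset j \<gamma>\<close> only up to monomials of lower degree, which are subtracted by
  means of the induction hypothesis. This is why both kinds of data are built together.\<close>

lemma cauchy_data_basis:
  fixes t :: "'n::finite" and \<beta> :: "'n multiset"
  assumes "t \<notin># \<beta>"
  shows "\<exists>u \<in> wave_closure (sphere 0 1). \<forall>\<gamma>. t \<notin># \<gamma> \<longrightarrow>
      multi_partial \<gamma> u 0 = (if \<gamma> = \<beta> then 1 else 0) \<and> multi_partial (add_mset t \<gamma>) u 0 = 0"
    and "\<exists>u \<in> wave_closure (sphere 0 1). \<forall>\<gamma>. t \<notin># \<gamma> \<longrightarrow>
      multi_partial \<gamma> u 0 = 0 \<and> multi_partial (add_mset t \<gamma>) u 0 = (if \<gamma> = \<beta> then 1 else 0)"
proof -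
  let ?E = "wave_closure (sphere (0 :: real^'n) 1)"
  let ?P0 = "\<lambda>\<beta> u. \<forall>\<gamma>. t \<notin># \<gamma> \<longrightarrow>
      multi_partial \<gamma> u 0 = (if \<gamma> = \<beta> then 1 else 0) \<and> multi_partial (add_mset t \<gamma>) u 0 = 0"
  let ?P1 = "\<lambda>\<beta> u. \<forall>\<gamma>. t \<notin># \<gamma> \<longrightarrow>
      multi_partial \<gamma> u 0 = 0 \<and> multi_partial (add_mset t \<gamma>) u 0 = (if \<gamma> = \<beta> then 1 else 0)"
  have hE: "helmholtz_solution 1 u" if "u \<in> ?E" for u
    using helmholtz_wave_closure[OF _ that] by simp
  have "(\<exists>u\<in>?E. ?P0 \<beta> u) \<and> (\<exists>u\<in>?E. ?P1 \<beta> u)"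
    using assms
  proof (induction "size \<beta>" arbitrary: \<beta> rule: less_induct)
    case less
    show ?case
    proof (cases \<beta>)
      case empty
      have "(\<lambda>x :: real^'n. cos (axis t 1 \<bullet> x + \<phi>)) \<in> ?E" for \<phi>
        using waves_subset_closure[OF waves_wave[of "axis t 1" "sphere 0 1" 1 \<phi>]] by simp
      moreover have "?P0 \<beta> (\<lambda>x :: real^'n. cos (axis t 1 \<bullet> x + 0))"
        using cauchy_data_axis_wave[of t _ 0] by (auto simp: empty)
      moreover have "?P1 \<beta> (\<lambda>x :: real^'n. cos (axis t 1 \<bullet> x + (- pi / 2)))"
        using cauchy_data_axis_wave[of t _ "- pi / 2"] by (auto simp: empty)
      ultimately show ?thesis by blast
    next
      case (add j \<gamma>)
      then have jt: "j \<noteq> t" and \<gamma>: "t \<notin># \<gamma>" "size \<gamma> < size \<beta>" using less.prems by auto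
      obtain f where f: "f \<in> ?E" "?P0 \<gamma> f" using less.hyps[OF \<gamma>(2,1)] by blast
      obtain g where g: "g \<in> ?E" "?P1 \<gamma> g" using less.hyps[OF \<gamma>(2,1)] by blast
      have Xf: "rotation_deriv j t f \<in> ?E" and Xg: "rotation_deriv j t g \<in> ?E"
        using rotation_deriv_wave_closure jt f g by blast+
      have X0: "multi_partial \<delta> (rotation_deriv j t u) 0
          = - real (count \<delta> j) * multi_partial (add_mset t (\<delta> - {#j#})) u 0"
        if "u \<in> ?E" "t \<notin># \<delta>" for u \<delta>
      proof -
        have "count \<delta> t = 0" using that by (simp add: not_in_iff)
        then show ?thesis
          using multi_partial_rotation_deriv[OF hE[OF that(1)] hE, where j = j and t = t and M = \<delta> and x = 0]
            rotation_deriv_wave_closure[OF that(1) jt]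
          by (simp add: rotation_deriv_def)
      qed
      \<comment> \<open>Here the second Leibniz term contains \<open>t\<close> twice; the equation
        rewrites it as tangential derivatives, which are known data of \<open>u\<close>.\<close>
      have X1: "multi_partial (add_mset t \<delta>) (rotation_deriv j t u) 0
          = multi_partial (add_mset j \<delta>) u 0 + real (count \<delta> j) * (multi_partial (\<delta> - {#j#}) u 0
            + (\<Sum>i\<in>UNIV - {t}. multi_partial (add_mset i (add_mset i (\<delta> - {#j#}))) u 0))"
        if "u \<in> ?E" "t \<notin># \<delta>" for u \<delta>
      proof -
        have c: "count \<delta> t = 0" using that by (simp add: not_in_iff)
        have "add_mset t \<delta> - {#j#} = add_mset t (\<delta> - {#j#})" using jt by simp
        then show ?thesis
          using multi_partial_rotation_deriv[OF hE[OF that(1)] hE, where j = j and t = t and M = "add_mset t \<delta>" and x = 0]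
            rotation_deriv_wave_closure[OF that(1) jt] c jt
          by (simp add: rotation_deriv_def multi_partial_laplace[OF hE[OF that(1)], of t] algebra_simps)
      qed
      \<comment> \<open>The multiplicity of \<open>j\<close> in \<open>\<beta>\<close>, by which
        both constructions have to be divided.\<close>
      define c where "c = real (count \<gamma> j) + 1"
      have c: "c \<noteq> 0" by (simp add: c_def)
      have sub: "t \<notin># \<delta> - {#j#}" if "t \<notin># \<delta>" for \<delta>
        using that by (meson in_diffD)
      have eqb: "count \<delta> j > 0 \<Longrightarrow> (\<delta> - {#j#} = \<gamma>) = (\<delta> = \<beta>)" for \<delta>
        using add by (metis add_mset_remove_trivial count_greater_zero_iff insert_DiffM)
      have cb: "count \<beta> j = count \<gamma> j + 1" using add by simp
      have "(\<lambda>x. (- 1 / c) * rotation_deriv j t g x + 0 * g x) \<in> ?E"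
        by (rule wave_closure_lincomb[OF Xg g(1)])
      moreover have "?P0 \<beta> (\<lambda>x. (- 1 / c) * rotation_deriv j t g x + 0 * g x)"
      proof (intro allI impI)
        fix \<delta> assume \<delta>: "t \<notin># \<delta>"
        have "multi_partial \<delta> (rotation_deriv j t g) 0 = (if \<delta> = \<beta> then - c else 0)"
          unfolding X0[OF g(1) \<delta>] using g(2) sub[OF \<delta>] eqb[of \<delta>] cb
          by (cases "count \<delta> j = 0") (auto simp: c_def)
        moreover have "multi_partial (add_mset t \<delta>) (rotation_deriv j t g) 0 = 0"
          unfolding X1[OF g(1) \<delta>] using g(2) sub[OF \<delta>] \<delta> jt by simp
        ultimately show "multi_partial \<delta> (\<lambda>x. (- 1 / c) * rotation_deriv j t g x + 0 * g x) 0 = (if \<delta> = \<beta> then 1 else 0)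
          \<and> multi_partial (add_mset t \<delta>) (\<lambda>x. (- 1 / c) * rotation_deriv j t g x + 0 * g x) 0 = 0"
          unfolding multi_partial_lincomb[OF hE[OF Xg] hE[OF g(1)]] using c by simp
      qed
      ultimately have one: "\<exists>u\<in>?E. ?P0 \<beta> u" by blast
      \<comment> \<open>All unwanted normal data of \<open>rotation_deriv j t f\<close> sit at
        multi-indices of size below \<open>size \<gamma>\<close>. So \<open>L\<close> contains them
        but not \<open>\<beta>\<close>, and the induction hypothesis provides a solution
        \<open>k \<delta>\<close> for each of its members.\<close>
      define L where "L = {\<delta>. size \<delta> \<le> size \<gamma>} \<inter> {\<delta>. t \<notin># \<delta>}"
      have finL: "finite L" unfolding L_def using finite_multisets_size_le by blast
      have "\<exists>k. k \<in> ?E \<and> ?P1 \<delta> k" if "\<delta> \<in> L" for \<delta>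
        using less.hyps[of \<delta>] that \<gamma>(2) by (auto simp: L_def)
      then obtain k where k: "\<And>\<delta>. \<delta> \<in> L \<Longrightarrow> k \<delta> \<in> ?E" "\<And>\<delta>. \<delta> \<in> L \<Longrightarrow> ?P1 \<delta> (k \<delta>)"
        by metis
      define G where "G \<delta> = multi_partial (add_mset t \<delta>) (rotation_deriv j t f) 0" for \<delta>
      define s where "s x = (\<Sum>\<delta>\<in>L. G \<delta> * k \<delta> x)" for x
      have s: "s \<in> ?E" unfolding s_def[abs_def] using finL k(1) by (intro wave_closure_sum) auto
      have ms: "multi_partial M s 0 = (\<Sum>\<delta>\<in>L. G \<delta> * multi_partial M (k \<delta>) 0)" for M
        unfolding s_def[abs_def] using multi_partial_sum[OF finL, of k M G] hE k(1) by simp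
      have s0: "multi_partial \<delta> s 0 = 0" if "t \<notin># \<delta>" for \<delta>
        unfolding ms using k(2) that by simp
      have s1: "multi_partial (add_mset t \<delta>) s 0 = (if \<delta> \<in> L then G \<delta> else 0)" if "t \<notin># \<delta>" for \<delta>
      proof -
        have "multi_partial (add_mset t \<delta>) s 0 = (\<Sum>\<delta>'\<in>L. if \<delta>' = \<delta> then G \<delta>' else 0)"
          unfolding ms using k(2) that by (intro sum.cong) auto
        then show ?thesis using finL by simp
      qed
      have "(\<lambda>x. (1 / c) * rotation_deriv j t f x + (- 1 / c) * s x) \<in> ?E"
        by (rule wave_closure_lincomb[OF Xf s])
      moreover have "?P1 \<beta> (\<lambda>x. (1 / c) * rotation_deriv j t f x + (- 1 / c) * s x)"
      proof (intro allI impI)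
        fix \<delta> assume \<delta>: "t \<notin># \<delta>"
        have "multi_partial \<delta> (rotation_deriv j t f) 0 = 0"
          unfolding X0[OF f(1) \<delta>] using f(2) sub[OF \<delta>] by simp
        \<comment> \<open>Outside \<open>L\<close> the multi-index is too large for the lower-order
          terms of \<open>X1\<close> to meet \<open>\<gamma>\<close>; only the term with
          \<open>\<delta> - {#j#} = \<gamma>\<close>, that is \<open>\<delta> = \<beta>\<close>,
          remains.\<close>
        moreover have "G \<delta> - (if \<delta> \<in> L then G \<delta> else 0) = (if \<delta> = \<beta> then c else 0)"
        proof (cases "\<delta> \<in> L")
          case True
          then have "\<delta> \<noteq> \<beta>" using add by (auto simp: L_def)
          then show ?thesis using True by simp
        next
          case False
          then have size: "size \<delta> > size \<gamma>" using \<delta> by (auto simp: L_def)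
          then have 1: "add_mset j \<delta> \<noteq> \<gamma>" by auto
          have 2: "add_mset i (add_mset i (\<delta> - {#j#})) \<noteq> \<gamma>" if "count \<delta> j > 0" for i
          proof
            assume "add_mset i (add_mset i (\<delta> - {#j#})) = \<gamma>"
            then have "size \<gamma> = size (\<delta> - {#j#}) + 2" by auto
            moreover have "size (\<delta> - {#j#}) = size \<delta> - 1" using that by (simp add: size_Diff_singleton)
            ultimately show False using size by simp
          qed
          have "G \<delta> = real (count \<delta> j) * (if \<delta> = \<beta> then 1 else 0)"
            unfolding G_def X1[OF f(1) \<delta>] using f(2) sub[OF \<delta>] \<delta> jt 1 2 eqb[of \<delta>]
            by (cases "count \<delta> j = 0") auto
          then show ?thesis using False cb by (simp add: c_def)
        qed
        ultimately show "multi_partial \<delta> (\<lambda>x. (1 / c) * rotation_deriv j t f x + (- 1 / c) * s x) 0 = 0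
          \<and> multi_partial (add_mset t \<delta>) (\<lambda>x. (1 / c) * rotation_deriv j t f x + (- 1 / c) * s x) 0
            = (if \<delta> = \<beta> then 1 else 0)"
          unfolding multi_partial_lincomb[OF hE[OF Xf] hE[OF s]] s0[OF \<delta>] s1[OF \<delta>] G_def[symmetric]
          using c by (auto simp: field_simps)
      qed
      ultimately have "\<exists>u\<in>?E. ?P1 \<beta> u" by blast
      with one show ?thesis by blast
    qed
  qed
  then show "\<exists>u\<in>?E. ?P0 \<beta> u" "\<exists>u\<in>?E. ?P1 \<beta> u" by auto
qed

section \<open>Density of plane waves\<close>

text \<open>Eliminating two derivatives in direction \<open>t\<close> by the equation produces
  \<open>CARD('n)\<close> terms with two fewer of them and no larger order. The factor needed once
  per pair is generously spent once per \<open>t\<close>.\<close>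

lemma multi_partial_bound_reduced:
  fixes v :: "real^'n::finite \<Rightarrow> real"
  assumes v: "helmholtz_solution 1 v" and B: "B \<ge> 0"
    and red: "\<And>M. size M \<le> m \<Longrightarrow> count M t \<le> 1 \<Longrightarrow> \<bar>multi_partial M v 0\<bar> \<le> B"
    and "size M \<le> m"
  shows "\<bar>multi_partial M v 0\<bar> \<le> real CARD('n) ^ count M t * B"
  using \<open>size M \<le> m\<close>
proof (induction "count M t" arbitrary: M rule: less_induct)
  case less
  define d where "d = real CARD('n)"
  have d1: "d \<ge> 1" unfolding d_def by (simp add: Suc_leI)
  show ?case
  proof (cases "count M t \<le> 1")
    case True
    have "1 * B \<le> d ^ count M t * B" using d1 B by (intro mult_right_mono) auto
    then show ?thesis using red[OF less.prems True] by (simp add: d_def)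
  next
    case False
    define N where "N = M - {#t#} - {#t#}"
    have 1: "t \<in># M" and 2: "t \<in># M - {#t#}"
      using False by (simp_all flip: count_greater_zero_iff)
    have M: "M = add_mset t (add_mset t N)"
      unfolding N_def insert_DiffM[OF 2] insert_DiffM[OF 1] ..
    have cM: "count M t = count N t + 2" and sM: "size M = size N + 2" by (simp_all add: M)
    have b: "\<bar>multi_partial M' v 0\<bar> \<le> d ^ count N t * B" if "count M' t = count N t" "size M' \<le> m" for M'
      using less.hyps[of M'] that cM by (simp add: d_def)
    have "\<bar>multi_partial M v 0\<bar> \<le> \<bar>multi_partial N v 0\<bar> + (\<Sum>i\<in>UNIV - {t}. \<bar>multi_partial (add_mset i (add_mset i N)) v 0\<bar>)"
    proof -
      have "\<bar>\<Sum>i\<in>UNIV - {t}. multi_partial (add_mset i (add_mset i N)) v 0\<bar>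
          \<le> (\<Sum>i\<in>UNIV - {t}. \<bar>multi_partial (add_mset i (add_mset i N)) v 0\<bar>)" by (rule sum_abs)
      then show ?thesis
        using multi_partial_laplace[OF v, of t N 0] unfolding M[symmetric] by linarith
    qed
    also have "\<dots> \<le> d ^ count N t * B + (\<Sum>i\<in>UNIV - {t}. d ^ count N t * B)"
      using sM less.prems by (intro add_mono sum_mono b) auto
    also have "\<dots> = d * (d ^ count N t * B)"
      by (simp add: d_def card_Diff_singleton of_nat_diff algebra_simps)
    also have "\<dots> \<le> d * (d * (d ^ count N t * B))"
      using d1 B mult_right_mono[of 1 d "d * (d ^ count N t * B)"] by simp
    finally show ?thesis by (simp add: cM d_def mult_ac)
  qed
qed

text \<open>A finite combination of the basis solutions, with the Cauchy data of \<open>h\<close> up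
  to order \<open>N\<close> as coefficients. Nothing is required of \<open>h\<close>, whose
  derivatives at 0 enter as numbers only.\<close>

lemma cauchy_data_truncation:
  fixes h :: "real^'n::finite \<Rightarrow> real" and t :: 'n
  obtains p where "p \<in> wave_closure (sphere 0 1)"
    "\<And>\<gamma>. t \<notin># \<gamma> \<Longrightarrow> multi_partial \<gamma> p 0 = (if size \<gamma> \<le> N then multi_partial \<gamma> h 0 else 0)"
    "\<And>\<gamma>. t \<notin># \<gamma> \<Longrightarrow> multi_partial (add_mset t \<gamma>) p 0
      = (if size \<gamma> \<le> N then multi_partial (add_mset t \<gamma>) h 0 else 0)"
proof -
  let ?E = "wave_closure (sphere (0 :: real^'n) 1)"
  have hE: "helmholtz_solution 1 u" if "u \<in> ?E" for u
    using helmholtz_wave_closure[OF _ that] by simp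
  define L where "L = {\<delta> :: 'n multiset. size \<delta> \<le> N} \<inter> {\<delta>. t \<notin># \<delta>}"
  have finL: "finite L" unfolding L_def using finite_multisets_size_le by blast
  have "\<exists>k. k \<in> ?E \<and> (\<forall>\<gamma>. t \<notin># \<gamma> \<longrightarrow>
      multi_partial \<gamma> k 0 = (if \<gamma> = \<beta> then 1 else 0) \<and> multi_partial (add_mset t \<gamma>) k 0 = 0)"
    if "\<beta> \<in> L" for \<beta>
    using cauchy_data_basis(1)[of t \<beta>] that by (auto simp: L_def)
  then obtain k where k: "\<And>\<beta>. \<beta> \<in> L \<Longrightarrow> k \<beta> \<in> ?E"
      "\<And>\<beta> \<gamma>. \<beta> \<in> L \<Longrightarrow> t \<notin># \<gamma> \<Longrightarrow> multi_partial \<gamma> (k \<beta>) 0 = (if \<gamma> = \<beta> then 1 else 0)"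
      "\<And>\<beta> \<gamma>. \<beta> \<in> L \<Longrightarrow> t \<notin># \<gamma> \<Longrightarrow> multi_partial (add_mset t \<gamma>) (k \<beta>) 0 = 0"
    by metis
  have "\<exists>l. l \<in> ?E \<and> (\<forall>\<gamma>. t \<notin># \<gamma> \<longrightarrow>
      multi_partial \<gamma> l 0 = 0 \<and> multi_partial (add_mset t \<gamma>) l 0 = (if \<gamma> = \<beta> then 1 else 0))"
    if "\<beta> \<in> L" for \<beta>
    using cauchy_data_basis(2)[of t \<beta>] that by (auto simp: L_def)
  then obtain l where l: "\<And>\<beta>. \<beta> \<in> L \<Longrightarrow> l \<beta> \<in> ?E"
      "\<And>\<beta> \<gamma>. \<beta> \<in> L \<Longrightarrow> t \<notin># \<gamma> \<Longrightarrow> multi_partial (add_mset t \<gamma>) (l \<beta>) 0 = (if \<gamma> = \<beta> then 1 else 0)"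
      "\<And>\<beta> \<gamma>. \<beta> \<in> L \<Longrightarrow> t \<notin># \<gamma> \<Longrightarrow> multi_partial \<gamma> (l \<beta>) 0 = 0"
    by metis
  define f where "f x = (\<Sum>\<beta>\<in>L. multi_partial \<beta> h 0 * k \<beta> x)" for x
  define g where "g x = (\<Sum>\<beta>\<in>L. multi_partial (add_mset t \<beta>) h 0 * l \<beta> x)" for x
  have f: "f \<in> ?E" and g: "g \<in> ?E"
    unfolding f_def[abs_def] g_def[abs_def] using finL k(1) l(1) by (auto intro!: wave_closure_sum)
  have mf: "multi_partial M f 0 = (\<Sum>\<beta>\<in>L. multi_partial \<beta> h 0 * multi_partial M (k \<beta>) 0)" for M
    unfolding f_def[abs_def] using multi_partial_sum[OF finL, of k M] hE k(1) by simp
  have mg: "multi_partial M g 0 = (\<Sum>\<beta>\<in>L. multi_partial (add_mset t \<beta>) h 0 * multi_partial M (l \<beta>) 0)" for M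
    unfolding g_def[abs_def] using multi_partial_sum[OF finL, of l M] hE l(1) by simp
  show ?thesis
  proof (rule that[of "\<lambda>x. 1 * f x + 1 * g x"])
    show "(\<lambda>x. 1 * f x + 1 * g x) \<in> ?E" by (rule wave_closure_lincomb[OF f g])
    fix \<gamma> assume \<gamma>: "t \<notin># \<gamma>"
    have "multi_partial \<gamma> f 0 = (\<Sum>\<beta>\<in>L. if \<beta> = \<gamma> then multi_partial \<beta> h 0 else 0)"
      unfolding mf using k(2) \<gamma> by (intro sum.cong) auto
    moreover have "multi_partial \<gamma> g 0 = 0" unfolding mg using l(3) \<gamma> by simp
    ultimately show "multi_partial \<gamma> (\<lambda>x. 1 * f x + 1 * g x) 0 = (if size \<gamma> \<le> N then multi_partial \<gamma> h 0 else 0)"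
      unfolding multi_partial_lincomb[OF hE[OF f] hE[OF g]] using finL \<gamma> by (simp add: L_def)
    have "multi_partial (add_mset t \<gamma>) g 0 = (\<Sum>\<beta>\<in>L. if \<beta> = \<gamma> then multi_partial (add_mset t \<beta>) h 0 else 0)"
      unfolding mg using l(2) \<gamma> by (intro sum.cong) auto
    moreover have "multi_partial (add_mset t \<gamma>) f 0 = 0" unfolding mf using k(3) \<gamma> by simp
    ultimately show "multi_partial (add_mset t \<gamma>) (\<lambda>x. 1 * f x + 1 * g x) 0
        = (if size \<gamma> \<le> N then multi_partial (add_mset t \<gamma>) h 0 else 0)"
      unfolding multi_partial_lincomb[OF hE[OF f] hE[OF g]] using finL \<gamma> by (simp add: L_def)
  qed
qed

text \<open>The sequence \<open>\<epsilon> ^ s * fact s\<close> first falls and then rises, so on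
  \<open>0..m\<close> it is bounded by its end values 1 and \<open>\<epsilon> ^ m * fact m\<close>.
  This is needed because elimination by the equation lowers the order of derivatives.\<close>

lemma power_mult_fact_le:
  fixes \<epsilon> :: real
  assumes "\<epsilon> \<ge> 0" "s \<le> m"
  shows "\<epsilon> ^ s * fact s \<le> 1 + \<epsilon> ^ m * fact m"
proof -
  have "\<epsilon> ^ s * fact s \<le> max 1 (\<epsilon> ^ m * fact m)"
    using assms(2)
  proof (induction m)
    case (Suc m)
    show ?case
    proof (cases "s = Suc m")
      case False
      then have IH: "\<epsilon> ^ s * fact s \<le> max 1 (\<epsilon> ^ m * fact m)" using Suc by simp
      have eq: "\<epsilon> ^ Suc m * fact (Suc m) = (\<epsilon> ^ m * fact m) * (\<epsilon> * real (Suc m))"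
        by (simp add: algebra_simps)
      show ?thesis
      proof (cases "\<epsilon> * real (Suc m) \<ge> 1")
        case True
        then have "(\<epsilon> ^ m * fact m) * 1 \<le> \<epsilon> ^ Suc m * fact (Suc m)"
          unfolding eq using assms(1) by (intro mult_left_mono) auto
        then show ?thesis using IH by simp
      next
        case False
        then have em: "\<epsilon> * real m \<le> 1" using assms(1) by (simp add: algebra_simps)
        have "\<epsilon> ^ m * fact m \<le> \<epsilon> ^ m * real (m ^ m)"
          using assms(1) by (intro mult_left_mono fact_le_power) auto
        also have "\<dots> = (\<epsilon> * real m) ^ m" by (simp add: power_mult_distrib)
        also have "\<dots> \<le> 1" using em assms(1) by (intro power_le_one) auto
        finally show ?thesis using IH by simp
      qed
    qed simp
  qed simp
  moreover have "\<epsilon> ^ m * fact m \<ge> 0" using assms(1) by simp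
  ultimately show ?thesis by linarith
qed

theorem helmholtz_in_wave_closure:
  fixes h :: "real^'n::finite \<Rightarrow> real"
  assumes h: "helmholtz_solution 1 h"
  shows "h \<in> wave_closure (sphere 0 1)"
proof (rule wave_closure_approx)
  fix R e :: real assume R: "R > 0" and e: "e > 0"
  let ?E = "wave_closure (sphere (0 :: real^'n) 1)"
  fix t :: 'n
  define d where "d = real CARD('n)"
  have d1: "d \<ge> 1" unfolding d_def by (simp add: Suc_leI)
  \<comment> \<open>One factor \<open>d\<close> stems from expanding powers of the directional
    derivative, the other from reducing derivatives to Cauchy data. With
    \<open>c * \<epsilon> = 1 / 2\<close> the relevant series is geometric with ratio 1/2.\<close>
  define c where "c = d * R * d"
  have c: "c > 0" using d1 R by (simp add: c_def)
  define \<epsilon> where "\<epsilon> = 1 / (2 * c)"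
  have \<epsilon>: "\<epsilon> > 0" and c\<epsilon>: "c * \<epsilon> = 1 / 2" using c by (simp_all add: \<epsilon>_def)
  obtain K where K: "K \<ge> 0" "\<And>is. \<bar>iterated_partial is h 0\<bar> \<le> K * \<epsilon> ^ length is * fact (length is)"
    using helmholtz_jet_decay[OF h \<epsilon>] by blast
  have K': "\<bar>multi_partial M h 0\<bar> \<le> K * (\<epsilon> ^ size M * fact (size M))" for M
  proof -
    obtain "is" where "M = mset is" by (metis ex_mset)
    then show ?thesis using K(2)[of "is"] multi_partial_mset[OF h, of "is"] by (simp add: mult.assoc)
  qed
  \<comment> \<open>Majorant for the \<open>m\<close>-th Taylor term of the error, in which the
    truncation order does not occur; so \<open>N\<close> can be chosen afterwards, from the tail of
    the sum.\<close>
  define A where "A m = K * (c ^ m / fact m + (1 / 2) ^ m)" for m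
  have A0: "A m \<ge> 0" for m using K(1) c by (simp add: A_def)
  have "summable (\<lambda>m. c ^ m / fact m)"
    using summable_exp[of c] by (simp add: divide_inverse mult.commute)
  then have "summable A"
    unfolding A_def by (intro summable_mult summable_add summable_geometric) auto
  then obtain N where N: "\<And>n. norm (sum A {N..<n}) < e / 2"
    using e unfolding summable_Cauchy by (metis half_gt_zero order_refl)
  obtain p where p: "p \<in> ?E"
    "\<And>\<gamma>. t \<notin># \<gamma> \<Longrightarrow> multi_partial \<gamma> p 0 = (if size \<gamma> \<le> N then multi_partial \<gamma> h 0 else 0)"
    "\<And>\<gamma>. t \<notin># \<gamma> \<Longrightarrow> multi_partial (add_mset t \<gamma>) p 0
      = (if size \<gamma> \<le> N then multi_partial (add_mset t \<gamma>) h 0 else 0)"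
    using cauchy_data_truncation[of t N h] by blast
  have hp: "helmholtz_solution 1 p" using helmholtz_wave_closure[OF _ p(1)] by simp
  define v where "v x = 1 * h x + (- 1) * p x" for x
  have hv: "helmholtz_solution 1 v"
    unfolding v_def[abs_def] by (rule helmholtz_lincomb[OF h hp])
  have mv: "multi_partial M v 0 = multi_partial M h 0 - multi_partial M p 0" for M
    unfolding v_def[abs_def] multi_partial_lincomb[OF h hp] by simp
  \<comment> \<open>Up to order \<open>N\<close> the Cauchy data of \<open>h\<close> and
    \<open>p\<close> agree; beyond it those of the error are either 0 or those of
    \<open>h\<close>.\<close>
  have red: "\<bar>multi_partial M v 0\<bar> \<le> (if size M \<le> N then 0 else K * (\<epsilon> ^ size M * fact (size M)))"
    if "count M t \<le> 1" for M
  proof (cases "count M t = 0")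
    case True
    then have "t \<notin># M" by (simp add: not_in_iff)
    then show ?thesis using K'[of M] p(2)[of M] by (simp add: mv)
  next
    case False
    define \<gamma> where "\<gamma> = M - {#t#}"
    have M: "M = add_mset t \<gamma>" using False by (simp add: \<gamma>_def)
    then have "t \<notin># \<gamma>" using that by (simp add: not_in_iff)
    then show ?thesis using K'[of M] p(3)[of \<gamma>] by (auto simp: mv M)
  qed
  define b where "b m = (if m \<le> N then 0 else d ^ m * (K * (1 + \<epsilon> ^ m * fact m)))" for m
  have bound: "\<bar>iterated_partial is v 0\<bar> \<le> b (length is)" for "is"
  proof -
    define m where "m = length is"
    define B where "B = (if m \<le> N then 0 else K * (1 + \<epsilon> ^ m * fact m))"
    have B: "B \<ge> 0" using K(1) \<epsilon> by (simp add: B_def)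
    have bd: "\<bar>multi_partial M v 0\<bar> \<le> B" if "size M \<le> m" "count M t \<le> 1" for M
    proof -
      have "K * (\<epsilon> ^ size M * fact (size M)) \<le> K * (1 + \<epsilon> ^ m * fact m)"
        using K(1) \<epsilon> that by (intro mult_left_mono power_mult_fact_le) auto
      then show ?thesis using red[OF that(2)] that(1) B by (auto simp: B_def split: if_splits)
    qed
    have "\<bar>iterated_partial is v 0\<bar> \<le> d ^ count (mset is) t * B"
      unfolding multi_partial_mset[OF hv, symmetric] d_def
      by (rule multi_partial_bound_reduced[OF hv B bd]) (auto simp: m_def)
    also have "\<dots> \<le> d ^ m * B"
      using d1 B by (intro mult_right_mono power_increasing) (use count_le_size[of "mset is" t] in \<open>auto simp: m_def\<close>)
    also have "\<dots> = b m" by (simp add: B_def b_def)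
    finally show ?thesis by (simp add: m_def)
  qed
  have sums: "(\<Sum>m<n. (real CARD('n) * R) ^ m * b m / fact m) \<le> e / 2" for n
  proof -
    have term_eq: "(d * R) ^ m * b m / fact m = (if m \<le> N then 0 else A m)" for m
    proof -
      have "(d * R) ^ m * (d ^ m * (K * (1 + \<epsilon> ^ m * fact m))) / fact m
          = K * (c ^ m / fact m + (c * \<epsilon>) ^ m)"
        by (simp add: c_def power_mult_distrib field_simps)
      then show ?thesis by (simp add: b_def A_def c\<epsilon>)
    qed
    have "(\<Sum>m<n. (d * R) ^ m * b m / fact m) = (\<Sum>m\<in>{..<n} \<inter> {m. \<not> m \<le> N}. A m)"
      unfolding term_eq by (simp add: sum.inter_restrict if_distrib cong: if_cong) (auto intro: sum.cong)
    also have "\<dots> \<le> (\<Sum>m\<in>{N..<n}. A m)"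
      using A0 by (intro sum_mono2) auto
    also have "\<dots> \<le> e / 2" using N[of n] by simp
    finally show ?thesis by (simp add: d_def)
  qed
  have "\<bar>p x - h x\<bar> < e" if "x \<in> cball 0 R" for x
  proof -
    have "\<bar>v x\<bar> \<le> e / 2"
      by (rule helmholtz_bound_from_jet[OF hv bound sums]) (use that in simp)
    then show ?thesis using e unfolding v_def by linarith
  qed
  then show "\<exists>p\<in>?E. \<forall>x\<in>cball 0 R. \<bar>p x - h x\<bar> < e" using p(1) by blast
qed

text \<open>Cosine is 1-Lipschitz, so moving a frequency by \<open>\<delta>\<close> changes a wave
  of amplitude \<open>a\<close> on the ball of radius \<open>R\<close> by at most
  \<open>\<bar>a\<bar> * \<delta> * R\<close>.\<close>

lemma wave_closure_dense_directions:
  fixes D :: "(real^'n::finite) set"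
  assumes dense: "\<And>\<xi> e. norm \<xi> = 1 \<Longrightarrow> e > 0 \<Longrightarrow> \<exists>\<zeta>\<in>D. dist \<zeta> \<xi> < e"
    and h: "helmholtz_solution 1 h"
  shows "h \<in> wave_closure D"
proof -
  have wave: "(\<lambda>x. a * cos (\<xi> \<bullet> x + \<phi>)) \<in> wave_closure D" if \<xi>: "norm \<xi> = 1" for \<xi> a \<phi>
  proof (rule wave_closure_approx)
    fix R e :: real assume R: "R > 0" and e: "e > 0"
    \<comment> \<open>Avoids division by zero for \<open>a = 0\<close>.\<close>
    define b where "b = \<bar>a\<bar> + 1"
    have b: "b > 0" "\<bar>a\<bar> < b" by (simp_all add: b_def)
    define \<delta> where "\<delta> = e / (b * R)"
    have "\<delta> > 0" using R e b by (simp add: \<delta>_def)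
    then obtain \<zeta> where \<zeta>: "\<zeta> \<in> D" "dist \<zeta> \<xi> < \<delta>" using dense[OF \<xi>] by blast
    have "\<bar>a * cos (\<zeta> \<bullet> x + \<phi>) - a * cos (\<xi> \<bullet> x + \<phi>)\<bar> < e" if x: "x \<in> cball 0 R" for x
    proof -
      have cos_lip: "\<bar>cos p - cos q\<bar> \<le> \<bar>p - q\<bar>" for p q :: real
      proof -
        have "\<bar>cos p - cos q\<bar> = 2 * (\<bar>sin ((p + q) / 2)\<bar> * \<bar>sin ((q - p) / 2)\<bar>)"
          by (simp add: cos_diff_cos abs_mult)
        also have "\<dots> \<le> 2 * (1 * \<bar>(q - p) / 2\<bar>)"
          by (intro mult_left_mono mult_mono abs_sin_le_one abs_sin_x_le_abs_x) auto
        finally show ?thesis by simp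
      qed
      have "\<bar>a * cos (\<zeta> \<bullet> x + \<phi>) - a * cos (\<xi> \<bullet> x + \<phi>)\<bar> = \<bar>a\<bar> * \<bar>cos (\<zeta> \<bullet> x + \<phi>) - cos (\<xi> \<bullet> x + \<phi>)\<bar>"
        by (simp add: right_diff_distrib[symmetric] abs_mult)
      also have "\<dots> \<le> \<bar>a\<bar> * \<bar>(\<zeta> - \<xi>) \<bullet> x\<bar>"
        using cos_lip[of "\<zeta> \<bullet> x + \<phi>" "\<xi> \<bullet> x + \<phi>"] by (intro mult_left_mono) (auto simp: inner_diff_left)
      also have "\<dots> \<le> \<bar>a\<bar> * (norm (\<zeta> - \<xi>) * R)"
        using x by (intro mult_left_mono order.trans[OF Cauchy_Schwarz_ineq2] mult_left_mono) auto
      also have "\<dots> \<le> \<bar>a\<bar> * (\<delta> * R)"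
        using \<zeta>(2) R by (intro mult_left_mono mult_right_mono) (auto simp: dist_norm)
      also have "\<dots> < b * (\<delta> * R)"
        using \<open>\<delta> > 0\<close> R b by (intro mult_strict_right_mono) auto
      also have "\<dots> = e" using R b by (simp add: \<delta>_def)
      finally show ?thesis .
    qed
    then show "\<exists>p\<in>wave_closure D. \<forall>x\<in>cball 0 R. \<bar>p x - a * cos (\<xi> \<bullet> x + \<phi>)\<bar> < e"
      by (intro bexI[OF _ waves_subset_closure[OF waves_wave[OF \<zeta>(1), of a \<phi>]]]) simp
  qed
  have "w \<in> wave_closure D" if "w \<in> waves (sphere 0 1)" for w
    using that
  proof (induction w rule: waves.induct)
    case (waves_add_wave w \<xi> a \<phi>)
    then show ?case
      using wave_closure_lincomb[OF waves_add_wave(3) wave[of \<xi> a \<phi>], of 1 1] by simp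
  qed (simp add: waves_subset_closure waves_zero)
  moreover obtain w where "\<And>n. w n \<in> waves (sphere 0 1)" "locally_uniform_limit w h"
    using wave_closure_sequence[OF helmholtz_in_wave_closure[OF h]] by blast
  ultimately show ?thesis using wave_closure_limit by blast
qed

section \<open>Tori with an integral quadratic form\<close>

definition integer_vector :: "real^'n \<Rightarrow> bool" where
  "integer_vector k \<longleftrightarrow> (\<forall>i. k $ i \<in> \<int>)"

lemma integer_vector_intros:
  "integer_vector (axis i 1)"
  "integer_vector k \<Longrightarrow> integer_vector l \<Longrightarrow> integer_vector (k + l)"
  "integer_vector k \<Longrightarrow> c \<in> \<int> \<Longrightarrow> integer_vector (c *\<^sub>R k)"
  by (auto simp: integer_vector_def axis_def)

lemma inner_integer_vector: "integer_vector k \<Longrightarrow> integer_vector l \<Longrightarrow> k \<bullet> l \<in> \<int>"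
  by (auto simp: integer_vector_def inner_vec_def intro!: Ints_sum Ints_mult)

lemma lattice_of_iff: "\<gamma> \<in> lattice_of A \<longleftrightarrow> (\<exists>k. integer_vector k \<and> \<gamma> = A *v k)"
  by (auto simp: lattice_of_def integer_vector_def)

context
  fixes A :: "real^'n::finite^'n"
  assumes A: "invertible A"
begin

lemma transpose_matrix_inv_transpose:
  "transpose A ** matrix_inv (transpose A) = mat 1" "matrix_inv (transpose A) ** transpose A = mat 1"
  using someI_ex[OF transpose_invertible[OF A, unfolded invertible_def]]
  by (auto simp: matrix_inv_def)

lemma inner_dual_lattice: "(matrix_inv (transpose A) *v k) \<bullet> (A *v j) = k \<bullet> j"
  by (simp flip: dot_lmul_matrix transpose_matrix_vector add: matrix_vector_mul_assoc transpose_matrix_inv_transpose)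

lemma dual_basis_inverse:
  "matrix_inv (transpose A) *v (transpose A *v x) = x" "transpose A *v (matrix_inv (transpose A) *v x) = x"
  by (simp_all add: matrix_vector_mul_assoc transpose_matrix_inv_transpose del: transpose_matrix_vector)

lemma dual_basis_eq_0_iff: "matrix_inv (transpose A) *v k = 0 \<longleftrightarrow> k = 0"
  using dual_basis_inverse(2)[of k] by (metis matrix_vector_mult_0_right)

lemma cos_dual_lattice_periodic:
  assumes "integer_vector k" "\<gamma> \<in> lattice_of A"
  shows "cos (((2 * pi) *\<^sub>R (matrix_inv (transpose A) *v k)) \<bullet> (x + \<gamma>) + \<phi>)
    = cos (((2 * pi) *\<^sub>R (matrix_inv (transpose A) *v k)) \<bullet> x + \<phi>)"
proof -
  obtain j where j: "integer_vector j" "\<gamma> = A *v j"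
    using assms(2) by (auto simp: lattice_of_iff)
  obtain n where n: "k \<bullet> j = of_int n"
    using inner_integer_vector[OF assms(1) j(1)] Ints_cases by blast
  define y where "y = ((2 * pi) *\<^sub>R (matrix_inv (transpose A) *v k)) \<bullet> x + \<phi>"
  have "((2 * pi) *\<^sub>R (matrix_inv (transpose A) *v k)) \<bullet> (x + \<gamma>) + \<phi> = y + 2 * pi * of_int n"
    by (simp add: y_def inner_add_right j(2) inner_dual_lattice n algebra_simps)
  then show ?thesis
    unfolding y_def[symmetric] by (simp only: cos_add cos_int_2pin sin_int_2pin mult_1_right mult_zero_right diff_zero)
qed

text \<open>Unit vectors that become frequencies of the torus after multiplication by
  \<open>\<sigma>\<close> and some denominator \<open>N\<close>. The scale \<open>\<sigma>\<close>
  is shared, so finitely many directions have a common multiple of this kind.\<close>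

definition lattice_directions :: "real \<Rightarrow> (real^'n) set" where
  "lattice_directions \<sigma> = {\<xi>. norm \<xi> = 1 \<and> (\<exists>N::nat. N > 0 \<and> (\<exists>k. integer_vector k \<and>
     (real N * \<sigma>) *\<^sub>R \<xi> = (2 * pi) *\<^sub>R (matrix_inv (transpose A) *v k)))}"

text \<open>The product of the denominators works for a whole sum of waves. Arbitrary multiples
  \<open>m\<close> are allowed both for the induction and for sending the eigenvalues to
  infinity.\<close>

lemma waves_lattice_periodic:
  assumes "w \<in> waves (lattice_directions \<sigma>)"
  shows "\<exists>N::nat. N > 0 \<and> (\<forall>m::nat. \<forall>x. \<forall>\<gamma>\<in>lattice_of A.
    w ((real m * real N * \<sigma>) *\<^sub>R (x + \<gamma>)) = w ((real m * real N * \<sigma>) *\<^sub>R x))"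
  using assms
proof (induction w rule: waves.induct)
  case waves_zero
  then show ?case by (intro exI[of _ 1]) simp
next
  case (waves_add_wave w \<xi> a \<phi>)
  obtain N1 :: nat where N1: "N1 > 0" "\<And>m x \<gamma>. \<gamma> \<in> lattice_of A \<Longrightarrow>
      w ((real m * real N1 * \<sigma>) *\<^sub>R (x + \<gamma>)) = w ((real m * real N1 * \<sigma>) *\<^sub>R x)"
    using waves_add_wave.IH by blast
  obtain N2 :: nat and k where N2: "N2 > 0" "integer_vector k"
      "(real N2 * \<sigma>) *\<^sub>R \<xi> = (2 * pi) *\<^sub>R (matrix_inv (transpose A) *v k)"
    using waves_add_wave.hyps by (auto simp: lattice_directions_def)
  have "w ((real m * real (N1 * N2) * \<sigma>) *\<^sub>R (x + \<gamma>)) + a * cos (\<xi> \<bullet> ((real m * real (N1 * N2) * \<sigma>) *\<^sub>R (x + \<gamma>)) + \<phi>)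
      = w ((real m * real (N1 * N2) * \<sigma>) *\<^sub>R x) + a * cos (\<xi> \<bullet> ((real m * real (N1 * N2) * \<sigma>) *\<^sub>R x) + \<phi>)"
    if \<gamma>: "\<gamma> \<in> lattice_of A" for m x \<gamma>
  proof -
    define k' where "k' = real (m * N1) *\<^sub>R k"
    have k': "integer_vector k'" unfolding k'_def by (intro integer_vector_intros N2) simp
    have eq: "\<xi> \<bullet> ((real m * real (N1 * N2) * \<sigma>) *\<^sub>R y) = ((2 * pi) *\<^sub>R (matrix_inv (transpose A) *v k')) \<bullet> y" for y
    proof -
      have "\<xi> \<bullet> ((real m * real (N1 * N2) * \<sigma>) *\<^sub>R y) = real (m * N1) * (((real N2 * \<sigma>) *\<^sub>R \<xi>) \<bullet> y)"
        by (simp add: mult_ac)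
      also have "\<dots> = ((2 * pi) *\<^sub>R (matrix_inv (transpose A) *v k')) \<bullet> y"
        unfolding N2(3) by (simp add: k'_def scaleR_matrix_vector_assoc[symmetric] matrix_vector_mult_scaleR mult_ac)
      finally show ?thesis .
    qed
    show ?thesis
      unfolding eq cos_dual_lattice_periodic[OF k' \<gamma>]
      using N1(2)[OF \<gamma>, of "m * N2" x] by (simp add: mult_ac)
  qed
  then show ?case using N1(1) N2(1) by (intro exI[of _ "N1 * N2"]) auto
qed

text \<open>Stereographic projection of the sphere from a rational point. The unknown factor
  \<open>c\<close> cancels in the quotient of a polarised value of \<open>Q\<close> by a value of
  \<open>Q\<close>, so integer vectors give rational points. The scale \<open>\<sigma>\<close> is
  chosen to make the normalised frequency of \<open>axis t 1\<close> the base point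
  \<open>p0\<close>.\<close>

lemma lattice_directions_dense:
  fixes q :: "real^'n \<Rightarrow> real" and t :: 'n
  assumes Q: "\<And>k. lattice_form A k = c * q k"
    and q: "\<And>k. integer_vector k \<Longrightarrow> q k \<in> \<int>"
    and \<xi>: "norm \<xi> = 1" and e: "e > 0"
  defines "\<sigma> \<equiv> 2 * pi * norm (matrix_inv (transpose A) *v axis t 1)"
  shows "\<exists>\<zeta>\<in>lattice_directions \<sigma>. dist \<zeta> \<xi> < e"
proof -
  define B where "B = matrix_inv (transpose A)"
  define k0 where "k0 = (axis t 1 :: real^'n)"
  have k0: "integer_vector k0" by (simp add: k0_def integer_vector_intros)
  have Bk0: "B *v k0 \<noteq> 0" unfolding B_def dual_basis_eq_0_iff by (simp add: k0_def axis_eq_0_iff)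
  then have \<sigma>: "\<sigma> > 0" by (simp add: \<sigma>_def B_def k0_def)
  have QB: "4 * pi\<^sup>2 * (norm (B *v k))\<^sup>2 = c * q k" for k
    using Q[of k] by (simp add: lattice_form_def B_def)
  define p0 where "p0 = (2 * pi / \<sigma>) *\<^sub>R (B *v k0)"
  have p0: "norm p0 = 1" using \<sigma> Bk0 by (simp add: p0_def \<sigma>_def B_def k0_def)
  \<comment> \<open>the second intersection of the sphere with the line through \<open>- p0\<close> in direction \<open>B *v v\<close>\<close>
  define \<zeta> where "\<zeta> v = (2 * (p0 \<bullet> (B *v v)) / (norm (B *v v))\<^sup>2) *\<^sub>R (B *v v) - p0" for v
  have \<zeta>_norm: "norm (\<zeta> v) = 1" for v
  \<comment> \<open>For \<open>B *v v = 0\<close> division by zero yields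
    \<open>\<zeta> v = - p0\<close>, which is the right value for the one point missed by the
    projection.\<close>
  proof (cases "B *v v = 0")
    case False
    then have "\<zeta> v \<bullet> \<zeta> v = p0 \<bullet> p0"
      unfolding \<zeta>_def power2_norm_eq_inner
      by (simp add: inner_diff_left inner_diff_right inner_commute[of "B *v v" p0] field_simps)
    then show ?thesis using p0 by (simp add: norm_eq_sqrt_inner)
  qed (simp add: \<zeta>_def p0)
  have \<zeta>_scale: "\<zeta> (s *\<^sub>R v) = \<zeta> v" if "s \<noteq> 0" for s v
    using that unfolding \<zeta>_def matrix_vector_mult_scaleR power2_norm_eq_inner
    by (simp add: field_simps)
  have \<zeta>_mem: "\<zeta> w \<in> lattice_directions \<sigma>" if w: "integer_vector w" for w
  proof (cases "w = 0")
    case True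
    have "(real 1 * \<sigma>) *\<^sub>R \<zeta> w = (2 * pi) *\<^sub>R (B *v ((- 1) *\<^sub>R k0))"
      unfolding matrix_vector_mult_scaleR using \<sigma> True by (simp add: \<zeta>_def p0_def)
    moreover have "integer_vector ((- 1) *\<^sub>R k0)" by (intro integer_vector_intros k0) simp
    ultimately show ?thesis
      unfolding lattice_directions_def B_def using \<zeta>_norm zero_less_one by blast
  next
    case False
    then have "B *v w \<noteq> 0" unfolding B_def dual_basis_eq_0_iff by simp
    then have "c * q w \<noteq> 0" using QB[of w] by (metis mult_eq_0_iff norm_eq_zero pi_neq_zero power_not_zero zero_neq_numeral)
    then have c0: "c \<noteq> 0" and qw: "q w \<noteq> 0" by auto
    obtain b where b: "q w = of_int b" using q[OF w] Ints_cases by blast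
    obtain a where a: "q (k0 + w) - q k0 - q w = of_int a"
      using q[OF w] q[OF k0] q[OF integer_vector_intros(2)[OF k0 w]] by (meson Ints_cases Ints_diff)
    define N where "N = nat \<bar>b\<bar>"
    have N: "N > 0" "real N = of_int \<bar>b\<bar>" using qw b by (auto simp: N_def)
    have polar: "4 * pi\<^sup>2 * (2 * ((B *v k0) \<bullet> (B *v w))) = c * of_int a"
    proof -
      have eq: "2 * ((B *v k0) \<bullet> (B *v w)) = (norm (B *v (k0 + w)))\<^sup>2 - (norm (B *v k0))\<^sup>2 - (norm (B *v w))\<^sup>2"
        by (simp add: matrix_vector_right_distrib power2_norm_eq_inner inner_add_left inner_add_right inner_commute)
      then have "4 * pi\<^sup>2 * (2 * ((B *v k0) \<bullet> (B *v w)))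
          = 4 * pi\<^sup>2 * (norm (B *v (k0 + w)))\<^sup>2 - 4 * pi\<^sup>2 * (norm (B *v k0))\<^sup>2 - 4 * pi\<^sup>2 * (norm (B *v w))\<^sup>2"
        unfolding eq by (simp only: right_diff_distrib)
      also have "\<dots> = c * (q (k0 + w) - q k0 - q w)"
        unfolding QB by (simp add: algebra_simps)
      finally show ?thesis by (simp add: a)
    qed
    have ratio: "2 * ((B *v k0) \<bullet> (B *v w)) / (norm (B *v w))\<^sup>2 = of_int a / of_int b"
    proof -
      have "2 * ((B *v k0) \<bullet> (B *v w)) / (norm (B *v w))\<^sup>2
          = (4 * pi\<^sup>2 * (2 * ((B *v k0) \<bullet> (B *v w)))) / (4 * pi\<^sup>2 * (norm (B *v w))\<^sup>2)"
        by simp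
      also have "\<dots> = of_int a / of_int b"
        unfolding polar QB b using c0 by simp
      finally show ?thesis .
    qed
    \<comment> \<open>With \<open>N\<close> the absolute value of the denominator \<open>b\<close>,
      the number \<open>s\<close> is \<open>a\<close> up to sign.\<close>
    define s where "s = real N * (of_int a / of_int b)"
    have "s = of_int (sgn b * a)"
      using qw unfolding s_def N(2) b by (cases "b > 0") auto
    then have s: "s \<in> \<int>" by simp
    have "(real N * \<sigma>) *\<^sub>R \<zeta> w = (2 * pi) *\<^sub>R (B *v (s *\<^sub>R w + (- real N) *\<^sub>R k0))"
    proof -
      have "2 * (p0 \<bullet> (B *v w)) / (norm (B *v w))\<^sup>2 = (2 * pi / \<sigma>) * (of_int a / of_int b)"
        unfolding ratio[symmetric] by (simp add: p0_def)
      then have "\<zeta> w = (2 * pi / \<sigma>) *\<^sub>R ((of_int a / of_int b) *\<^sub>R (B *v w) - B *v k0)"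
        unfolding \<zeta>_def by (simp add: p0_def scaleR_diff_right)
      then show ?thesis
        using \<sigma> by (simp add: s_def matrix_vector_right_distrib matrix_vector_mult_scaleR scaleR_diff_right
            matrix_vector_mult_diff_distrib mult_ac)
    qed
    moreover have "integer_vector (s *\<^sub>R w + (- real N) *\<^sub>R k0)"
      by (intro integer_vector_intros k0 w s) simp
    ultimately show ?thesis
      unfolding lattice_directions_def B_def using \<zeta>_norm N(1) by blast
  qed
  \<comment> \<open>Inverse of the projection: \<open>B *v v\<close> is parallel to the chord from
    \<open>- p0\<close> to \<open>\<xi>\<close>.\<close>
  define v where "v = (\<sigma> / (2 * pi)) *\<^sub>R (transpose A *v (\<xi> + p0))"
  have Bv: "B *v v = (\<sigma> / (2 * pi)) *\<^sub>R (\<xi> + p0)"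
    unfolding v_def B_def matrix_vector_mult_scaleR dual_basis_inverse ..
  show ?thesis
  proof (cases "\<xi> + p0 = 0")
    case True
    then have "\<xi> = \<zeta> 0" by (simp add: \<zeta>_def eq_neg_iff_add_eq_0)
    moreover have "integer_vector (0 :: real^'n)" by (simp add: integer_vector_def)
    ultimately show ?thesis using \<zeta>_mem[of 0] e by (intro bexI[of _ "\<zeta> 0"]) auto
  next
    case False
    define y where "y = \<xi> + p0"
    define \<kappa> where "\<kappa> = \<sigma> / (2 * pi)"
    have \<kappa>: "\<kappa> > 0" and Bv': "B *v v = \<kappa> *\<^sub>R y" and y: "y \<noteq> 0"
      using \<sigma> False by (auto simp: \<kappa>_def y_def Bv)
    have \<zeta>v: "\<zeta> v = \<xi>"
    proof -
      have n: "y \<bullet> y = 2 * (p0 \<bullet> y)"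
        using \<xi> p0 unfolding norm_eq_1
        by (simp add: y_def inner_add_left inner_add_right inner_commute)
      then have z: "p0 \<bullet> y \<noteq> 0" using y by auto
      have "\<zeta> v = (2 * (p0 \<bullet> (\<kappa> *\<^sub>R y)) / (norm (\<kappa> *\<^sub>R y))\<^sup>2 * \<kappa>) *\<^sub>R y - p0"
        unfolding \<zeta>_def Bv' by (simp only: scaleR_scaleR)
      also have "2 * (p0 \<bullet> (\<kappa> *\<^sub>R y)) / (norm (\<kappa> *\<^sub>R y))\<^sup>2 * \<kappa> = 1"
        unfolding power2_norm_eq_inner inner_scaleR_left inner_scaleR_right n using \<kappa> z by simp
      finally have "\<zeta> v = y - p0" by simp
      then show ?thesis by (simp add: y_def)
    qed
    \<comment> \<open>Integer vectors whose directions tend to that of \<open>v\<close>; the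
      denominator \<open>Suc m\<close> is harmless, as \<open>\<zeta>\<close> is homogeneous of
      degree 0.\<close>
    define w where "w m = (\<chi> i. real_of_int \<lfloor>real (Suc m) * v $ i\<rfloor>)" for m
    have w: "integer_vector (w m)" for m by (simp add: integer_vector_def w_def)
    have lim: "(\<lambda>m. inverse (real (Suc m)) *\<^sub>R w m) \<longlonglongrightarrow> v"
    proof (rule vec_tendstoI)
      fix i
      have "\<bar>(inverse (real (Suc m)) *\<^sub>R w m) $ i - v $ i\<bar> \<le> inverse (real (Suc m))" for m
      proof -
        define N where "N = real (Suc m)"
        have N: "N > 0" by (simp add: N_def)
        define y where "y = v $ i"
        have "w m $ i = of_int \<lfloor>N * y\<rfloor>" by (simp only: w_def N_def y_def vec_lambda_beta)
        then have "(inverse N *\<^sub>R w m) $ i - v $ i = inverse N * (of_int \<lfloor>N * y\<rfloor> - N * y)"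
          using N by (simp add: y_def[symmetric] right_diff_distrib)
        moreover have "\<bar>of_int \<lfloor>N * y\<rfloor> - N * y\<bar> \<le> 1" by linarith
        ultimately show ?thesis
          unfolding N_def[symmetric] using N by (simp add: abs_mult)
      qed
      then have "(\<lambda>m. (inverse (real (Suc m)) *\<^sub>R w m) $ i - v $ i) \<longlonglongrightarrow> 0"
        by (intro Lim_null_comparison[OF _ LIMSEQ_inverse_real_of_nat]) auto
      then show "(\<lambda>m. (inverse (real (Suc m)) *\<^sub>R w m) $ i) \<longlonglongrightarrow> v $ i"
        by (simp add: LIM_zero_iff)
    qed
    have limB: "(\<lambda>m. B *v (inverse (real (Suc m)) *\<^sub>R w m)) \<longlonglongrightarrow> B *v v"
      by (rule bounded_linear.tendsto[OF matrix_vector_mul_bounded_linear lim])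
    have "B *v v \<noteq> 0" using \<kappa> y by (simp add: Bv')
    then have "(\<lambda>m. \<zeta> (inverse (real (Suc m)) *\<^sub>R w m)) \<longlonglongrightarrow> \<zeta> v"
      unfolding \<zeta>_def by (intro tendsto_intros limB) auto
    then have "(\<lambda>m. \<zeta> (w m)) \<longlonglongrightarrow> \<xi>"
      by (simp add: \<zeta>_scale \<zeta>v)
    then obtain m where "dist (\<zeta> (w m)) \<xi> < e"
      using e by (meson LIMSEQ_iff_nz metric_LIMSEQ_D order_refl)
    then show ?thesis using \<zeta>_mem[OF w] by blast
  qed
qed

end

section \<open>From approximating waves to eigenfunctions\<close>

lemma helmholtz_Ck_on: "helmholtz_solution 1 u \<Longrightarrow> Ck_on l u S"
proof (induction l arbitrary: u)
  case 0
  then show ?case by (simp add: helmholtz_solution_continuous)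
next
  case (Suc l)
  have "u differentiable_on S"
    using helmholtz_solutionD(1)[OF Suc.prems]
    by (auto simp: differentiable_on_def differentiable_def intro: has_derivative_at_withinI)
  then show ?case using Suc by (simp add: helmholtz_partial_deriv)
qed

text \<open>The iterated gradient estimate with step 1: derivatives of order at most
  \<open>l\<close> need a ball that is larger by \<open>l\<close>.\<close>

lemma Cl_norm_helmholtz_le:
  fixes v :: "real^'n::finite \<Rightarrow> real"
  assumes v: "helmholtz_solution 1 v" and M: "\<And>x. x \<in> cball a (r + real l) \<Longrightarrow> \<bar>v x\<bar> \<le> M" and "r > 0"
  shows "Cl_norm l (ball a r) v \<le> ennreal (grad_const TYPE('n) ^ l * M)"
proof -
  define C where "C = grad_const TYPE('n)"
  have C: "C \<ge> 1" using grad_const_ge_1 by (simp add: C_def)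
  have M0: "M \<ge> 0" using M[of a] \<open>r > 0\<close> by force
  have "\<bar>iterated_partial is v x\<bar> \<le> C ^ l * M" if "length is \<le> l" "x \<in> ball a r" for "is" x
  proof -
    have "\<bar>iterated_partial is v x\<bar> \<le> (C / 1) ^ length is * M"
      unfolding C_def using that
      by (intro iterated_gradient_estimate[OF v, where a = a and r = r] M) auto
    also have "\<dots> \<le> C ^ l * M"
      using C M0 that by (intro mult_right_mono) (auto intro: power_increasing)
    finally show ?thesis .
  qed
  then show ?thesis
    unfolding Cl_norm_def using helmholtz_Ck_on[OF v]
    by (auto simp: C_def intro!: SUP_least ennreal_leI)
qed

theorem inverse_localization_of_integral_form:
  fixes A :: "real^'n::finite^'n"
  assumes A: "invertible A"
    and Q: "\<And>k. lattice_form A k = c * q k"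
    and q: "\<And>k. integer_vector k \<Longrightarrow> q k \<in> \<int>"
  shows "inverse_localization (lattice_of A)"
  unfolding inverse_localization_def
proof (intro allI impI, elim conjE)
  fix h :: "real^'n \<Rightarrow> real" and a :: "real^'n" and r :: real and l :: nat
  assume h: "helmholtz_solution 1 h" and r: "r > 0"
  fix t :: 'n
  define \<sigma> where "\<sigma> = 2 * pi * norm (matrix_inv (transpose A) *v axis t 1)"
  define D where "D = lattice_directions A \<sigma>"
  have \<sigma>: "\<sigma> > 0" using dual_basis_eq_0_iff[OF A] by (simp add: \<sigma>_def axis_eq_0_iff)
  have D1: "D \<subseteq> sphere 0 1" by (auto simp: D_def lattice_directions_def[OF A])
  have dense: "\<exists>\<zeta>\<in>D. dist \<zeta> \<xi> < e" if "norm \<xi> = 1" "e > 0" for \<xi> e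
    unfolding D_def \<sigma>_def by (rule lattice_directions_dense[OF A Q q that])
  have hD: "h \<in> wave_closure D"
    by (rule wave_closure_dense_directions[OF dense h])
  define C where "C = grad_const TYPE('n)"
  have C: "C \<ge> 1" using grad_const_ge_1 by (simp add: C_def)
  define R where "R = norm a + r + real l"
  \<comment> \<open>An eigenfunction must not vanish identically. If the approximating sum does,
    then \<open>h\<close> is itself small on the ball and a single wave of amplitude
    \<open>e / 2\<close> is used.\<close>
  have appr: "\<exists>w\<in>waves D. (\<exists>x. w x \<noteq> 0) \<and> (\<forall>x\<in>cball 0 R. \<bar>w x - h x\<bar> \<le> e)" if e: "e > 0" for e
  proof -
    obtain w where w: "w \<in> waves D" "\<And>x. x \<in> cball 0 R \<Longrightarrow> \<bar>w x - h x\<bar> < e / 2"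
      using hD half_gt_zero[OF e] unfolding wave_closure_def by blast
    show ?thesis
    proof (cases "\<exists>x. w x \<noteq> 0")
      case True
      have "\<forall>x\<in>cball 0 R. \<bar>w x - h x\<bar> \<le> e" using w(2) e by fastforce
      with True w(1) show ?thesis by blast
    next
      case False
      obtain \<xi> where \<xi>: "\<xi> \<in> D" using dense[of "axis t 1" 1] by auto
      have "\<bar>e / 2 * cos (\<xi> \<bullet> x + 0) - h x\<bar> \<le> e" if "x \<in> cball 0 R" for x
      proof -
        have "\<bar>e / 2 * cos (\<xi> \<bullet> x + 0)\<bar> \<le> e / 2 * 1"
          unfolding abs_mult using e by (intro mult_mono) auto
        moreover have "\<bar>h x\<bar> < e / 2" using w(2)[OF that] False by simp
        ultimately show ?thesis by linarith
      qed
      moreover have "e / 2 * cos (\<xi> \<bullet> 0 + 0) \<noteq> 0" using e by simp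
      ultimately show ?thesis
        by (intro bexI[OF _ waves_wave[OF \<xi>, of "e / 2" 0]] conjI ballI exI[of _ 0])
    qed
  qed
  define W where "W n w \<longleftrightarrow> w \<in> waves D \<and> (\<exists>x. w x \<noteq> 0) \<and>
    (\<forall>x\<in>cball 0 R. \<bar>w x - h x\<bar> \<le> inverse (real (Suc n)))" for n w
  have "\<exists>w. W n w" for n
    using appr[of "inverse (real (Suc n))"] by (auto simp: W_def Bex_def)
  then obtain w where "\<And>n. W n (w n)" by metis
  then have w: "\<And>n. w n \<in> waves D" "\<And>n. \<exists>x. w n x \<noteq> 0"
      "\<And>n x. x \<in> cball 0 R \<Longrightarrow> \<bar>w n x - h x\<bar> \<le> inverse (real (Suc n))"
    unfolding W_def by blast+
  define P where "P n N \<longleftrightarrow> N > 0 \<and> (\<forall>m::nat. \<forall>x. \<forall>\<gamma>\<in>lattice_of A.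
    w n ((real m * real N * \<sigma>) *\<^sub>R (x + \<gamma>)) = w n ((real m * real N * \<sigma>) *\<^sub>R x))" for n and N :: nat
  have "\<exists>N. P n N" for n
    unfolding P_def by (rule waves_lattice_periodic[OF A w(1)[of n, unfolded D_def]])
  then obtain N where "\<And>n. P n (N n)" by metis
  then have N: "\<And>n. N n > 0" "\<And>n m x \<gamma>. \<gamma> \<in> lattice_of A \<Longrightarrow>
    w n ((real m * real (N n) * \<sigma>) *\<^sub>R (x + \<gamma>)) = w n ((real m * real (N n) * \<sigma>) *\<^sub>R x)"
    by (auto simp: P_def)
  \<comment> \<open>\<open>N n\<close> makes the scaled sum periodic; the additional factor
    \<open>Suc n\<close> drives the eigenvalues to infinity.\<close>
  define s where "s n = real (Suc n) * real (N n) * \<sigma>" for n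
  have s: "s n > 0" for n using \<sigma> N(1) by (simp add: s_def)
  define u where "u n x = w n (s n *\<^sub>R x)" for n x
  define \<mu> where "\<mu> n = (s n)\<^sup>2" for n
  have sqrt: "sqrt (\<mu> n) = s n" for n using s[of n] by (simp add: \<mu>_def)
  have hw: "helmholtz_solution 1 (w n)" for n by (rule helmholtz_waves[OF D1 w(1)])
  have eig: "laplace_eigenfunction (lattice_of A) (\<mu> n) (u n)" for n
    unfolding laplace_eigenfunction_def
  proof (intro conjI allI ballI)
    show "\<mu> n \<ge> 0" by (simp add: \<mu>_def)
    obtain x where "w n x \<noteq> 0" using w(2) by blast
    then have "u n (inverse (s n) *\<^sub>R x) \<noteq> 0" using s[of n] by (simp add: u_def)
    then show "\<exists>x. u n x \<noteq> 0" by blast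
    show "u n (x + \<gamma>) = u n x" if "\<gamma> \<in> lattice_of A" for x \<gamma>
      unfolding u_def s_def by (rule N(2)[OF that])
    show "helmholtz_solution (\<mu> n) (u n)"
      using helmholtz_affine[OF hw[of n], of "\<mu> n" "s n" 0] by (simp add: u_def[abs_def] \<mu>_def)
  qed
  have lim: "filterlim \<mu> at_top sequentially"
  proof (rule filterlim_at_top_mono)
    show "filterlim (\<lambda>n. real (Suc n) * \<sigma>\<^sup>2) at_top sequentially"
      using \<sigma> by (intro filterlim_tendsto_pos_mult_at_top[OF tendsto_const, of "\<sigma>\<^sup>2", simplified mult.commute]
          filterlim_compose[OF filterlim_real_sequentially filterlim_Suc]) auto
    show "\<forall>\<^sub>F n in sequentially. real (Suc n) * \<sigma>\<^sup>2 \<le> \<mu> n"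
    proof (rule always_eventually, rule allI)
      fix n
      have "real (Suc n) \<le> (real (Suc n) * real (N n))\<^sup>2"
      proof -
        have "Suc n \<le> Suc n * N n" using N(1)[of n] by (cases "N n") auto
        then have "Suc n \<le> (Suc n * N n)\<^sup>2" using power2_nat_le_imp_le le_square order.trans
          by (metis power2_eq_square)
        then show ?thesis by (metis of_nat_le_iff of_nat_mult of_nat_power)
      qed
      then show "real (Suc n) * \<sigma>\<^sup>2 \<le> \<mu> n"
        unfolding \<mu>_def s_def power_mult_distrib[of _ \<sigma>] by (intro mult_right_mono) auto
    qed
  qed
  have eq: "(\<lambda>x. u n (x /\<^sub>R sqrt (\<mu> n)) - h x) = (\<lambda>x. 1 * w n x + (- 1) * h x)" for n
    using s[of n] by (simp add: u_def sqrt)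
  have le: "Cl_norm l (ball a r) (\<lambda>x. u n (x /\<^sub>R sqrt (\<mu> n)) - h x) \<le> ennreal (C ^ l * inverse (real (Suc n)))" for n
    unfolding eq C_def
  proof (rule Cl_norm_helmholtz_le[OF helmholtz_lincomb[OF hw h] _ r])
    fix x assume "x \<in> cball a (r + real l)"
    then have "x \<in> cball 0 R"
      using dist_triangle[of 0 x a] by (simp add: R_def)
    from w(3)[OF this] show "\<bar>1 * w n x + (- 1) * h x\<bar> \<le> inverse (real (Suc n))" by simp
  qed
  have "(\<lambda>n. ennreal (C ^ l * inverse (real (Suc n)))) \<longlonglongrightarrow> ennreal (C ^ l * 0)"
    by (intro tendsto_ennrealI tendsto_mult tendsto_const LIMSEQ_inverse_real_of_nat)
  then have lim0: "(\<lambda>n. ennreal (C ^ l * inverse (real (Suc n)))) \<longlonglongrightarrow> 0"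
    by (simp only: mult_zero_right ennreal_0)
  have "(\<lambda>n. Cl_norm l (ball a r) (\<lambda>x. u n (x /\<^sub>R sqrt (\<mu> n)) - h x)) \<longlonglongrightarrow> 0"
    by (rule tendsto_sandwich[OF always_eventually[OF allI[OF zero_le]] always_eventually[OF allI[OF le]]
          tendsto_const lim0])
  then show "\<exists>u \<mu>. (\<forall>n. laplace_eigenfunction (lattice_of A) (\<mu> n) (u n)) \<and>
      filterlim \<mu> at_top sequentially \<and>
      (\<lambda>n. Cl_norm l (ball a r) (\<lambda>x. u n (x /\<^sub>R sqrt (\<mu> n)) - h x)) \<longlonglongrightarrow> 0"
    using eig lim by (intro exI[of _ u] exI[of _ \<mu>] conjI allI)
qed

section \<open>Fourier coefficients on the unit cube\<close>

text \<open>The slab by which the shifted cube sticks out is moved back by one period.\<close>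

lemma integral_unit_cube_shift:
  fixes g :: "real^'n::finite \<Rightarrow> real"
  assumes g: "continuous_on UNIV g" and per: "\<And>y. g (y + axis j 1) = g y" and s: "0 \<le> s" "s \<le> 1"
  shows "integral (cbox 0 1) (\<lambda>y. g (y + s *\<^sub>R axis j 1)) = integral (cbox 0 1) g"
proof -
  define e where "e = (axis j 1 :: real^'n)"
  define c where "c = s *\<^sub>R e"
  \<comment> \<open>Upper corner of the slab \<open>0 \<le> x $ j \<le> s\<close> of the unit
    cube.\<close>
  define d where "d = 1 + c - e"
  have eB: "e \<in> Basis" by (simp add: e_def)
  have xe: "x \<bullet> e = x $ j" for x by (simp add: e_def inner_axis)
  have ei: "e $ i = (if i = j then 1 else 0)" for i by (simp add: e_def axis_def)
  have intg: "g integrable_on cbox a b" for a b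
    using g by (intro integrable_continuous continuous_on_subset[OF g]) auto
  have ci: "c $ i = (if i = j then s else 0)" for i by (simp add: c_def ei)
  have di: "d $ i = (if i = j then s else 1)" for i by (simp add: d_def ci ei)
  have mb: "x \<in> cbox p q \<longleftrightarrow> (p $ j \<le> x $ j \<and> x $ j \<le> q $ j) \<and> (\<forall>i. i \<noteq> j \<longrightarrow> p $ i \<le> x $ i \<and> x $ i \<le> q $ i)"
    for p q x :: "real^'n"
    unfolding mem_box_cart by metis
  have 1: "cbox c (1 + c) \<inter> {x. x \<bullet> e \<le> 1} = cbox c 1"
    by (rule set_eqI) (use s in \<open>auto simp: mb xe ci di ei\<close>)
  have 2: "cbox c (1 + c) \<inter> {x. x \<bullet> e \<ge> 1} = cbox (0 + e) (d + e)"
    by (rule set_eqI) (use s in \<open>auto simp: mb xe ci di ei\<close>)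
  have 3: "cbox 0 1 \<inter> {x. x \<bullet> e \<le> s} = cbox 0 d"
    by (rule set_eqI) (use s in \<open>auto simp: mb xe ci di ei\<close>)
  have 4: "cbox 0 1 \<inter> {x. x \<bullet> e \<ge> s} = cbox c 1"
    by (rule set_eqI) (use s in \<open>auto simp: mb xe ci di ei\<close>)
  have "integral (cbox 0 1) (\<lambda>y. g (y + s *\<^sub>R axis j 1)) = integral (cbox (0 + c) (1 + c)) g"
    unfolding integral_shift_cbox_plus[symmetric] by (simp add: o_def c_def e_def add.commute)
  also have "\<dots> = integral (cbox c 1) g + integral (cbox (0 + e) (d + e)) g"
    using integral_split[OF intg eB, of c "1 + c" 1] unfolding 1 2 by simp
  also have "integral (cbox (0 + e) (d + e)) g = integral (cbox 0 d) g"
    unfolding integral_shift_cbox_plus[symmetric] using per by (simp add: o_def e_def add.commute)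
  also have "integral (cbox c 1) g + integral (cbox 0 d) g = integral (cbox 0 1) g"
    using integral_split[OF intg eB, of 0 1 s] unfolding 3 4 by simp
  finally show ?thesis .
qed

text \<open>By shift invariance every difference quotient has integral 0, and the quotients converge
  uniformly on the cube. Iterated integrals are thereby avoided.\<close>

lemma integral_unit_cube_derivative:
  fixes g :: "real^'n::finite \<Rightarrow> real"
  assumes g: "\<And>x. (g has_derivative (\<lambda>h. \<Sum>j\<in>UNIV. h $ j * g' j x)) (at x)"
    and g': "continuous_on UNIV (g' j)" and per: "\<And>y. g (y + axis j 1) = g y"
  shows "integral (cbox 0 1) (g' j) = 0"
proof -
  have cont: "continuous_on UNIV g"
    using g by (meson continuous_at_imp_continuous_on has_derivative_continuous)
  define s where "s n = inverse (real (Suc n))" for n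
  have s: "0 < s n" "s n \<le> 1" for n by (auto simp: s_def field_simps)
  define v where "v n y = (g (y + s n *\<^sub>R axis j 1) - g (y + 0 *\<^sub>R axis j 1)) / s n" for n y
  have "locally_uniform_limit v (\<lambda>y. g' j (y + 0 *\<^sub>R axis j 1))"
    unfolding v_def[abs_def] s_def
  proof (rule locally_uniform_difference_quotient)
    show "((\<lambda>\<theta>. g (x + \<theta> *\<^sub>R axis j 1)) has_real_derivative g' j (x + \<theta> *\<^sub>R axis j 1)) (at \<theta>)" for x \<theta>
      using has_real_derivative_along_axis[OF g, of x 1 j \<theta>] by simp
    show "continuous_on UNIV (\<lambda>(\<theta>, x). g' j (x + \<theta> *\<^sub>R axis j 1))"
      unfolding case_prod_beta by (intro continuous_intros continuous_on_compose2[OF g']) auto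
  qed
  then have lim: "locally_uniform_limit v (g' j)" by simp
  obtain R where "\<And>x :: real^'n. x \<in> cbox 0 1 \<Longrightarrow> norm x \<le> R"
    using bounded_cbox bounded_iff by metis
  then have sub: "cbox 0 (1 :: real^'n) \<subseteq> cball 0 R" by auto
  have ul: "uniform_limit (cbox 0 1) v (g' j) sequentially"
    using lim[unfolded locally_uniform_limit_def, rule_format, of R] sub by (rule uniform_limit_on_subset)
  have cv: "continuous_on (cbox 0 1) (v n)" for n
    unfolding v_def using s[of n] by (intro continuous_intros continuous_on_compose2[OF cont]) auto
  obtain I J where IJ: "\<And>n. (v n has_integral I n) (cbox 0 1)" "(g' j has_integral J) (cbox 0 1)" "I \<longlonglongrightarrow> J"
    using uniform_limit_integral_cbox[OF ul cv] by auto
  have I0: "I n = 0" for n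
  proof -
    have c1: "(\<lambda>y. g (y + s n *\<^sub>R axis j 1)) integrable_on cbox 0 1" "g integrable_on cbox 0 1"
      by (intro integrable_continuous continuous_intros continuous_on_compose2[OF cont]; simp)+
    have "I n = integral (cbox 0 1) (\<lambda>y. (g (y + s n *\<^sub>R axis j 1) - g y) / s n)"
      using integral_unique[OF IJ(1)[of n]] by (simp add: v_def[abs_def])
    also have "\<dots> = (integral (cbox 0 1) (\<lambda>y. g (y + s n *\<^sub>R axis j 1)) - integral (cbox 0 1) g) / s n"
      using c1 by (simp add: Henstock_Kurzweil_Integration.integral_diff)
    also have "\<dots> = 0"
      using integral_unit_cube_shift[OF cont per, of "s n"] s[of n] by simp
    finally show ?thesis .
  qed
  have "I = (\<lambda>n. 0)" using I0 by blast
  then have "J = 0" using IJ(3) by (simp add: LIMSEQ_const_iff)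
  then show ?thesis using IJ(2) by (simp add: integral_unique)
qed

section \<open>Trigonometric polynomials and completeness\<close>

abbreviation integer_frequencies :: "(real^'n::finite) set" where
  "integer_frequencies \<equiv> {(2 * pi) *\<^sub>R k | k. integer_vector k}"

lemma waves_mult:
  fixes D :: "(real^'n::finite) set"
  assumes D: "\<And>\<xi> \<zeta>. \<xi> \<in> D \<Longrightarrow> \<zeta> \<in> D \<Longrightarrow> \<xi> + \<zeta> \<in> D \<and> \<xi> - \<zeta> \<in> D"
    and v: "v \<in> waves D" and w: "w \<in> waves D"
  shows "(\<lambda>x. v x * w x) \<in> waves D"
  using w
proof (induction w rule: waves.induct)
  case (waves_add_wave w \<xi> a \<phi>)
  have "(\<lambda>x. v x * (a * cos (\<xi> \<bullet> x + \<phi>))) \<in> waves D"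
    using v
  proof (induction v rule: waves.induct)
    case (waves_add_wave v \<zeta> b \<psi>)
    have "(\<lambda>x. (b * a / 2) * cos ((\<zeta> - \<xi>) \<bullet> x + (\<psi> - \<phi>)) + (b * a / 2) * cos ((\<zeta> + \<xi>) \<bullet> x + (\<psi> + \<phi>))) \<in> waves D"
      by (intro waves_add waves_wave) (use D waves_add_wave(2) \<open>\<xi> \<in> D\<close> in auto)
    also have "(\<lambda>x. (b * a / 2) * cos ((\<zeta> - \<xi>) \<bullet> x + (\<psi> - \<phi>)) + (b * a / 2) * cos ((\<zeta> + \<xi>) \<bullet> x + (\<psi> + \<phi>)))
        = (\<lambda>x. b * cos (\<zeta> \<bullet> x + \<psi>) * (a * cos (\<xi> \<bullet> x + \<phi>)))"
    proof
      fix x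
      have "cos (\<zeta> \<bullet> x + \<psi>) * cos (\<xi> \<bullet> x + \<phi>)
          = (cos ((\<zeta> - \<xi>) \<bullet> x + (\<psi> - \<phi>)) + cos ((\<zeta> + \<xi>) \<bullet> x + (\<psi> + \<phi>))) / 2"
        unfolding cos_times_cos by (simp add: inner_add_left inner_diff_left algebra_simps)
      then show "(b * a / 2) * cos ((\<zeta> - \<xi>) \<bullet> x + (\<psi> - \<phi>)) + (b * a / 2) * cos ((\<zeta> + \<xi>) \<bullet> x + (\<psi> + \<phi>))
          = b * cos (\<zeta> \<bullet> x + \<psi>) * (a * cos (\<xi> \<bullet> x + \<phi>))"
        by (simp add: field_simps)
    qed
    finally show ?case
      using waves_add[OF _ waves_add_wave(3)] by (simp add: distrib_right)
  qed (simp add: waves_zero)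
  then show ?case
    using waves_add[OF _ waves_add_wave(3)] by (simp add: distrib_left)
qed (simp add: waves_zero)

lemma waves_sum:
  "finite I \<Longrightarrow> (\<And>i. i \<in> I \<Longrightarrow> f i \<in> waves D) \<Longrightarrow> (\<lambda>x. \<Sum>i\<in>I. f i x) \<in> waves D"
  by (induction I rule: finite_induct) (auto simp: waves_zero intro: waves_add)

lemma continuous_on_waves: "w \<in> waves D \<Longrightarrow> continuous_on S w"
  by (induction w rule: waves.induct) (auto intro!: continuous_intros)

text \<open>By Stone-Weierstrass, \<open>W\<close> is a uniform limit on the cube of trigonometric
  polynomials, to which it is orthogonal; hence the integral of its square is 0.\<close>

lemma fourier_completeness:
  fixes W :: "real^'n::finite \<Rightarrow> real"
  assumes W: "continuous_on UNIV W" and per: "\<And>y k. integer_vector k \<Longrightarrow> W (y + k) = W y"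
    and zero: "\<And>k \<phi>. integer_vector k \<Longrightarrow> integral (cbox 0 1) (\<lambda>y. W y * cos (((2 * pi) *\<^sub>R k) \<bullet> y + \<phi>)) = 0"
  shows "W y = 0"
proof -
  define K where "K = cbox 0 (1 :: real^'n)"
  \<comment> \<open>Embedding of the torus into a Euclidean space, where polynomials pull back to
    trigonometric polynomials.\<close>
  define f where "f y = (\<chi> i. cos (2 * pi * y $ i), \<chi> i. sin (2 * pi * y $ i))" for y :: "real^'n"
  let ?T = "waves (integer_frequencies :: (real^'n) set)"
  have compK: "compact K" by (simp add: K_def)
  have contf: "continuous_on S f" for S
    unfolding f_def by (intro continuous_intros)
  have contW: "continuous_on S W" for S
    using W continuous_on_subset by blast
  have inv: "W y = W z" if "f y = f z" for y z
  proof -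
    have "\<exists>n::int. y $ i = z $ i + of_int n" for i
    proof -
      have "sin (2 * pi * y $ i) = sin (2 * pi * z $ i)" "cos (2 * pi * y $ i) = cos (2 * pi * z $ i)"
        using that by (auto simp: f_def vec_eq_iff)
      then obtain n :: int where "2 * pi * y $ i = 2 * pi * z $ i + 2 * pi * n"
        using sin_cos_eq_iff by blast
      then have "2 * pi * y $ i = 2 * pi * (z $ i + n)" by (simp add: distrib_left)
      then show ?thesis by auto
    qed
    then have "(y - z) $ i \<in> \<int>" for i
      by (metis Ints_of_int add_diff_cancel_left' vector_minus_component)
    then have "integer_vector (y - z)" by (simp add: integer_vector_def)
    from per[OF this, of z] show ?thesis by simp
  qed
  \<comment> \<open>\<open>W\<close> as a function on the embedded torus. Continuity follows from
    compactness of the cube: \<open>f\<close> maps closed subsets of it to closed sets.\<close>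
  define G where "G s = W (SOME y. y \<in> K \<and> f y = s)" for s
  have Gf: "G (f y) = W y" if "y \<in> K" for y
    unfolding G_def by (rule inv) (use someI[of "\<lambda>z. z \<in> K \<and> f z = f y" y] that in blast)
  have compS: "compact (f ` K)" by (intro compact_continuous_image contf compK)
  have contG: "continuous_on (f ` K) G"
    unfolding continuous_on_closed_vimage[OF compact_imp_closed[OF compS]]
  proof (intro allI impI)
    fix B :: "real set" assume "closed B"
    then have "closed (W -` B \<inter> K)"
      using continuous_on_closed_vimage[OF compact_imp_closed[OF compK], of W] contW by blast
    then have "compact (f ` (W -` B \<inter> K))"
      using compK by (intro compact_continuous_image contf) (metis compact_Int_closed inf.commute inf.right_idem)
    moreover have "G -` B \<inter> f ` K = f ` (W -` B \<inter> K)"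
      using Gf by (auto simp: image_iff)
    ultimately show "closed (G -` B \<inter> f ` K)" using compact_imp_closed by metis
  qed
  have freq: "\<xi> + \<zeta> \<in> integer_frequencies \<and> \<xi> - \<zeta> \<in> integer_frequencies"
    if \<xi>\<zeta>: "\<xi> \<in> integer_frequencies" "\<zeta> \<in> integer_frequencies" for \<xi> \<zeta> :: "real^'n"
  proof -
    obtain k where "integer_vector k" "\<xi> = (2 * pi) *\<^sub>R k"
      using \<xi>\<zeta>(1) by blast
    moreover obtain l where "integer_vector l" "\<zeta> = (2 * pi) *\<^sub>R l"
      using \<xi>\<zeta>(2) by blast
    moreover from calculation have "integer_vector (k + l)" "integer_vector (k - l)"
      by (auto simp: integer_vector_def)
    ultimately show ?thesis
      by (auto simp flip: scaleR_add_right scaleR_diff_right)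
  qed
  have coord: "(\<lambda>y. a * cos (2 * pi * y $ i + \<phi>)) \<in> ?T" for a i \<phi>
    using waves_wave[of "(2 * pi) *\<^sub>R axis i 1" integer_frequencies a \<phi>] integer_vector_intros(1)
    by (auto simp: inner_axis')
  have poly: "(\<lambda>y. p (f y)) \<in> ?T" if "real_polynomial_function p" for p
    using that
  proof (induction p rule: real_polynomial_function.induct)
    case (linear p)
    then interpret bounded_linear p .
    have "p (f y) = (\<Sum>i\<in>UNIV. p (axis i 1, 0) * cos (2 * pi * y $ i + 0))
        + (\<Sum>i\<in>UNIV. p (0, axis i 1) * cos (2 * pi * y $ i + (- pi / 2)))" for y
    proof -
      have "f y = (\<Sum>i\<in>UNIV. cos (2 * pi * y $ i) *\<^sub>R (axis i 1, 0)) + (\<Sum>i\<in>UNIV. sin (2 * pi * y $ i) *\<^sub>R (0, axis i 1))"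
        by (simp add: f_def prod_eq_iff fst_sum snd_sum vec_eq_iff axis_def if_distrib cong: if_cong)
      moreover have "cos (2 * pi * y $ i + (- pi / 2)) = sin (2 * pi * y $ i)" for i
        using cos_diff[of "2 * pi * y $ i" "pi / 2"] by simp
      moreover have "p (c *\<^sub>R v, 0) = c * p (v, 0)" "p (0, c *\<^sub>R v) = c * p (0, v)" for c v
        using scaleR[of c "(v, 0)"] scaleR[of c "(0, v)"] by simp_all
      ultimately show ?thesis
        by (simp add: add sum mult.commute)
    qed
    then show ?case
      by (simp only:) (intro waves_add waves_sum finite coord)
  next
    case (const c)
    have "0 \<in> (integer_frequencies :: (real^'n) set)"
      by (auto intro!: exI[of _ 0] simp: integer_vector_def)
    from waves_wave[OF this, of c 0] show ?case by simp
  next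
    case (add p q)
    then show ?case by (intro waves_add)
  next
    case (mult p q)
    then show ?case using waves_mult[OF freq] by blast
  qed
  have orth: "integral K (\<lambda>y. W y * \<tau> y) = 0" if "\<tau> \<in> ?T" for \<tau>
    using that
  proof (induction \<tau> rule: waves.induct)
    case (waves_add_wave \<tau> \<xi> a \<phi>)
    obtain k where k: "integer_vector k" "\<xi> = (2 * pi) *\<^sub>R k" using waves_add_wave(2) by blast
    have "(\<lambda>y. W y * (\<tau> y + a * cos (\<xi> \<bullet> y + \<phi>))) = (\<lambda>y. W y * \<tau> y + a * (W y * cos (\<xi> \<bullet> y + \<phi>)))"
      by (auto simp: algebra_simps)
    moreover have "(\<lambda>y. W y * \<tau> y) integrable_on K" "(\<lambda>y. a * (W y * cos (\<xi> \<bullet> y + \<phi>))) integrable_on K"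
      unfolding K_def
      by (intro integrable_continuous continuous_intros contW continuous_on_waves[OF waves_add_wave(1)])+
    ultimately show ?case
      using waves_add_wave(3) zero[OF k(1), of \<phi>]
      by (simp add: Henstock_Kurzweil_Integration.integral_add k(2) K_def)
  qed simp
  obtain Mx where Mx: "\<And>y. y \<in> K \<Longrightarrow> \<bar>W y\<bar> \<le> Mx"
  proof -
    have "compact (W ` K)" by (intro compact_continuous_image contW compK)
    then obtain M where "\<And>y. y \<in> W ` K \<Longrightarrow> norm y \<le> M"
      using compact_imp_bounded bounded_iff by metis
    then show ?thesis using that[of M] by auto
  qed
  have K0: "0 \<in> K" by (simp add: K_def mem_box_cart)
  have Mx0: "Mx \<ge> 0" using Mx[OF K0] by linarith
  define C where "C = Mx * measure lborel K"
  have small: "\<bar>integral K (\<lambda>y. W y * W y)\<bar> \<le> e * C" if e: "e > 0" for e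
  proof -
    obtain p where p: "real_polynomial_function p" "\<And>s. s \<in> f ` K \<Longrightarrow> \<bar>G s - p s\<bar> < e"
      using Stone_Weierstrass_real_polynomial_function[OF compS contG e] by blast
    define \<tau> where "\<tau> y = p (f y)" for y
    have \<tau>: "\<tau> \<in> ?T" unfolding \<tau>_def[abs_def] by (rule poly[OF p(1)])
    have i: "(\<lambda>y. W y * W y) integrable_on K" "(\<lambda>y. W y * \<tau> y) integrable_on K"
        "(\<lambda>y. W y * (W y - \<tau> y)) integrable_on K"
      unfolding K_def by (intro integrable_continuous continuous_intros contW continuous_on_waves[OF \<tau>])+
    have "integral K (\<lambda>y. W y * (W y - \<tau> y)) = integral K (\<lambda>y. W y * W y)"
      using Henstock_Kurzweil_Integration.integral_diff[OF i(1,2)] orth[OF \<tau>]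
      by (simp add: right_diff_distrib)
    moreover have "norm (integral K (\<lambda>y. W y * (W y - \<tau> y))) \<le> (Mx * e) * measure lborel K"
      unfolding K_def
    proof (rule integrable_bound)
      show "0 \<le> Mx * e" using Mx0 e by simp
      show "(\<lambda>y. W y * (W y - \<tau> y)) integrable_on cbox 0 1" using i(3) by (simp add: K_def)
      fix y :: "real^'n" assume "y \<in> cbox 0 1"
      then have y: "y \<in> K" by (simp add: K_def)
      have "\<bar>W y - \<tau> y\<bar> < e" using p(2)[of "f y"] y Gf[OF y] by (auto simp: \<tau>_def)
      then show "norm (W y * (W y - \<tau> y)) \<le> Mx * e"
        unfolding real_norm_def abs_mult using Mx[OF y] Mx0 by (intro mult_mono) auto
    qed
    ultimately show ?thesis by (simp add: C_def mult_ac)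
  qed
  have "\<bar>integral K (\<lambda>y. W y * W y)\<bar> \<le> 0"
  proof (rule field_le_epsilon)
    fix e :: real assume e: "e > 0"
    have C0: "C \<ge> 0" using Mx0 by (simp add: C_def)
    have "e / (C + 1) * C \<le> e" using C0 e by (simp add: field_simps)
    then show "\<bar>integral K (\<lambda>y. W y * W y)\<bar> \<le> 0 + e"
      using small[of "e / (C + 1)"] e C0 by simp
  qed
  then have i0: "((\<lambda>y. W y * W y) has_integral 0) (cbox 0 1)"
    using integrable_integral[of "\<lambda>y. W y * W y" "cbox 0 1"]
    by (simp add: K_def integrable_continuous continuous_on_mult contW)
  have ne: "box 0 (1 :: real^'n) \<noteq> {}"
  proof -
    have "(\<chi> i. 1 / 2) \<in> box 0 (1 :: real^'n)" by (simp add: mem_box_cart)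
    then show ?thesis by blast
  qed
  have WK: "W z = 0" if "z \<in> K" for z
  proof -
    have "W z * W z = 0"
      by (rule has_integral_0_cbox_imp_0[OF _ _ i0 ne])
        (use that in \<open>auto simp: K_def intro!: continuous_on_mult contW\<close>)
    then show ?thesis by simp
  qed
  define k where "k = (\<chi> i. real_of_int \<lfloor>y $ i\<rfloor>)"
  have "integer_vector k" by (simp add: k_def integer_vector_def)
  moreover have "y - k \<in> K"
    unfolding K_def mem_box_cart by (auto simp: k_def) linarith
  ultimately show ?thesis using per[of k "y - k"] WK[of "y - k"] by simp
qed

section \<open>A second equation for eigenfunctions\<close>

lemma inner_matrix_vector: "\<kappa> \<bullet> (A *v y) = (transpose A *v \<kappa>) \<bullet> (y :: real^'n::finite)"
  by (simp add: dot_lmul_matrix)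

lemma continuous_on_matrix_compose:
  fixes A :: "real^'n::finite^'n"
  shows "continuous_on UNIV f \<Longrightarrow> continuous_on S (\<lambda>y. f (A *v y))"
  by (rule continuous_on_compose2[of UNIV f])
    (auto intro: linear_continuous_on matrix_vector_mul_bounded_linear)

text \<open>The derivatives of \<open>F\<close> composed with \<open>A\<close> integrate to 0 over
  the unit cube; they are combinations of the functions in question with the entries of
  \<open>A\<close>, and the inverse matrix undoes this.\<close>

lemma integral_lattice_derivative:
  fixes F :: "real^'n::finite \<Rightarrow> real"
  assumes A: "invertible (A :: real^'n^'n)"
    and F: "\<And>x. (F has_derivative (\<lambda>h. \<Sum>i\<in>UNIV. h $ i * F' i x)) (at x)"
    and F': "\<And>i. continuous_on UNIV (F' i)"
    and per: "\<And>x \<gamma>. \<gamma> \<in> lattice_of A \<Longrightarrow> F (x + \<gamma>) = F x"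
  shows "integral (cbox 0 1) (\<lambda>y. F' i (A *v y)) = 0"
proof -
  define g' where "g' j y = (\<Sum>l\<in>UNIV. A $ l $ j * F' l (A *v y))" for j y
  have g: "((\<lambda>y. F (A *v y)) has_derivative (\<lambda>h. \<Sum>j\<in>UNIV. h $ j * g' j y)) (at y)" for y
  proof -
    have "((\<lambda>y. A *v y) has_derivative (\<lambda>h. A *v h)) (at y)"
      by (intro bounded_linear_imp_has_derivative matrix_vector_mul_bounded_linear)
    from has_derivative_compose[OF this F]
    have "((\<lambda>y. F (A *v y)) has_derivative (\<lambda>h. \<Sum>l\<in>UNIV. (A *v h) $ l * F' l (A *v y))) (at y)" .
    moreover have "(\<Sum>l\<in>UNIV. (A *v h) $ l * F' l (A *v y)) = (\<Sum>j\<in>UNIV. h $ j * g' j y)" for h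
      unfolding matrix_vector_mult_def g'_def
      by (simp add: sum_distrib_left sum_distrib_right mult_ac) (rule sum.swap)
    ultimately show ?thesis by simp
  qed
  have g'_cont: "continuous_on S (g' j)" for j S
    unfolding g'_def by (intro continuous_intros continuous_on_matrix_compose F')
  have "integral (cbox 0 1) (g' j) = 0" for j
  proof (rule integral_unit_cube_derivative[OF g g'_cont])
    show "F (A *v (y + axis j 1)) = F (A *v y)" for y
      using per[of "A *v axis j 1" "A *v y"] integer_vector_intros(1)
      by (auto simp: lattice_of_iff matrix_vector_right_distrib)
  qed
  then have g'_int: "(g' j has_integral 0) (cbox 0 1)" for j
    using integrable_integral[OF integrable_continuous[OF g'_cont]] by metis
  obtain A' where A': "A ** A' = mat 1" using A by (auto simp: invertible_def)
  have "((\<lambda>y. \<Sum>j\<in>UNIV. A' $ j $ i * g' j y) has_integral (\<Sum>j\<in>(UNIV :: 'n set). A' $ j $ i * 0)) (cbox 0 1)"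
    by (intro has_integral_sum has_integral_mult_right g'_int) auto
  moreover have "(\<Sum>j\<in>UNIV. A' $ j $ i * g' j y) = F' i (A *v y)" for y
  proof -
    have e: "(\<Sum>j\<in>UNIV. A $ l $ j * A' $ j $ i) = (if l = i then 1 else 0)" for l
    proof -
      have "(A ** A') $ l $ i = (\<Sum>j\<in>UNIV. A $ l $ j * A' $ j $ i)" by (simp add: matrix_matrix_mult_def)
      then show ?thesis by (simp add: A' mat_def)
    qed
    have "(\<Sum>j\<in>UNIV. A' $ j $ i * g' j y) = (\<Sum>l\<in>UNIV. \<Sum>j\<in>UNIV. A $ l $ j * A' $ j $ i * F' l (A *v y))"
      unfolding g'_def sum_distrib_left by (subst sum.swap) (simp add: mult_ac)
    also have "\<dots> = (\<Sum>l\<in>UNIV. (if l = i then 1 else 0) * F' l (A *v y))"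
      by (simp only: e flip: sum_distrib_right)
    finally show ?thesis by (simp add: if_distrib[of "\<lambda>x. x * _"] cong: if_cong)
  qed
  ultimately show ?thesis by (simp add: integral_unique)
qed

lemma periodic_partial_deriv:
  assumes u: "helmholtz_solution \<mu> u" and per: "\<And>x. u (x + \<gamma>) = u x"
  shows "partial_deriv i u (x + \<gamma>) = partial_deriv i u x"
proof -
  have "(\<lambda>x. u (1 *\<^sub>R x + \<gamma>)) = u" using per by simp
  then show ?thesis
    using fun_cong[OF partial_deriv_affine[OF u, of i 1 \<gamma>], of x] by simp
qed

text \<open>Integration by parts against a wave of the dual lattice; the derivative of the wave is
  written as a phase shift by \<open>pi / 2\<close>.\<close>

lemma fourier_coefficient_partial_deriv:
  fixes v :: "real^'n::finite \<Rightarrow> real"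
  assumes A: "invertible (A :: real^'n^'n)" and v: "helmholtz_solution 1 v"
    and per: "\<And>x \<gamma>. \<gamma> \<in> lattice_of A \<Longrightarrow> v (x + \<gamma>) = v x"
    and \<kappa>: "transpose A *v \<kappa> = (2 * pi) *\<^sub>R k" and k: "integer_vector k"
  shows "integral (cbox 0 1) (\<lambda>y. partial_deriv i v (A *v y) * cos (\<kappa> \<bullet> (A *v y) + \<phi>))
    = - (\<kappa> $ i) * integral (cbox 0 1) (\<lambda>y. v (A *v y) * cos (\<kappa> \<bullet> (A *v y) + (\<phi> + pi / 2)))"
proof -
  define F' where "F' i x = partial_deriv i v x * cos (\<kappa> \<bullet> x + \<phi>)
    + v x * (\<kappa> $ i * cos (\<kappa> \<bullet> x + (\<phi> + pi / 2)))" for i x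
  have "integral (cbox 0 1) (\<lambda>y. F' i (A *v y)) = 0"
  proof (rule integral_lattice_derivative[OF A])
    fix x
    have "((\<lambda>x. v x * (1 * cos (\<kappa> \<bullet> x + \<phi>))) has_derivative
      (\<lambda>h. v x * (\<Sum>i\<in>UNIV. h $ i * (1 * \<kappa> $ i * cos (\<kappa> \<bullet> x + (\<phi> + pi / 2))))
        + (\<Sum>i\<in>UNIV. h $ i * partial_deriv i v x) * (1 * cos (\<kappa> \<bullet> x + \<phi>)))) (at x)"
      by (rule has_derivative_mult[OF helmholtz_solutionD(1)[OF v] has_derivative_plane_wave])
    moreover have "v x * (\<Sum>i\<in>UNIV. h $ i * (1 * \<kappa> $ i * cos (\<kappa> \<bullet> x + (\<phi> + pi / 2))))
        + (\<Sum>i\<in>UNIV. h $ i * partial_deriv i v x) * (1 * cos (\<kappa> \<bullet> x + \<phi>)) = (\<Sum>i\<in>UNIV. h $ i * F' i x)" for h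
      unfolding F'_def by (simp add: sum_distrib_left sum_distrib_right sum.distrib algebra_simps)
    ultimately show "((\<lambda>x. v x * (1 * cos (\<kappa> \<bullet> x + \<phi>))) has_derivative (\<lambda>h. \<Sum>i\<in>UNIV. h $ i * F' i x)) (at x)"
      by (simp only:)
  next
    show "continuous_on UNIV (F' i)" for i
      unfolding F'_def by (intro continuous_intros helmholtz_solution_continuous[OF v])
  next
    fix x \<gamma> assume \<gamma>: "\<gamma> \<in> lattice_of A"
    then obtain j where j: "integer_vector j" "\<gamma> = A *v j" by (auto simp: lattice_of_iff)
    obtain n where n: "k \<bullet> j = of_int n"
      using inner_integer_vector[OF k j(1)] Ints_cases by blast
    have "\<kappa> \<bullet> (x + \<gamma>) + \<phi> = \<kappa> \<bullet> x + \<phi> + 2 * pi * of_int n"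
      by (simp add: inner_add_right j(2) inner_matrix_vector \<kappa> n del: transpose_matrix_vector)
    then have "cos (\<kappa> \<bullet> (x + \<gamma>) + \<phi>) = cos (\<kappa> \<bullet> x + \<phi>)"
      by (simp only: cos_add[of "\<kappa> \<bullet> x + \<phi>"] cos_int_2pin sin_int_2pin mult_1_right mult_zero_right diff_zero)
    then show "v (x + \<gamma>) * (1 * cos (\<kappa> \<bullet> (x + \<gamma>) + \<phi>)) = v x * (1 * cos (\<kappa> \<bullet> x + \<phi>))"
      using per[OF \<gamma>] by simp
  qed
  moreover have "integral (cbox 0 1) (\<lambda>y. F' i (A *v y))
    = integral (cbox 0 1) (\<lambda>y. partial_deriv i v (A *v y) * cos (\<kappa> \<bullet> (A *v y) + \<phi>))
      + integral (cbox 0 1) (\<lambda>y. \<kappa> $ i * (v (A *v y) * cos (\<kappa> \<bullet> (A *v y) + (\<phi> + pi / 2))))"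
  proof (subst Henstock_Kurzweil_Integration.integral_add[symmetric])
    show "(\<lambda>y. partial_deriv i v (A *v y) * cos (\<kappa> \<bullet> (A *v y) + \<phi>)) integrable_on cbox 0 1"
      "(\<lambda>y. \<kappa> $ i * (v (A *v y) * cos (\<kappa> \<bullet> (A *v y) + (\<phi> + pi / 2)))) integrable_on cbox 0 1"
      by (intro integrable_continuous continuous_on_mult continuous_on_const
          continuous_on_matrix_compose[of "\<lambda>x. cos (\<kappa> \<bullet> x + _)"] continuous_on_matrix_compose[of v]
          continuous_on_matrix_compose[of "partial_deriv i v"]
          helmholtz_solution_continuous[OF v]; intro continuous_intros)+
  qed (simp add: F'_def mult_ac)
  ultimately show ?thesis by simp
qed

text \<open>Both sides are compared through Fourier coefficients. The Helmholtz equation kills those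
  of \<open>u\<close> at frequencies off the unit sphere, and at the others the symbol of the second
  operator is the constant \<open>c\<close>.\<close>

lemma periodic_helmholtz_extra_equation:
  fixes u :: "real^'n::finite \<Rightarrow> real"
  assumes A: "invertible (A :: real^'n^'n)" and u: "helmholtz_solution 1 u"
    and per: "\<And>x \<gamma>. \<gamma> \<in> lattice_of A \<Longrightarrow> u (x + \<gamma>) = u x"
    and a: "\<And>\<kappa> k. norm \<kappa> = 1 \<Longrightarrow> integer_vector k \<Longrightarrow> transpose A *v \<kappa> = (2 * pi) *\<^sub>R k \<Longrightarrow>
      (\<Sum>i\<in>UNIV. \<Sum>j\<in>UNIV. a i j * \<kappa> $ i * \<kappa> $ j) = c"
  shows "(\<Sum>i\<in>UNIV. \<Sum>j\<in>UNIV. a i j * partial_deriv i (partial_deriv j u) x) = - c * u x"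
proof -
  let ?I = "\<lambda>\<kappa> v \<phi>. integral (cbox 0 1) (\<lambda>y. v (A *v y) * cos (\<kappa> \<bullet> (A *v y) + \<phi>))"
  define E where "E x = (\<Sum>i\<in>UNIV. \<Sum>j\<in>UNIV. a i j * partial_deriv i (partial_deriv j u) x) + c * u x" for x
  have perD: "partial_deriv i u (x + \<gamma>) = partial_deriv i u x" if "\<gamma> \<in> lattice_of A" for x \<gamma> i
    by (rule periodic_partial_deriv[OF u per[OF that]])
  have perDD: "partial_deriv i (partial_deriv j u) (x + \<gamma>) = partial_deriv i (partial_deriv j u) x"
    if "\<gamma> \<in> lattice_of A" for x \<gamma> i j
    by (rule periodic_partial_deriv[OF helmholtz_partial_deriv(1)[OF u] perD[OF that]])
  have hasI: "((\<lambda>y. v (A *v y) * cos (\<kappa> \<bullet> (A *v y) + \<phi>)) has_integral ?I \<kappa> v \<phi>) (cbox 0 1)"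
    if "helmholtz_solution 1 v" for v \<kappa> \<phi>
    by (intro integrable_integral integrable_continuous continuous_on_mult
        continuous_on_matrix_compose[of v] continuous_on_matrix_compose[of "\<lambda>x. cos (\<kappa> \<bullet> x + _)"]
        helmholtz_solution_continuous[OF that]) (intro continuous_intros)
  have second: "?I \<kappa> (partial_deriv i (partial_deriv j u)) \<phi> = - (\<kappa> $ i * \<kappa> $ j) * ?I \<kappa> u \<phi>"
    if k: "integer_vector k" "transpose A *v \<kappa> = (2 * pi) *\<^sub>R k" for \<kappa> k i j \<phi>
  proof -
    have "cos (z + (\<phi> + pi / 2 + pi / 2)) = - cos (z + \<phi>)" for z
      by (metis (no_types, lifting) add.assoc cos_periodic_pi field_sum_of_halves)
    then have "?I \<kappa> u (\<phi> + pi / 2 + pi / 2) = - ?I \<kappa> u \<phi>"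
      by simp
    then show ?thesis
      using fourier_coefficient_partial_deriv[OF A helmholtz_partial_deriv(1)[OF u] perD k(2,1), of i j \<phi>]
        fourier_coefficient_partial_deriv[OF A u per k(2,1), of j "\<phi> + pi / 2"] by simp
  qed
  have zero: "?I \<kappa> E \<phi> = 0"
    if k: "integer_vector k" "transpose A *v \<kappa> = (2 * pi) *\<^sub>R k" for \<kappa> k \<phi>
  proof -
    have h: "helmholtz_solution 1 (partial_deriv i (partial_deriv j u))" for i j
      by (intro helmholtz_partial_deriv u)
    have sum: "((\<lambda>y. \<Sum>i\<in>UNIV. partial_deriv i (partial_deriv i u) (A *v y) * cos (\<kappa> \<bullet> (A *v y) + \<phi>))
      has_integral (\<Sum>i\<in>UNIV. ?I \<kappa> (partial_deriv i (partial_deriv i u)) \<phi>)) (cbox 0 1)"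
      by (intro has_integral_sum hasI h finite)
    have eq: "(\<lambda>y. \<Sum>i\<in>UNIV. partial_deriv i (partial_deriv i u) (A *v y) * cos (\<kappa> \<bullet> (A *v y) + \<phi>))
      = (\<lambda>y. (- 1) * (u (A *v y) * cos (\<kappa> \<bullet> (A *v y) + \<phi>)))"
      using helmholtz_solutionD(4)[OF u] by (simp flip: sum_distrib_right)
    have "(\<Sum>i\<in>UNIV. ?I \<kappa> (partial_deriv i (partial_deriv i u)) \<phi>) = (- 1) * ?I \<kappa> u \<phi>"
      by (rule has_integral_unique[OF sum[unfolded eq] has_integral_mult_right[OF hasI[OF u]]])
    moreover have "(\<Sum>i\<in>UNIV. ?I \<kappa> (partial_deriv i (partial_deriv i u)) \<phi>) = - (norm \<kappa>)\<^sup>2 * ?I \<kappa> u \<phi>"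
      unfolding second[OF k] by (simp add: power2_norm_eq_inner inner_vec_def sum_negf flip: sum_distrib_right)
    ultimately have "((norm \<kappa>)\<^sup>2 - 1) * ?I \<kappa> u \<phi> = 0"
      by (simp add: left_diff_distrib)
    \<comment> \<open>Integrating the Helmholtz equation against the wave multiplies the coefficient
      by \<open>- (norm \<kappa>)\<^sup>2\<close> on one side and by \<open>- 1\<close> on the
      other.\<close>
    then have dich: "norm \<kappa> = 1 \<or> ?I \<kappa> u \<phi> = 0"
      using power2_eq_1_iff[of "norm \<kappa>"] norm_ge_zero[of \<kappa>] by auto
    have "((\<lambda>y. (\<Sum>i\<in>UNIV. \<Sum>j\<in>UNIV. a i j * (partial_deriv i (partial_deriv j u) (A *v y) * cos (\<kappa> \<bullet> (A *v y) + \<phi>)))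
        + c * (u (A *v y) * cos (\<kappa> \<bullet> (A *v y) + \<phi>))) has_integral
      (\<Sum>i\<in>UNIV. \<Sum>j\<in>UNIV. a i j * ?I \<kappa> (partial_deriv i (partial_deriv j u)) \<phi>) + c * ?I \<kappa> u \<phi>) (cbox 0 1)"
      by (intro has_integral_add has_integral_sum has_integral_mult_right hasI h u finite)
    then have "?I \<kappa> E \<phi> = (\<Sum>i\<in>UNIV. \<Sum>j\<in>UNIV. a i j * ?I \<kappa> (partial_deriv i (partial_deriv j u)) \<phi>) + c * ?I \<kappa> u \<phi>"
      by (intro integral_unique) (simp add: E_def distrib_right sum_distrib_right mult.assoc)
    also have "\<dots> = (c - (\<Sum>i\<in>UNIV. \<Sum>j\<in>UNIV. a i j * \<kappa> $ i * \<kappa> $ j)) * ?I \<kappa> u \<phi>"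
      unfolding second[OF k] by (simp add: left_diff_distrib sum_distrib_right sum_negf mult.assoc)
    also have "\<dots> = 0"
      using dich a[OF _ k] by auto
    finally show ?thesis .
  qed
  have contE: "continuous_on UNIV E"
    unfolding E_def by (intro continuous_intros helmholtz_solution_continuous[OF u] helmholtz_solutionD(3)[OF u])
  have perE: "E (x + \<gamma>) = E x" if "\<gamma> \<in> lattice_of A" for x \<gamma>
    unfolding E_def using perDD[OF that] per[OF that] by simp
  have WE: "E (A *v y) = 0" for y
  proof (rule fourier_completeness[of "\<lambda>y. E (A *v y)"])
    show "continuous_on UNIV (\<lambda>y. E (A *v y))" by (rule continuous_on_matrix_compose[OF contE])
    show "E (A *v (y + k)) = E (A *v y)" if "integer_vector k" for y k
      using perE[of "A *v k" "A *v y"] that by (auto simp: matrix_vector_right_distrib lattice_of_iff)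
    fix k :: "real^'n" and \<phi> :: real assume k: "integer_vector k"
    define \<kappa> where "\<kappa> = (2 * pi) *\<^sub>R (matrix_inv (transpose A) *v k)"
    have \<kappa>: "transpose A *v \<kappa> = (2 * pi) *\<^sub>R k"
      unfolding \<kappa>_def matrix_vector_mult_scaleR dual_basis_inverse(2)[OF A] ..
    have "\<kappa> \<bullet> (A *v y) = ((2 * pi) *\<^sub>R k) \<bullet> y" for y
      unfolding inner_matrix_vector \<kappa> ..
    with zero[OF k \<kappa>, of \<phi>] show "integral (cbox 0 1) (\<lambda>y. E (A *v y) * cos (((2 * pi) *\<^sub>R k) \<bullet> y + \<phi>)) = 0"
      by simp
  qed
  obtain A' where A': "A ** A' = mat 1" using A by (auto simp: invertible_def)
  have "x = A *v (A' *v x)" by (simp add: matrix_vector_mul_assoc A')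
  then have "E x = 0" using WE by metis
  then show ?thesis by (simp add: E_def eq_neg_iff_add_eq_0)
qed

section \<open>Integrality of the quadratic form\<close>

definition bilinear_form :: "('n::finite \<Rightarrow> 'n \<Rightarrow> real) \<Rightarrow> real^'n \<Rightarrow> real^'n \<Rightarrow> real" where
  "bilinear_form H x y = (\<Sum>i\<in>UNIV. \<Sum>j\<in>UNIV. H i j * x $ i * y $ j)"

lemma bilinear_bilinear_form: "bilinear (bilinear_form H)"
  unfolding bilinear_def bilinear_form_def
  by (auto intro!: linearI simp: algebra_simps sum.distrib sum_distrib_left)

lemma bilinear_form_axis: "bilinear_form H (axis i 1) (axis j 1) = H i j"
proof -
  have "(\<Sum>l\<in>UNIV. H k l * axis i 1 $ k * axis j 1 $ l) = (if k = i then H k j else 0)" for k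
  proof -
    have "(\<Sum>l\<in>UNIV. H k l * axis i 1 $ k * axis j 1 $ l)
        = (\<Sum>l\<in>UNIV. if l = j then H k l * axis i 1 $ k else 0)"
      by (intro sum.cong) (auto simp: axis_def)
    then show ?thesis by (simp add: axis_def)
  qed
  then show ?thesis by (simp add: bilinear_form_def)
qed

lemma bilinear_form_linear_image:
  fixes f :: "real^'n::finite \<Rightarrow> real^'n"
  assumes "linear f"
  shows "bilinear_form H (f x) (f y)
    = bilinear_form (\<lambda>p q. bilinear_form H (f (axis p 1)) (f (axis q 1))) x y"
proof -
  have f: "f z = (\<Sum>p\<in>UNIV. z $ p *\<^sub>R f (axis p 1))" for z
  proof -
    have "f z = f (\<Sum>p\<in>UNIV. z $ p *\<^sub>R axis p 1)"
      using basis_expansion[of z] by (simp add: scalar_mult_eq_scaleR)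
    then show ?thesis by (simp add: linear_sum[OF assms] linear_cmul[OF assms])
  qed
  have "bilinear_form H (f x) (f y)
      = (\<Sum>(p, q)\<in>UNIV \<times> UNIV. bilinear_form H (x $ p *\<^sub>R f (axis p 1)) (y $ q *\<^sub>R f (axis q 1)))"
    by (subst f[of x], subst f[of y]) (rule bilinear_sum[OF bilinear_bilinear_form])
  also have "\<dots> = (\<Sum>(p, q)\<in>UNIV \<times> UNIV. bilinear_form H (f (axis p 1)) (f (axis q 1)) * x $ p * y $ q)"
    by (simp add: bilinear_lmul[OF bilinear_bilinear_form] bilinear_rmul[OF bilinear_bilinear_form] mult_ac)
  finally show ?thesis
    by (simp add: bilinear_form_def[of "\<lambda>p q. bilinear_form H (f (axis p 1)) (f (axis q 1))"] sum.cartesian_product)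
qed

lemma bilinear_form_scale: "bilinear_form H (c *\<^sub>R x) (c *\<^sub>R x) = c\<^sup>2 * bilinear_form H x x"
  by (simp add: bilinear_lmul[OF bilinear_bilinear_form] bilinear_rmul[OF bilinear_bilinear_form] power2_eq_square)

definition dual_gram :: "real^'n::finite^'n \<Rightarrow> 'n \<Rightarrow> 'n \<Rightarrow> real" where
  "dual_gram A i j = 4 * pi\<^sup>2 * ((matrix_inv (transpose A) *v axis i 1) \<bullet> (matrix_inv (transpose A) *v axis j 1))"

lemma lattice_form_eq_bilinear_form: "lattice_form A k = bilinear_form (dual_gram A) k k"
proof -
  define B where "B = matrix_inv (transpose A)"
  define H where "H i j = (if i = j then 4 * pi\<^sup>2 else 0)" for i j :: 'a
  have H: "bilinear_form H x y = 4 * pi\<^sup>2 * (x \<bullet> y)" for x y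
  proof -
    have "bilinear_form H x y = (\<Sum>i\<in>UNIV. \<Sum>j\<in>UNIV. if j = i then 4 * pi\<^sup>2 * x $ i * y $ j else 0)"
      unfolding bilinear_form_def H_def by (intro sum.cong) auto
    then show ?thesis by (simp add: inner_vec_def sum_distrib_left mult_ac)
  qed
  have "lattice_form A k = bilinear_form H (B *v k) (B *v k)"
    by (simp add: lattice_form_def H B_def power2_norm_eq_inner)
  also have "\<dots> = bilinear_form (\<lambda>p q. bilinear_form H (B *v axis p 1) (B *v axis q 1)) k k"
    by (rule bilinear_form_linear_image) (rule matrix_vector_mul_linear)
  also have "(\<lambda>p q. bilinear_form H (B *v axis p 1) (B *v axis q 1)) = dual_gram A"
    by (intro ext) (simp add: H dual_gram_def B_def)
  finally show ?thesis .
qed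

section \<open>Rational dependence of the coefficients\<close>

lemma rational_common_denominator:
  fixes F :: "rat set"
  assumes "finite F"
  shows "\<exists>N::int. N > 0 \<and> (\<forall>r\<in>F. \<exists>m::int. of_rat r * of_int N = (of_int m :: real))"
  using assms
proof (induction F rule: finite_induct)
  case empty
  then show ?case by (intro exI[of _ 1]) simp
next
  case (insert r F)
  obtain N where N: "N > 0" "\<And>s. s \<in> F \<Longrightarrow> \<exists>m::int. of_rat s * of_int N = (of_int m :: real)"
    using insert.IH by blast
  obtain p q where pq: "r = Fract p q" "q > 0" by (cases r) auto
  have r: "of_rat r * of_int q = (of_int p :: real)"
    using pq by (simp add: of_rat_rat)
  show ?case
  proof (rule exI[of _ "N * q"], intro conjI ballI)
    show "N * q > 0" using N(1) pq(2) by simp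
    fix s assume s: "s \<in> insert r F"
    obtain m :: int where "of_rat s * of_int (N * q) = (of_int m :: real)"
    proof (cases "s = r")
      case True
      then have "of_rat s * of_int (N * q) = (of_int (p * N) :: real)"
        using r by (simp add: mult_ac)
      then show ?thesis by (rule that)
    next
      case False
      then obtain m :: int where "of_rat s * of_int N = (of_int m :: real)" using N(2) s by blast
      then have "of_rat s * of_int (N * q) = (of_int (m * q) :: real)"
        by (simp add: mult.assoc[symmetric])
      then show ?thesis by (rule that)
    qed
    then show "\<exists>m::int. of_rat s * of_int (N * q) = (of_int m :: real)" by blast
  qed
qed

lemma sum_pairs_ordered:
  fixes f :: "'n::{finite,linorder} \<Rightarrow> 'n \<Rightarrow> real"
  shows "(\<Sum>i\<in>UNIV. \<Sum>j\<in>UNIV. f i j) = (\<Sum>(i, j)\<in>{(i, j). i \<le> j}. if i = j then f i i else f i j + f j i)"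
proof -
  have "(\<Sum>i\<in>UNIV. \<Sum>j\<in>UNIV. f i j) = (\<Sum>(i, j)\<in>UNIV. f i j)"
    by (simp add: sum.cartesian_product)
  also have "\<dots> = (\<Sum>(i, j)\<in>{(i, j). i \<le> j} \<union> {(i, j). j < i}. f i j)"
    by (rule arg_cong[where f = "sum _"]) (auto simp: not_le)
  also have "\<dots> = (\<Sum>(i, j)\<in>{(i, j). i \<le> j}. f i j) + (\<Sum>(i, j)\<in>{(i, j). j < i}. f i j)"
    by (intro sum.union_disjoint) auto
  also have "(\<Sum>(i, j)\<in>{(i, j). j < i}. f i j) = (\<Sum>(i, j)\<in>{(i, j). i < j}. f j i)"
    by (rule sum.reindex_bij_witness[of _ prod.swap prod.swap]) auto
  also have "\<dots> = (\<Sum>(i, j)\<in>{(i, j). i \<le> j}. if i = j then 0 else f j i)"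
    by (rule sum.mono_neutral_cong_left) (auto simp: less_le split: if_splits)
  also have "(\<Sum>(i, j)\<in>{(i, j). i \<le> j}. f i j) + \<dots>
      = (\<Sum>(i, j)\<in>{(i, j). i \<le> j}. if i = j then f i i else f i j + f j i)"
    by (subst sum.distrib[symmetric]) (rule sum.cong, auto)
  finally show ?thesis .
qed

lemma integral_form_of_rational_ratios:
  fixes G :: "'n::{finite,linorder} \<Rightarrow> 'n \<Rightarrow> real"
  assumes "\<And>i j. \<exists>r::rat. G i j = of_rat r * g"
  shows "\<exists>c q. integral_quadratic_form q \<and> (\<forall>k. bilinear_form G k k = c * q k)"
proof -
  obtain r :: "'n \<Rightarrow> 'n \<Rightarrow> rat" where r: "\<And>i j. G i j = of_rat (r i j) * g"
    using assms by metis
  obtain N :: int where N: "N > 0" "\<And>i j. \<exists>m::int. of_rat (r i j) * of_int N = (of_int m :: real)"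
    using rational_common_denominator[of "range (\<lambda>(i, j). r i j)"] by auto
  obtain m :: "'n \<Rightarrow> 'n \<Rightarrow> int" where m: "\<And>i j. of_rat (r i j) * of_int N = (of_int (m i j) :: real)"
    using N(2) by metis
  \<comment> \<open>The two mixed terms are merged into one coefficient; the common denominator goes
    into the factor \<open>g / of_int N\<close>.\<close>
  define b where "b i j = (if i = j then m i i else m i j + m j i)" for i j
  define q where "q k = (\<Sum>(i, j)\<in>{(i, j). i \<le> j}. of_int (b i j) * (k $ i) * (k $ j))" for k :: "real^('n::{finite,linorder})"
  have "bilinear_form G k k = g / of_int N * q k" for k
  proof -
    have "bilinear_form G k k = (\<Sum>i\<in>UNIV. \<Sum>j\<in>UNIV. g / of_int N * (of_int (m i j) * k $ i * k $ j))"
      unfolding bilinear_form_def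
    proof (intro sum.cong refl)
      fix i j
      show "G i j * k $ i * k $ j = g / of_int N * (of_int (m i j) * k $ i * k $ j)"
        unfolding r m[symmetric] using N(1) by simp
    qed
    also have "\<dots> = g / of_int N * (\<Sum>i\<in>UNIV. \<Sum>j\<in>UNIV. of_int (m i j) * k $ i * k $ j)"
      by (simp add: sum_distrib_left)
    also have "(\<Sum>i\<in>UNIV. \<Sum>j\<in>UNIV. of_int (m i j) * k $ i * k $ j) = q k"
      unfolding sum_pairs_ordered q_def
      by (intro sum.cong) (auto simp: b_def algebra_simps)
    finally show ?thesis .
  qed
  moreover have "integral_quadratic_form q"
    unfolding integral_quadratic_form_def q_def by blast
  ultimately show ?thesis by blast
qed

text \<open>The reals form a vector space over the rationals in which \<open>x\<close> and
  \<open>g\<close> are independent, so values prescribed on them extend linearly. Only integer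
  scalars are recorded, as \<open>\<phi>\<close> is applied to values of \<open>Q\<close> at integer
  vectors.\<close>

lemma rational_linear_functional:
  fixes g x :: real
  assumes "g \<noteq> 0" "\<And>r::rat. x \<noteq> of_rat r * g"
  obtains \<phi> :: "real \<Rightarrow> real" where "\<And>a b. \<phi> (a + b) = \<phi> a + \<phi> b"
    "\<And>(n::int) a. \<phi> (of_int n * a) = of_int n * \<phi> a" "\<phi> g = 0" "\<phi> x = 1"
proof -
  let ?s = "\<lambda>(q::rat) (x::real). of_rat q * x"
  interpret V: vector_space ?s
    by unfold_locales (auto simp: of_rat_add of_rat_mult algebra_simps)
  interpret P: vector_space_pair ?s ?s ..
  have "V.independent {x, g}"
    using assms V.independent_insert[of x "{g}"] V.span_singleton[of g]
    by (auto simp: V.dependent_single)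
  then obtain \<phi> where lin: "Vector_Spaces.linear ?s ?s \<phi>" and \<phi>: "\<And>y. y \<in> {x, g} \<Longrightarrow> \<phi> y = (if y = x then 1 else 0)"
    using P.linear_independent_extend[of "{x, g}" "\<lambda>y. if y = x then 1 else 0"] by blast
  have "x \<noteq> g" using assms(2)[of 1] by simp
  show ?thesis
  proof (rule that[of \<phi>])
    show "\<phi> (a + b) = \<phi> a + \<phi> b" for a b
      using lin by (simp add: Vector_Spaces.linear_iff)
    show "\<phi> (of_int n * a) = of_int n * \<phi> a" for n a
    proof -
      have "\<phi> (?s (of_int n) a) = ?s (of_int n) (\<phi> a)"
        using lin by (simp only: Vector_Spaces.linear_iff)
      then show ?thesis by simp
    qed
    show "\<phi> g = 0" "\<phi> x = 1" using \<phi>[of g] \<phi>[of x] \<open>x \<noteq> g\<close> by auto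
  qed
qed

section \<open>The second equation in the limit\<close>

lemma iterated_partial_tendsto_of_Cl_norm:
  assumes "(\<lambda>n. Cl_norm l S (f n)) \<longlonglongrightarrow> 0" "length is \<le> l" "x \<in> S"
  shows "(\<lambda>n. iterated_partial is (f n) x) \<longlonglongrightarrow> 0"
proof -
  have "ennreal \<bar>iterated_partial is (f n) x\<bar> \<le> Cl_norm l S (f n)" for n
  proof (cases "Ck_on l (f n) S")
    case True
    have "ennreal \<bar>iterated_partial is (f n) x\<bar> \<le> (SUP x\<in>S. ennreal \<bar>iterated_partial is (f n) x\<bar>)"
      using assms(3) by (rule SUP_upper)
    also have "\<dots> \<le> Cl_norm l S (f n)"
      unfolding Cl_norm_def using True assms(2)
      by (auto intro!: SUP_upper2[of "is"])
    finally show ?thesis .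
  qed (simp add: Cl_norm_def)
  then have "(\<lambda>n. ennreal \<bar>iterated_partial is (f n) x\<bar>) \<longlonglongrightarrow> 0"
    by (intro tendsto_sandwich[OF always_eventually[OF allI[OF zero_le]] always_eventually[OF allI]
          tendsto_const assms(1)])
  then have "(\<lambda>n. \<bar>iterated_partial is (f n) x\<bar>) \<longlonglongrightarrow> 0"
    using tendsto_ennreal_iff[of "\<lambda>n. \<bar>iterated_partial is (f n) x\<bar>" sequentially 0] by simp
  then show ?thesis by (rule tendsto_rabs_zero_cancel)
qed

text \<open>
  Eigenfunctions whose frequencies, rescaled to the unit sphere, lie on a level set of one fixed
  quadratic form satisfy a second differential equation, which passes to limits.
\<close>

lemma no_inverse_localization:
  fixes \<Gamma> :: "(real^'n::finite) set"
  assumes extra: "\<And>\<mu> u. \<mu> > 0 \<Longrightarrow> laplace_eigenfunction \<Gamma> \<mu> u \<Longrightarrow>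
      \<exists>c. \<forall>x. (\<Sum>i\<in>UNIV. \<Sum>j\<in>UNIV. a i j * partial_deriv i (partial_deriv j (\<lambda>x. u (x /\<^sub>R sqrt \<mu>))) x)
        = - c * u (x /\<^sub>R sqrt \<mu>)"
    and \<xi>: "norm \<xi> = 1" "norm \<zeta> = 1" "bilinear_form a \<xi> \<xi> \<noteq> bilinear_form a \<zeta> \<zeta>"
  shows "\<not> inverse_localization \<Gamma>"
proof
  assume loc: "inverse_localization \<Gamma>"
  define S where "S z = bilinear_form a z z" for z
  define e where "e z x = 1 * cos (z \<bullet> x + 0)" for z x :: "real^'n"
  have he: "helmholtz_solution 1 (e z)" if "norm z = 1" for z
    unfolding e_def[abs_def] by (rule helmholtz_plane_wave) (simp add: that)
  \<comment> \<open>Two waves on which the second operator has different symbols; the sum has the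
    value 2 at the origin.\<close>
  define h where "h x = 1 * e \<xi> x + 1 * e \<zeta> x" for x
  have hh: "helmholtz_solution 1 h"
    unfolding h_def[abs_def] by (intro helmholtz_lincomb he \<xi>)
  have De: "iterated_partial [i, j] (e z) x = - (z $ i * z $ j * e z x)" for i j z x
    unfolding e_def[abs_def] iterated_partial_plane_wave by simp
  have Dh: "iterated_partial [i, j] h x = - (\<xi> $ i * \<xi> $ j * e \<xi> x) - \<zeta> $ i * \<zeta> $ j * e \<zeta> x" for i j x
    unfolding h_def[abs_def] iterated_partial_lincomb[OF he[OF \<xi>(1)] he[OF \<xi>(2)]] De by simp
  obtain u \<mu> where eig: "\<And>n. laplace_eigenfunction \<Gamma> (\<mu> n) (u n)"
    and \<mu>: "filterlim \<mu> at_top sequentially"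
    and lim: "(\<lambda>n. Cl_norm 2 (ball 0 1) (\<lambda>x. u n (x /\<^sub>R sqrt (\<mu> n)) - h x)) \<longlonglongrightarrow> 0"
    using loc[unfolded inverse_localization_def, rule_format, of h 1 2 0] hh by auto
  define v where "v n x = u n (x /\<^sub>R sqrt (\<mu> n))" for n x
  have ev: "\<forall>\<^sub>F n in sequentially. \<mu> n > 0"
    using \<mu> by (simp add: filterlim_at_top_dense)
  have hv: "helmholtz_solution 1 (v n)" if "\<mu> n > 0" for n
  proof -
    have "helmholtz_solution 1 (\<lambda>x. u n (inverse (sqrt (\<mu> n)) *\<^sub>R x + 0))"
      using eig[of n] that
      by (intro helmholtz_affine[of "\<mu> n"]) (auto simp: laplace_eigenfunction_def power_inverse)
    then show ?thesis by (simp add: v_def[abs_def])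
  qed
  have conv: "(\<lambda>n. iterated_partial is (v n) x) \<longlonglongrightarrow> iterated_partial is h x"
    if "length is \<le> 2" "x \<in> ball 0 1" for "is" x
  proof -
    have ev_eq: "\<forall>\<^sub>F n in sequentially. iterated_partial is (\<lambda>x. u n (x /\<^sub>R sqrt (\<mu> n)) - h x) x
        = iterated_partial is (v n) x - iterated_partial is h x"
      using ev
    proof eventually_elim
      case (elim n)
      have "(\<lambda>x. u n (x /\<^sub>R sqrt (\<mu> n)) - h x) = (\<lambda>x. 1 * v n x + (- 1) * h x)" by (simp add: v_def)
      then show ?case by (simp only: iterated_partial_lincomb[OF hv[OF elim] hh])
    qed
    have "(\<lambda>n. iterated_partial is (v n) x - iterated_partial is h x) \<longlonglongrightarrow> 0"
      by (rule Lim_transform_eventually[OF iterated_partial_tendsto_of_Cl_norm[OF lim that] ev_eq])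
    then show ?thesis by (simp add: LIM_zero_iff)
  qed
  define P where "P n c \<longleftrightarrow> (\<mu> n > 0 \<longrightarrow> (\<forall>x.
      (\<Sum>i\<in>UNIV. \<Sum>j\<in>UNIV. a i j * partial_deriv i (partial_deriv j (v n)) x) = - c * v n x))" for n c
  have "\<exists>c. P n c" for n
  proof (cases "\<mu> n > 0")
    case True
    from extra[OF True eig] show ?thesis unfolding P_def v_def[abs_def] by blast
  qed (simp add: P_def)
  then obtain c where "\<And>n. P n (c n)" by metis
  then have c: "\<And>n x. \<mu> n > 0 \<Longrightarrow>
      (\<Sum>i\<in>UNIV. \<Sum>j\<in>UNIV. a i j * partial_deriv i (partial_deriv j (v n)) x) = - c n * v n x"
    unfolding P_def by blast
  define T where "T x = S \<xi> * e \<xi> x + S \<zeta> * e \<zeta> x" for x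
  have Th: "(\<Sum>i\<in>UNIV. \<Sum>j\<in>UNIV. a i j * iterated_partial [i, j] h x) = - T x" for x
  proof -
    define p q where "p = e \<xi> x" and "q = e \<zeta> x"
    have "(\<Sum>i\<in>UNIV. \<Sum>j\<in>UNIV. a i j * iterated_partial [i, j] h x)
        = (\<Sum>i\<in>UNIV. \<Sum>j\<in>UNIV. - (a i j * \<xi> $ i * \<xi> $ j * p) - a i j * \<zeta> $ i * \<zeta> $ j * q)"
      unfolding Dh p_def[symmetric] q_def[symmetric]
      by (intro sum.cong refl) (simp add: right_diff_distrib)
    also have "\<dots> = - (S \<xi> * p + S \<zeta> * q)"
      by (simp add: S_def bilinear_form_def sum_subtractf sum_negf sum_distrib_right)
    finally show ?thesis by (simp add: T_def p_def q_def)
  qed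
  have cv: "(\<lambda>n. c n * v n x) \<longlonglongrightarrow> T x" if "x \<in> ball 0 1" for x
  proof -
    have "(\<lambda>n. \<Sum>i\<in>UNIV. \<Sum>j\<in>UNIV. a i j * iterated_partial [i, j] (v n) x)
        \<longlonglongrightarrow> (\<Sum>i\<in>UNIV. \<Sum>j\<in>UNIV. a i j * iterated_partial [i, j] h x)"
      by (intro tendsto_sum tendsto_mult tendsto_const conv that) simp
    moreover have "\<forall>\<^sub>F n in sequentially.
        (\<Sum>i\<in>UNIV. \<Sum>j\<in>UNIV. a i j * iterated_partial [i, j] (v n) x) = - (c n * v n x)"
      using ev by eventually_elim (simp add: c)
    ultimately have "(\<lambda>n. - (c n * v n x)) \<longlonglongrightarrow> - T x"
      unfolding Th by (rule Lim_transform_eventually)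
    then show ?thesis by (simp add: tendsto_minus_cancel_left[symmetric])
  qed
  have v0: "(\<lambda>n. v n x) \<longlonglongrightarrow> h x" if "x \<in> ball 0 1" for x
    using conv[of "[]" x] that by simp
  \<comment> \<open>The constants \<open>c n\<close> come without any bound. Since
    \<open>v n 0\<close> tends to 2, division at the origin makes them converge, to the mean of the
    two symbols.\<close>
  define c0 where "c0 = (S \<xi> + S \<zeta>) / 2"
  have c0: "c \<longlonglongrightarrow> c0"
  proof -
    have h0: "h 0 = 2" by (simp add: h_def e_def)
    have "(\<lambda>n. c n * v n 0 / v n 0) \<longlonglongrightarrow> T 0 / h 0"
      by (intro tendsto_divide cv v0) (auto simp: h0)
    moreover have "\<forall>\<^sub>F n in sequentially. v n 0 > 1"
      using v0[of 0] by (rule order_tendstoD) (auto simp: h0)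
    then have "\<forall>\<^sub>F n in sequentially. c n * v n 0 / v n 0 = c n"
      by eventually_elim auto
    ultimately have "c \<longlonglongrightarrow> T 0 / h 0" by (rule Lim_transform_eventually)
    then show ?thesis by (simp add: h0 T_def e_def c0_def)
  qed
  have "e \<xi> x = e \<zeta> x" if "x \<in> ball 0 1" for x
  proof -
    have "(\<lambda>n. c n * v n x) \<longlonglongrightarrow> c0 * h x"
      by (intro tendsto_mult c0 v0 that)
    with cv[OF that] have "T x = c0 * h x" by (rule LIMSEQ_unique)
    then have "(S \<xi> - S \<zeta>) * (e \<xi> x - e \<zeta> x) = 0"
      by (simp add: T_def h_def c0_def field_simps)
    then show ?thesis using \<xi>(3) by (simp add: S_def)
  qed
  \<comment> \<open>The two waves would coincide on the unit ball. At half of \<open>\<xi>\<close>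
    this forces the Cauchy-Schwarz inequality to be an equality, so \<open>\<zeta>\<close> is
    \<open>\<xi>\<close> or \<open>- \<xi>\<close>, where the form takes the same value.\<close>
  from this[of "\<xi> /\<^sub>R 2"] have "cos (1 / 2) = cos (\<bar>\<zeta> \<bullet> \<xi>\<bar> / 2)"
    using \<xi>(1) by (simp add: e_def norm_eq_1 abs_if)
  moreover have "\<bar>\<zeta> \<bullet> \<xi>\<bar> \<le> 1" using Cauchy_Schwarz_ineq2[of \<zeta> \<xi>] \<xi> by simp
  ultimately have "\<bar>\<zeta> \<bullet> \<xi>\<bar> = 1"
    using cos_inj_pi[of "1 / 2" "\<bar>\<zeta> \<bullet> \<xi>\<bar> / 2"] pi_gt3 by simp
  then have "\<zeta> = \<xi> \<or> \<zeta> = - \<xi>"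
    using norm_cauchy_schwarz_abs_eq[of \<zeta> \<xi>] \<xi> by auto
  moreover have "bilinear_form a (- \<xi>) (- \<xi>) = bilinear_form a \<xi> \<xi>"
    using bilinear_form_scale[of a "- 1" \<xi>] by simp
  ultimately show False using \<xi>(3) by auto
qed

lemma integral_form_of_inverse_localization:
  fixes A :: "real^('n::{finite,linorder})^('n::{finite,linorder})"
  assumes A: "invertible A" and loc: "inverse_localization (lattice_of A)"
  shows "\<exists>c q. integral_quadratic_form q \<and> (\<forall>k. lattice_form A k = c * q k)"
proof (rule ccontr)
  assume not: "\<not> ?thesis"
  define B where "B = matrix_inv (transpose A)"
  define G where "G = dual_gram A"
  have Q: "lattice_form A k = bilinear_form G k k" for k
    by (simp add: G_def lattice_form_eq_bilinear_form)
  have Gsym: "G i j = G j i" for i j by (simp add: G_def dual_gram_def inner_commute)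
  fix t :: 'n
  define g where "g = G t t"
  have g: "g > 0"
  proof -
    have "B *v axis t 1 \<noteq> 0" unfolding B_def dual_basis_eq_0_iff[OF A] by (simp add: axis_eq_0_iff)
    then show ?thesis by (simp add: g_def G_def dual_gram_def B_def)
  qed
  obtain a b where ab: "\<And>r::rat. G a b \<noteq> of_rat r * g"
    using not integral_form_of_rational_ratios[of G g] unfolding Q by blast
  obtain \<phi> :: "real \<Rightarrow> real" where \<phi>: "\<And>a b. \<phi> (a + b) = \<phi> a + \<phi> b"
      "\<And>(n::int) a. \<phi> (of_int n * a) = of_int n * \<phi> a" "\<phi> g = 0" "\<phi> (G a b) = 1"
    using rational_linear_functional[of g "G a b"] g ab by (metis less_irrefl)
  interpret additive \<phi> by unfold_locales (rule \<phi>(1))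
  \<comment> \<open>The functional applied coefficientwise; at integer vectors this gives
    \<open>\<phi>\<close> of the value of \<open>Q\<close>, hence a constant on each level
    set.\<close>
  define H where "H i j = \<phi> (G i j)" for i j
  have H: "\<phi> (lattice_form A k) = bilinear_form H k k" if k: "integer_vector k" for k
  proof -
    have "\<phi> (G i j * k $ i * k $ j) = H i j * k $ i * k $ j" for i j
    proof -
      obtain m n :: int where mn: "k $ i = of_int m" "k $ j = of_int n"
        using k unfolding integer_vector_def by (metis Ints_cases)
      have "\<phi> (of_int (m * n) * G i j) = of_int (m * n) * H i j" unfolding H_def by (rule \<phi>(2))
      then show ?thesis by (simp add: mn mult_ac)
    qed
    then show ?thesis unfolding Q bilinear_form_def sum by simp
  qed
  \<comment> \<open>Inverse of the map that sends an integer vector to its frequency;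
    \<open>s\<close> below is the form \<open>H\<close> in frequency coordinates.\<close>
  define L where "L \<kappa> = (1 / (2 * pi)) *\<^sub>R (transpose A *v \<kappa>)" for \<kappa>
  have linL: "linear L"
    unfolding L_def
    by (intro linear_compose_scale_right matrix_vector_mul_linear)
  define s where "s p q = bilinear_form H (L (axis p 1)) (L (axis q 1))" for p q
  have s: "bilinear_form s \<kappa> \<kappa> = bilinear_form H (L \<kappa>) (L \<kappa>)" for \<kappa>
    unfolding s_def by (rule bilinear_form_linear_image[OF linL, symmetric])
  have QL: "lattice_form A (L \<kappa>) = (norm \<kappa>)\<^sup>2" for \<kappa>
    by (simp add: lattice_form_def L_def matrix_vector_mult_scaleR dual_basis_inverse[OF A] power_divide
        power_mult_distrib del: transpose_matrix_vector)
  have LB: "L ((2 * pi) *\<^sub>R (B *v k)) = k" for k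
    by (simp add: L_def B_def matrix_vector_mult_scaleR dual_basis_inverse[OF A] del: transpose_matrix_vector)
  \<comment> \<open>Otherwise \<open>H = c0 * Q\<close> as forms. The coefficient \<open>g\<close>
    is killed by \<open>\<phi>\<close>, which forces \<open>c0 = 0\<close>, but \<open>G a b\<close>
    is mapped to 1.\<close>
  have "\<exists>\<xi> \<zeta>. norm \<xi> = 1 \<and> norm \<zeta> = 1 \<and> bilinear_form s \<xi> \<xi> \<noteq> bilinear_form s \<zeta> \<zeta>"
  proof (rule ccontr)
    assume const: "\<not> ?thesis"
    define c0 where "c0 = bilinear_form s (axis t 1) (axis t 1)"
    have c0: "bilinear_form s \<xi> \<xi> = c0" if "norm \<xi> = 1" for \<xi>
      using const that norm_axis_1[of t] unfolding c0_def by blast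
    have HQ: "bilinear_form H k k = c0 * lattice_form A k" for k
    proof (cases "k = 0")
      case True
      then show ?thesis by (simp add: bilinear_form_def lattice_form_def)
    next
      case False
      define \<kappa> where "\<kappa> = (2 * pi) *\<^sub>R (B *v k)"
      have "\<kappa> \<noteq> 0" using False unfolding \<kappa>_def B_def by (simp add: dual_basis_eq_0_iff[OF A])
      define y where "y = \<kappa> /\<^sub>R norm \<kappa>"
      have y: "norm y = 1" "norm \<kappa> *\<^sub>R y = \<kappa>" using \<open>\<kappa> \<noteq> 0\<close> by (simp_all add: y_def)
      have "bilinear_form s \<kappa> \<kappa> = (norm \<kappa>)\<^sup>2 * c0"
        using bilinear_form_scale[of s "norm \<kappa>" y] unfolding y(2) c0[OF y(1)] .
      then have "bilinear_form H (L \<kappa>) (L \<kappa>) = (norm \<kappa>)\<^sup>2 * c0" unfolding s .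
      then show ?thesis unfolding QL[symmetric] by (simp add: \<kappa>_def LB)
    qed
    have "c0 * g = 0"
      using HQ[of "axis t 1"] \<phi>(3) by (simp add: bilinear_form_axis Q H_def g_def)
    then have "c0 = 0" using g by simp
    then have H0: "bilinear_form H k k = 0" for k using HQ by simp
    have "bilinear_form H (axis a 1 + axis b 1) (axis a 1 + axis b 1) = H a a + H a b + H b a + H b b"
      by (simp add: bilinear_ladd[OF bilinear_bilinear_form] bilinear_radd[OF bilinear_bilinear_form] bilinear_form_axis)
    moreover have "H a a = 0" "H b b = 0"
      using H0[of "axis a 1"] H0[of "axis b 1"] by (simp_all add: bilinear_form_axis)
    moreover have "H a b = 1" "H b a = 1" using \<phi>(4) Gsym[of a b] by (simp_all add: H_def)
    ultimately show False using H0[of "axis a 1 + axis b 1"] by simp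
  qed
  then obtain \<xi> \<zeta> where \<xi>\<zeta>: "norm \<xi> = 1" "norm \<zeta> = 1" "bilinear_form s \<xi> \<xi> \<noteq> bilinear_form s \<zeta> \<zeta>"
    by blast
  have "\<not> inverse_localization (lattice_of A)"
  proof (rule no_inverse_localization[OF _ \<xi>\<zeta>])
    fix \<mu> u assume \<mu>: "\<mu> > 0" and u: "laplace_eigenfunction (lattice_of A) \<mu> u"
    define v where "v x = u (x /\<^sub>R sqrt \<mu>)" for x
    \<comment> \<open>The period lattice of the eigenfunction after rescaling its eigenvalue to
      1.\<close>
    define A' where "A' = sqrt \<mu> *\<^sub>R A"
    have A': "invertible A'" unfolding A'_def using \<mu> A by (intro scalar_invertible) auto
    have hv: "helmholtz_solution 1 v"
    proof -
      have "helmholtz_solution 1 (\<lambda>x. u (inverse (sqrt \<mu>) *\<^sub>R x + 0))"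
        using u \<mu> by (intro helmholtz_affine[of \<mu>]) (auto simp: laplace_eigenfunction_def power_inverse)
      then show ?thesis by (simp add: v_def[abs_def])
    qed
    have per: "v (x + \<gamma>) = v x" if \<gamma>: "\<gamma> \<in> lattice_of A'" for x \<gamma>
    proof -
      obtain k where k: "integer_vector k" "\<gamma> = A' *v k" using \<gamma> by (auto simp: lattice_of_iff)
      have "(x + \<gamma>) /\<^sub>R sqrt \<mu> = x /\<^sub>R sqrt \<mu> + A *v k"
        using \<mu> by (simp add: k(2) A'_def scaleR_matrix_vector_assoc[symmetric] scaleR_add_right)
      moreover have "A *v k \<in> lattice_of A" using k(1) by (auto simp: lattice_of_iff)
      ultimately show ?thesis using u by (simp add: v_def laplace_eigenfunction_def)
    qed
    \<comment> \<open>A unit frequency of the rescaled lattice comes from an integer vector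
      \<open>k\<close> with \<open>Q\<close> equal to \<open>\<mu>\<close> at \<open>k\<close>,
      where \<open>H\<close> has the value \<open>\<phi> \<mu>\<close>; scaling back divides by
      \<open>\<mu>\<close>.\<close>
    have level: "(\<Sum>i\<in>UNIV. \<Sum>j\<in>UNIV. s i j * \<kappa> $ i * \<kappa> $ j) = \<phi> \<mu> / \<mu>"
      if "norm \<kappa> = 1" "integer_vector k" "transpose A' *v \<kappa> = (2 * pi) *\<^sub>R k" for \<kappa> k
    proof -
      have "L (sqrt \<mu> *\<^sub>R \<kappa>) = (1 / (2 * pi)) *\<^sub>R (transpose A' *v \<kappa>)"
        by (simp add: L_def A'_def transpose_scalar scaleR_matrix_vector_assoc[symmetric] matrix_vector_mult_scaleR
            del: transpose_matrix_vector)
      also have "\<dots> = k" unfolding that(3) by simp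
      finally have Lk: "L (sqrt \<mu> *\<^sub>R \<kappa>) = k" .
      have "\<mu> * bilinear_form s \<kappa> \<kappa> = bilinear_form s (sqrt \<mu> *\<^sub>R \<kappa>) (sqrt \<mu> *\<^sub>R \<kappa>)"
        using \<mu> by (simp add: bilinear_form_scale)
      also have "\<dots> = \<phi> (lattice_form A k)" unfolding s Lk H[OF that(2)] ..
      also have "lattice_form A k = \<mu>" using QL[of "sqrt \<mu> *\<^sub>R \<kappa>"] \<mu> that(1) by (simp add: Lk)
      finally show ?thesis using \<mu> by (simp add: bilinear_form_def field_simps)
    qed
    show "\<exists>c. \<forall>x. (\<Sum>i\<in>UNIV. \<Sum>j\<in>UNIV. s i j * partial_deriv i (partial_deriv j (\<lambda>x. u (x /\<^sub>R sqrt \<mu>))) x)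
        = - c * u (x /\<^sub>R sqrt \<mu>)"
      unfolding v_def[symmetric, abs_def]
      by (intro exI[of _ "\<phi> \<mu> / \<mu>"] allI)
        (rule periodic_helmholtz_extra_equation[OF A' hv per level]; assumption)
  qed
  with loc show False by simp
qed

lemma integral_quadratic_form_Ints:
  assumes "integral_quadratic_form q" "integer_vector k"
  shows "q k \<in> \<int>"
  using assms unfolding integral_quadratic_form_def integer_vector_def
  by (auto intro!: Ints_sum Ints_mult)

theorem theorem1p2:
  fixes A :: "real^('n::{finite,linorder})^('n::{finite,linorder})" and \<Gamma> :: "(real^('n::{finite,linorder})) set"
  assumes "CARD('n) \<ge> 2"
    and "invertible A"
    and "\<Gamma> = lattice_of A"
  shows "inverse_localization \<Gamma> \<longleftrightarrow>
    (\<exists>(c::real) q. integral_quadratic_form q \<and> (\<forall>k. lattice_form A k = c * q k))"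
proof
  assume "inverse_localization \<Gamma>"
  then show "\<exists>c q. integral_quadratic_form q \<and> (\<forall>k. lattice_form A k = c * q k)"
    using integral_form_of_inverse_localization assms(2,3) by blast
next
  assume "\<exists>c q. integral_quadratic_form q \<and> (\<forall>k. lattice_form A k = c * q k)"
  then obtain c q where q: "integral_quadratic_form q" "\<And>k. lattice_form A k = c * q k" by blast
  show "inverse_localization \<Gamma>"
    unfolding assms(3)
    by (rule inverse_localization_of_integral_form[OF assms(2) q(2) integral_quadratic_form_Ints[OF q(1)]])
qed

end
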